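(* Let $n\ge 1$, let $\mu\in\mathrm{WComp}_{n-1}$ and let $k\ge 1$ be such that $\mathrm{supp}(\mu)\subseteq[k]$. Then there is an isomorphism of $\mathfrak{S}_n$-modules $$\mathcal{L}ie(\mu)\simeq_{\mathfrak{S}_n}\widetilde H^{n-3}((\hat 0,[n]^{\mu}))\otimes \mathrm{sgn}_n,$$ where $(\hat 0,[n]^\mu)$ is the open interval in the weighted partition poset $\Pi_n^k$ and $\mathrm{sgn}_n$ is the sign representation.
   Context: Fix a field $\mathbf{k}$. A weak composition is a sequence $\mu=(\mu(1),\mu(2),\dots)$ of nonnegative integers with finite sum $|\mu|=\sum_i\mu(i)$; $\mathrm{WComp}_n$ is the set of weak compositions with $|\mu|=n$, and $\mathrm{supp}(\mu)=\{j:\mu(j)\neq0\}$. Weak compositions are added and compared componentwise; $\mathbf{e}_r$ has a $1$ in position $r$ and $0$ elsewhere. A Lie bracket on a vector space is a bilinear antisymmetric product satisfying the Jacobi identity; a set of Lie brackets is compatible if every linear combination of them is a Lie bracket. Consider brackets $[\cdot,\cdot]_j$ indexed by $j\in\mathbb{P}=\{1,2,\dots\}$. $\mathcal{L}ie_{\mathbb{P}}(n)$ is the $\mathbf{k}$-vector space spanned by all (mixed) bracketed permutations of $[n]$ (bracketings, with each bracket carrying a type $j\in\mathbb{P}$, in which each element of $[n]$ occurs exactly once), subject only to antisymmetry and the Jacobi identity for each bracket type and the compatibility relations for every set of bracket types (equivalently, for each pair $i\neq j$, the mixed Jacobi relation $[x,[y,z]_j]_i+[z,[x,y]_j]_i+[y,[z,x]_j]_i+[x,[y,z]_i]_j+[z,[x,y]_i]_j+[y,[z,x]_i]_j=0$).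 For $\mu\in\mathrm{WComp}_{n-1}$, $\mathcal{L}ie(\mu)$ is the subspace spanned by bracketed permutations having exactly $\mu(j)$ brackets of type $j$ for each $j$. $\mathfrak{S}_n$ acts by replacing each letter $i$ by $\tau(i)$. The poset $\Pi_n^k$: its elements are weighted partitions $\{B_1^{\mu_1},\dots,B_t^{\mu_t}\}$ where $\{B_1,\dots,B_t\}$ is a set partition of $[n]$ and $\mu_i\in\mathrm{WComp}_{|B_i|-1}$ with $\mathrm{supp}(\mu_i)\subseteq[k]$. The cover relation: $\{A_1^{\mu_1},\dots,A_s^{\mu_s}\}\lessdot\{B_1^{\nu_1},\dots,B_t^{\nu_t}\}$ iff the second is obtained from the first by merging two blocks $A_{i_1},A_{i_2}$ into $B_j=A_{i_1}\cup A_{i_2}$ with $\nu_j=\mu_{i_1}+\mu_{i_2}+\mathbf{e}_r$ for some $r\in[k]$, all other blocks unchanged with the same weights. It has minimum $\hat0=\{\{1\}^{0},\dots,\{n\}^{0}\}$ and maximal elements $[n]^\mu:=\{[n]^\mu\}$ for $\mu\in\mathrm{WComp}_{n-1}$ with $\mathrm{supp}(\mu)\subseteq[k]$. $\mathfrak{S}_n$ acts on $\Pi_n^k$ by permuting elements of blocks, fixing each $[n]^\mu$, hence acts on the reduced simplicial cohomology (over $\mathbf{k}$) of the order complex of each open interval $(\hat0,[n]^\mu)$. *)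

theory Defs
  imports
    Complex_Main
    "HOL-Library.Poly_Mapping"
    "HOL-Library.Function_Algebras"
    "HOL-Library.Set_Algebras"
    "HOL-Library.Disjoint_Sets"
    "HOL-Combinatorics.Permutations"
begin

section \<open>Function spaces over a field and their subquotients\<close>

definition fscale :: "'k::field \<Rightarrow> ('x \<Rightarrow> 'k) \<Rightarrow> 'x \<Rightarrow> 'k" where
  "fscale c f = (\<lambda>x. c * f x)"

global_interpretation fun_space: vector_space "fscale :: 'k::field \<Rightarrow> ('x \<Rightarrow> 'k) \<Rightarrow> 'x \<Rightarrow> 'k"
  by unfold_locales (auto simp: fscale_def fun_eq_iff algebra_simps)

definition basis_fun :: "'x \<Rightarrow> 'x \<Rightarrow> 'k::field" where
  "basis_fun x = (\<lambda>y. if y = x then 1 else 0)"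

text \<open>
  A representation over \<open>'k\<close> of a group of permutations of the natural numbers, given by its
  data. Only the operations on the carrier are meaningful.
\<close>

record ('k, 'v) rep =
  rep_carrier :: "'v set"
  rep_add :: "'v \<Rightarrow> 'v \<Rightarrow> 'v"
  rep_scale :: "'k \<Rightarrow> 'v \<Rightarrow> 'v"
  rep_act :: "(nat \<Rightarrow> nat) \<Rightarrow> 'v \<Rightarrow> 'v"

text \<open>Isomorphism of modules over the symmetric group on \<open>{1..n}\<close>.\<close>

definition rep_iso :: "nat \<Rightarrow> ('k, 'v) rep \<Rightarrow> ('k, 'w) rep \<Rightarrow> bool" where
  "rep_iso n M N \<longleftrightarrow> (\<exists>f. bij_betw f (rep_carrier M) (rep_carrier N) \<and>
     (\<forall>x\<in>rep_carrier M. \<forall>y\<in>rep_carrier M. f (rep_add M x y) = rep_add N (f x) (f y)) \<and>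
     (\<forall>c. \<forall>x\<in>rep_carrier M. f (rep_scale M c x) = rep_scale N c (f x)) \<and>
     (\<forall>\<tau>. \<tau> permutes {1..n} \<longrightarrow> (\<forall>x\<in>rep_carrier M. f (rep_act M \<tau> x) = rep_act N \<tau> (f x))))"

text \<open>
  For a linear action \<open>a\<close> on functions and subspaces \<open>V\<close> and \<open>W\<close> stable under it: the image of
  \<open>V\<close> in the quotient by \<open>W\<close>, whose elements are the cosets \<open>v +o W\<close> with \<open>v \<in> V\<close>. Adding \<open>W\<close>
  in the scalar multiplication matters for the scalar 0 only.
\<close>

definition subquotient ::
  "('x \<Rightarrow> 'k::field) set \<Rightarrow> ('x \<Rightarrow> 'k) set \<Rightarrow> ((nat \<Rightarrow> nat) \<Rightarrow> ('x \<Rightarrow> 'k) \<Rightarrow> ('x \<Rightarrow> 'k)) \<Rightarrow>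
   ('k, ('x \<Rightarrow> 'k) set) rep" where
  "subquotient V W a =
    \<lparr>rep_carrier = (\<lambda>v. v +o W) ` V,
     rep_add = (\<lambda>X Y. X + Y),
     rep_scale = (\<lambda>c X. fscale c ` X + W),
     rep_act = (\<lambda>\<tau> X. a \<tau> ` X)\<rparr>"

text \<open>
  The linear extension of an action \<open>\<rho>\<close> on basis elements: it sends \<open>basis_fun x\<close> to
  \<open>basis_fun (\<rho> \<tau> x)\<close>.
\<close>

definition perm_act :: "((nat \<Rightarrow> nat) \<Rightarrow> 'x \<Rightarrow> 'x) \<Rightarrow> (nat \<Rightarrow> nat) \<Rightarrow> ('x \<Rightarrow> 'k::field) \<Rightarrow> 'x \<Rightarrow> 'k" where
  "perm_act \<rho> \<tau> f = (\<lambda>x. f (\<rho> (inv \<tau>) x))"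

text \<open>
  The tensor product over \<open>'k\<close>: the space freely spanned by the pairs, modulo bilinearity, with
  the diagonal action.
\<close>

definition tensor_relations :: "('k::field, 'v) rep \<Rightarrow> ('k, 'w) rep \<Rightarrow> ('v \<times> 'w \<Rightarrow> 'k) set" where
  "tensor_relations M N =
     {basis_fun (rep_add M v v', w) - basis_fun (v, w) - basis_fun (v', w) | v v' w.
        v \<in> rep_carrier M \<and> v' \<in> rep_carrier M \<and> w \<in> rep_carrier N} \<union>
     {basis_fun (v, rep_add N w w') - basis_fun (v, w) - basis_fun (v, w') | v w w'.
        v \<in> rep_carrier M \<and> w \<in> rep_carrier N \<and> w' \<in> rep_carrier N} \<union>
     {basis_fun (rep_scale M c v, w) - fscale c (basis_fun (v, w)) | c v w.
        v \<in> rep_carrier M \<and> w \<in> rep_carrier N} \<union>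
     {basis_fun (v, rep_scale N c w) - fscale c (basis_fun (v, w)) | c v w.
        v \<in> rep_carrier M \<and> w \<in> rep_carrier N}"

definition tensor_rep ::
  "('k::field, 'v) rep \<Rightarrow> ('k, 'w) rep \<Rightarrow> ('k, ('v \<times> 'w \<Rightarrow> 'k) set) rep" where
  "tensor_rep M N = subquotient
     (fun_space.span (basis_fun ` (rep_carrier M \<times> rep_carrier N)))
     (fun_space.span (tensor_relations M N))
     (\<lambda>\<tau> f (v, w). if v \<in> rep_carrier M \<and> w \<in> rep_carrier N
        then f (rep_act M (inv \<tau>) v, rep_act N (inv \<tau>) w) else 0)"

definition sgn_rep :: "('k::field, 'k) rep" where
  "sgn_rep = \<lparr>rep_carrier = UNIV, rep_add = (+), rep_scale = (*),
     rep_act = (\<lambda>\<tau> x. of_int (sign \<tau>) * x)\<rparr>"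

section \<open>Weak compositions\<close>

text \<open>
  The sequence \<open>\<mu>(1), \<mu>(2), \<dots>\<close> is a finitely supported function on the naturals that vanishes
  at 0; its support is \<open>Poly_Mapping.keys \<mu>\<close>, and \<open>e\<^sub>r\<close> is \<open>Poly_Mapping.single r 1\<close>.
\<close>

definition wcomp :: "nat \<Rightarrow> (nat \<Rightarrow>\<^sub>0 nat) set" where
  "wcomp n = {\<mu>. 0 \<notin> Poly_Mapping.keys \<mu> \<and> (\<Sum>j\<in>Poly_Mapping.keys \<mu>. Poly_Mapping.lookup \<mu> j) = n}"

section \<open>The free Lie algebra with many compatible brackets, multilinear part\<close>

text \<open>\<open>Bracket j x y\<close> is \<open>[x, y]\<^sub>j\<close>.\<close>

datatype 'a bracketing = Letter 'a | Bracket nat "'a bracketing" "'a bracketing"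

primrec letters :: "'a bracketing \<Rightarrow> 'a list" where
  "letters (Letter a) = [a]"
| "letters (Bracket j x y) = letters x @ letters y"

primrec bracket_types :: "'a bracketing \<Rightarrow> nat list" where
  "bracket_types (Letter a) = []"
| "bracket_types (Bracket j x y) = j # bracket_types x @ bracket_types y"

definition bracketed_perms :: "nat \<Rightarrow> nat bracketing set" where
  "bracketed_perms n =
     {t. distinct (letters t) \<and> set (letters t) = {1..n} \<and> 0 \<notin> set (bracket_types t)}"

text \<open>
  \<open>lie_rel ts\<close> says that the sum of the list \<open>ts\<close> is one of the defining relations (antisymmetry,
  Jacobi for each bracket type, mixed Jacobi for each pair of types), possibly inside further
  brackets; all their coefficients can be taken to be 1.
\<close>

inductive lie_rel :: "'a bracketing list \<Rightarrow> bool" where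
  antisym: "lie_rel [Bracket j x y, Bracket j y x]"
| jacobi: "lie_rel [Bracket j x (Bracket j y z), Bracket j z (Bracket j x y),
                    Bracket j y (Bracket j z x)]"
| mixed_jacobi: "i \<noteq> j \<Longrightarrow>
    lie_rel [Bracket i x (Bracket j y z), Bracket i z (Bracket j x y), Bracket i y (Bracket j z x),
             Bracket j x (Bracket i y z), Bracket j z (Bracket i x y), Bracket j y (Bracket i z x)]"
| left_context: "lie_rel ts \<Longrightarrow> lie_rel (map (\<lambda>t. Bracket j t u) ts)"
| right_context: "lie_rel ts \<Longrightarrow> lie_rel (map (\<lambda>t. Bracket j u t) ts)"

definition lie_relations :: "nat \<Rightarrow> (nat bracketing \<Rightarrow> 'k::field) set" where
  "lie_relations n = fun_space.span
     {(\<Sum>t\<leftarrow>ts. basis_fun t) | ts. lie_rel ts \<and> set ts \<subseteq> bracketed_perms n}"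

definition Lie_P :: "nat \<Rightarrow> ('k::field, (nat bracketing \<Rightarrow> 'k) set) rep" where
  "Lie_P n = subquotient
     (fun_space.span (basis_fun ` bracketed_perms n)) (lie_relations n)
     (perm_act map_bracketing)"

text \<open>The subspace of \<open>Lie_P n\<close> spanned by the bracketed permutations of content \<open>\<mu>\<close>.\<close>

definition Lie :: "nat \<Rightarrow> (nat \<Rightarrow>\<^sub>0 nat) \<Rightarrow> ('k::field, (nat bracketing \<Rightarrow> 'k) set) rep" where
  "Lie n \<mu> = (Lie_P n)\<lparr>rep_carrier := (\<lambda>v. v +o lie_relations n) ` fun_space.span (basis_fun `
     {t \<in> bracketed_perms n. \<forall>j. count_list (bracket_types t) j = Poly_Mapping.lookup \<mu> j})\<rparr>"

section \<open>The poset of weighted partitions\<close>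

type_synonym wpartition = "(nat set \<times> (nat \<Rightarrow>\<^sub>0 nat)) set"

definition weighted_partitions :: "nat \<Rightarrow> nat \<Rightarrow> wpartition set" where
  "weighted_partitions n k = {P. partition_on {1..n} (fst ` P) \<and> inj_on fst P \<and>
     (\<forall>(B, \<beta>)\<in>P. \<beta> \<in> wcomp (card B - 1) \<and> Poly_Mapping.keys \<beta> \<subseteq> {1..k})}"

definition wp_cover :: "nat \<Rightarrow> nat \<Rightarrow> wpartition \<Rightarrow> wpartition \<Rightarrow> bool" where
  "wp_cover n k P Q \<longleftrightarrow> P \<in> weighted_partitions n k \<and> Q \<in> weighted_partitions n k \<and>
     (\<exists>A \<alpha> B \<beta>. \<exists>r\<in>{1..k}. (A, \<alpha>) \<in> P \<and> (B, \<beta>) \<in> P \<and> A \<noteq> B \<and>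
        Q = (P - {(A, \<alpha>), (B, \<beta>)}) \<union> {(A \<union> B, \<alpha> + \<beta> + Poly_Mapping.single r 1)})"

definition wp_less :: "nat \<Rightarrow> nat \<Rightarrow> wpartition \<Rightarrow> wpartition \<Rightarrow> bool" where
  "wp_less n k = (wp_cover n k)\<^sup>+\<^sup>+"

definition wp_bot :: "nat \<Rightarrow> wpartition" where
  "wp_bot n = (\<lambda>i. ({i}, 0)) ` {1..n}"

definition wp_top :: "nat \<Rightarrow> (nat \<Rightarrow>\<^sub>0 nat) \<Rightarrow> wpartition" where
  "wp_top n \<mu> = {({1..n}, \<mu>)}"

definition wp_act :: "(nat \<Rightarrow> nat) \<Rightarrow> wpartition \<Rightarrow> wpartition" where
  "wp_act \<tau> P = (\<lambda>(B, \<beta>). (\<tau> ` B, \<beta>)) ` P"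

section \<open>Reduced cohomology of order complexes\<close>

text \<open>
  A face of an order complex is a finite chain, listed increasingly; the empty chain is a face
  of dimension \<open>-1\<close>. For the one-element interval \<open>[x, x]\<close> (which occurs for \<open>n = 1\<close>) we follow
  the usual convention of poset topology: the order complex of \<open>(x, x)\<close> is the degenerate empty
  complex without any face, whose reduced cohomology is the field in degree \<open>-2\<close> and 0 elsewhere.
  In \<open>faces\<close> this is achieved by a formal generator in dimension \<open>-2\<close>.
\<close>

definition open_interval_complex :: "('p \<Rightarrow> 'p \<Rightarrow> bool) \<Rightarrow> 'p \<Rightarrow> 'p \<Rightarrow> 'p list set" where
  "open_interval_complex lt x y =
     (if x = y then {} else {c. sorted_wrt lt c \<and> set c \<subseteq> {z. lt x z \<and> lt z y}})"

definition faces :: "'p list set \<Rightarrow> int \<Rightarrow> 'p list set" where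
  "faces \<Delta> r = (if \<Delta> = {} then (if r = -2 then {[]} else {})
     else {c \<in> \<Delta>. int (length c) = r + 1})"

definition cochains :: "'p list set \<Rightarrow> int \<Rightarrow> ('p list \<Rightarrow> 'k::field) set" where
  "cochains \<Delta> r = {\<phi>. \<forall>c. c \<notin> faces \<Delta> r \<longrightarrow> \<phi> c = 0}"

definition coboundary :: "'p list set \<Rightarrow> int \<Rightarrow> ('p list \<Rightarrow> 'k::field) \<Rightarrow> 'p list \<Rightarrow> 'k" where
  "coboundary \<Delta> r \<phi> = (\<lambda>c. if c \<in> faces \<Delta> (r + 1)
     then (\<Sum>i<length c. (- 1) ^ i * \<phi> (take i c @ drop (Suc i) c)) else 0)"

definition reduced_cohomology ::
  "'p list set \<Rightarrow> ((nat \<Rightarrow> nat) \<Rightarrow> 'p \<Rightarrow> 'p) \<Rightarrow> int \<Rightarrow> ('k::field, ('p list \<Rightarrow> 'k) set) rep" where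
  "reduced_cohomology \<Delta> \<rho> r = subquotient
     {\<phi> \<in> cochains \<Delta> r. coboundary \<Delta> r \<phi> = 0}
     (coboundary \<Delta> (r - 1) ` cochains \<Delta> (r - 1))
     (perm_act (\<lambda>\<tau>. map (\<rho> \<tau>)))"

end

theory Submission
  imports Defs
begin

text \<open>
  In top degree every cochain is a cocycle, so the cohomology has the maximal chains as generators, and
  its relations say that the sum over all elements filling a gap of rank two in a chain vanishes.
  There are three kinds of gaps: two disjoint merges (two fillings, which only permits to reorder the
  merges up to sign), three blocks merged with the same type twice (three fillings, a Jacobi relation)
  or with two different types (six fillings, a mixed Jacobi relation).

  To keep track of signs, consider functions \<open>H L c\<close> of a forest \<open>L\<close> (a list of bracketings) and a
  saturated chain \<open>c\<close> from the weighted partition of \<open>L\<close> to the top. Trees are treated as odd elements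
  of an exterior algebra: \<open>H\<close> should be alternating in \<open>L\<close>, and splitting the root bracket of the
  \<open>i\<close>-th tree moves the partition of \<open>L\<close> into the chain at the cost of the sign \<open>(-1)\<^sup>i\<close>. Such a function
  is determined by its values on single trees, and also by its values on forests of leaves, and it
  respects the Lie relations if and only if it respects the gap relations. Building trees from a chain
  and chains from a tree both produce such functions, and they are therefore inverse to each other.
\<close>

text \<open>The signs fit together for the following reason. A bracket turns two odd trees into one
  odd tree, so it is itself an odd operation: two brackets in different trees anticommute, because
  splitting the one in front shifts the position of the other by one. This is the relation of the
  gaps with two fillings. Exchanging the arguments of a bracket costs a sign as well, which is
  antisymmetry. On forests of leaves, alternation means that a word of letters contributes the sign
  of its permutation; relabelling by \<tau> multiplies it by the sign of \<tau>, and this is the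
  origin of the factor \<open>sgn_rep\<close>. The obstacle is that both constructions involve
  choices: a chain does not order the two blocks that it merges, and a tree does not order its
  brackets. Each construction fixes an order, and independence of it has to be derived from the
  relations of the target. No basis or dimension of either side is computed: two linear maps are
  defined on generators, send relations to relations, and are inverse to each other modulo
  relations.\<close>

text \<open>
  Values in an arbitrary abelian group make it possible to compute with equations in a quotient instead
  of congruences.
\<close>

definition sg :: "nat \<Rightarrow> 'v::ab_group_add \<Rightarrow> 'v" where
  "sg m x = (if even m then x else - x)"

lemma sg_simps [simp]:
  "sg 0 x = x" "sg (Suc m) x = - sg m x" "sg m (- x) = - sg m x" "sg m 0 = 0"
  "sg m (sg m x) = x" "sg (m + l) x = sg m (sg l x)" "sg m x = sg m y \<longleftrightarrow> x = y"
  "sg m x = 0 \<longleftrightarrow> x = 0"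
  by (auto simp: sg_def)

lemma sg_sum: "sg m (\<Sum>i\<in>A. f i) = (\<Sum>i\<in>A. sg m (f i))"
  by (auto simp: sg_def sum_negf)

lemma sg_sum_list: "sg m (\<Sum>x\<leftarrow>xs. f x) = (\<Sum>x\<leftarrow>xs. sg m (f x))"
  by (auto simp: sg_def uminus_sum_list_map comp_def)

lemma sg_commute: "sg m (sg l x) = sg l (sg m x)"
  by (auto simp: sg_def)

text \<open>Exchanges are counted on the lists themselves and not through a permutation, since
  alternation is a statement about adjacent entries. The count need not be minimal; it only enters
  through \<open>sg\<close>, that is, through its parity.\<close>

inductive swaps :: "nat \<Rightarrow> 'a list \<Rightarrow> 'a list \<Rightarrow> bool" where
  swaps_refl: "swaps 0 xs xs"
| swaps_step: "swaps m (as @ y # x # bs) ys \<Longrightarrow> swaps (Suc m) (as @ x # y # bs) ys"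

lemma swaps_trans: "swaps m xs ys \<Longrightarrow> swaps l ys zs \<Longrightarrow> swaps (m + l) xs zs"
  by (induction rule: swaps.induct) (auto intro: swaps_step)

lemma swaps_context: "swaps m xs ys \<Longrightarrow> swaps m (as @ xs @ bs) (as @ ys @ bs)"
proof (induction rule: swaps.induct)
  case (swaps_step m cs y x ds ys)
  then show ?case using swaps.swaps_step[of m "as @ cs" y x "ds @ bs"] by simp
qed (rule swaps_refl)

lemma swaps_to_front: "swaps (length as) (as @ x # bs) (x # as @ bs)"
proof (induction as arbitrary: bs rule: rev_induct)
  case (snoc a as)
  then show ?case using swaps_step[of "length as" as x a bs] by (simp add: snoc[of "a # bs"])
qed (simp add: swaps_refl)

lemma swaps_exists: "mset xs = mset ys \<Longrightarrow> \<exists>m. swaps m xs ys"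
proof (induction ys arbitrary: xs)
  case (Cons y ys)
  then have "y \<in> set xs"
    by (metis list.set_intros(1) mset_eq_setD)
  then obtain as bs where xs: "xs = as @ y # bs"
    by (meson split_list)
  with Cons.prems have "mset (as @ bs) = mset ys"
    by simp
  then obtain m where "swaps m (as @ bs) ys"
    using Cons.IH by blast
  then have "swaps m (y # as @ bs) (y # ys)"
    using swaps_context[of m "as @ bs" ys "[y]" "[]"] by simp
  then have "swaps (length as + m) (as @ y # bs) (y # ys)"
    by (rule swaps_trans[OF swaps_to_front])
  then show ?case
    using xs by blast
qed (auto intro: swaps_refl)

section \<open>Forests and weighted partitions\<close>

type_synonym wblock = "nat set \<times> (nat \<Rightarrow>\<^sub>0 nat)"

section \<open>Blocks of trees and their merges\<close>

primrec content :: "'a bracketing \<Rightarrow> nat \<Rightarrow>\<^sub>0 nat" where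
  "content (Letter a) = 0"
| "content (Bracket r x y) = content x + content y + Poly_Mapping.single r 1"

definition wblock :: "nat bracketing \<Rightarrow> wblock" where
  "wblock t = (set (letters t), content t)"

definition part :: "nat bracketing list \<Rightarrow> wpartition" where
  "part L = wblock ` set L"

definition join :: "nat \<Rightarrow> wblock \<Rightarrow> wblock \<Rightarrow> wblock" where
  "join r a b = (fst a \<union> fst b, snd a + snd b + Poly_Mapping.single r 1)"

definition merge :: "wpartition \<Rightarrow> nat \<Rightarrow> wblock \<Rightarrow> wblock \<Rightarrow> wpartition" where
  "merge P r a b = insert (join r a b) (P - {a, b})"

text \<open>What remains of the partition condition when \<open>n\<close>, \<open>k\<close> and the
  weights are forgotten. It suffices to reconstruct a merge from its result, and it is preserved by
  merging.\<close>

definition disjoint_blocks :: "wpartition \<Rightarrow> bool" where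
  "disjoint_blocks P \<longleftrightarrow> (\<forall>a\<in>P. fst a \<noteq> {}) \<and> (\<forall>a\<in>P. \<forall>b\<in>P. a \<noteq> b \<longrightarrow> fst a \<inter> fst b = {})"

lemma lookup_content: "Poly_Mapping.lookup (content t) j = count_list (bracket_types t) j"
  by (induction t) (auto simp: lookup_add lookup_single)

lemma keys_content: "Poly_Mapping.keys (content t) = set (bracket_types t)"
  by (auto simp: in_keys_iff lookup_content count_list_0_iff)

lemma letters_nonempty [simp]: "letters t \<noteq> []"
  by (induction t) auto

lemma length_bracket_types: "Suc (length (bracket_types t)) = length (letters t)"
  by (induction t) auto

lemma sum_content: "(\<Sum>j\<in>Poly_Mapping.keys (content t). Poly_Mapping.lookup (content t) j) = length (letters t) - 1"
proof -
  have "(\<Sum>j\<in>Poly_Mapping.keys (content t). Poly_Mapping.lookup (content t) j) = length (bracket_types t)"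
    by (simp add: keys_content lookup_content sum_count_set)
  then show ?thesis
    using length_bracket_types[of t] by simp
qed

lemma wblock_Bracket: "wblock (Bracket r x y) = join r (wblock x) (wblock y)"
  by (simp add: wblock_def join_def)

lemma part_simps [simp]: "part [] = {}" "part (t # L) = insert (wblock t) (part L)"
  "part (L @ L') = part L \<union> part L'"
  by (auto simp: part_def)

lemma part_cong_mset: "mset L = mset L' \<Longrightarrow> part L = part L'"
  unfolding part_def by (metis mset_eq_setD)

text \<open>A block of \<open>P\<close> that equals the join meets both \<open>a\<close> and
  \<open>b\<close>, and by disjointness it would have to be both of them.\<close>

lemma join_neq:
  assumes "disjoint_blocks P" "a \<in> P" "b \<in> P" "a \<noteq> b" "c \<in> P"
  shows "c \<noteq> join r a b"
proof
  assume c: "c = join r a b"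
  then have "fst c = fst a \<union> fst b" by (simp add: join_def)
  moreover have "fst a \<noteq> {}" "fst b \<noteq> {}" "fst a \<inter> fst b = {}"
    using assms by (auto simp: disjoint_blocks_def)
  ultimately have "fst c \<inter> fst a \<noteq> {}" "fst c \<inter> fst b \<noteq> {}"
    by auto
  then have "c = a" "c = b" using assms by (auto simp: disjoint_blocks_def)
  then show False using assms by blast
qed

lemma merge_diff:
  assumes "disjoint_blocks P" "a \<in> P" "b \<in> P" "a \<noteq> b"
  shows "P - merge P r a b = {a, b}" and "merge P r a b - P = {join r a b}"
  using join_neq[OF assms, of _ r] assms by (auto simp: merge_def)

lemma single_inject: "Poly_Mapping.single r (1::nat) = Poly_Mapping.single s 1 \<longleftrightarrow> r = s"
  by (metis lookup_single_eq lookup_single_not_eq zero_neq_one)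

lemma join_inject: "join r a b = join s a b \<longleftrightarrow> r = s"
  unfolding join_def using single_inject by (metis add_left_cancel prod.inject)

lemma join_commute: "join r a b = join r b a"
  by (auto simp: join_def ac_simps)

lemma merge_commute: "merge P r a b = merge P r b a"
  by (auto simp: merge_def join_commute insert_commute)

text \<open>The blocks that disappear reveal the merged pair, and the single block that appears
  reveals the type through its weight. The fillings of a gap are told apart in this way.\<close>

lemma merge_inject:
  assumes "disjoint_blocks P" "a \<in> P" "b \<in> P" "a \<noteq> b" "c \<in> P" "d \<in> P" "c \<noteq> d"
  shows "merge P r a b = merge P s c d \<longleftrightarrow> {a, b} = {c, d} \<and> r = s"
proof
  assume eq: "merge P r a b = merge P s c d"
  have ab: "{a, b} = {c, d}"
    using merge_diff(1)[of P a b r] merge_diff(1)[of P c d s] assms eq by simp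
  have "join r a b = join s c d"
    using merge_diff(2)[of P a b r] merge_diff(2)[of P c d s] assms eq by auto
  with ab have "join r a b = join s a b"
    by (auto simp: doubleton_eq_iff join_commute)
  then show "{a, b} = {c, d} \<and> r = s"
    using ab join_inject by blast
qed (auto simp: doubleton_eq_iff merge_commute)

lemma disjoint_blocks_merge:
  assumes "disjoint_blocks P" "a \<in> P" "b \<in> P" "a \<noteq> b"
  shows "disjoint_blocks (merge P r a b)"
  using assms unfolding disjoint_blocks_def merge_def join_def
  by (auto simp: Int_Un_distrib Int_Un_distrib2)

lemma disjoint_blocks_overlap:
  assumes "disjoint_blocks P" "a \<in> P" "b \<in> P" "x \<in> fst a" "x \<in> fst b"
  shows "a = b"
  using assms by (auto simp: disjoint_blocks_def)

text \<open>Let \<open>B\<close> be the block of the upper partition that contains the first join.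
  It contains two blocks of \<open>P\<close>, so it is not an untouched block but one of the two
  joins on the right, and the only blocks of \<open>P\<close> inside it are its two constituents.
  Hence \<open>a\<close> and \<open>b\<close> are these constituents.\<close>

lemma two_merges_disjoint:
  assumes P: "disjoint_blocks P" and in_P: "u \<in> P" "v \<in> P" "x \<in> P" "y \<in> P"
    and distinct: "distinct [u, v, x, y]"
    and ab: "a \<in> P" "b \<in> P" "a \<noteq> b"
    and cd: "c \<in> merge P q a b" "d \<in> merge P q a b" "c \<noteq> d"
    and eq: "merge (merge P q a b) t c d = merge (merge P r u v) s x y"
  shows "merge P q a b = merge P r u v \<or> merge P q a b = merge P s x y"
proof -
  let ?P2 = "merge (merge P r u v) s x y"
  have Q: "disjoint_blocks (merge P q a b)"
    using disjoint_blocks_merge P ab by blast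
  have P2: "disjoint_blocks ?P2"
    using disjoint_blocks_merge[OF Q cd, of t] eq by simp
  have P2_eq: "?P2 = insert (join s x y) (insert (join r u v) (P - {u, v, x, y}))"
    using join_neq[OF P, of u v _ r] in_P distinct by (auto simp: merge_def)
  let ?j = "join q a b"
  have j_or: "?j \<in> ?P2 \<or> ?j = c \<or> ?j = d"
    using eq[symmetric] by (auto simp: merge_def)
  \<comment> \<open>The first join either survives the second merge and is itself \<open>B\<close>,
    or it is one of \<open>c\<close> and \<open>d\<close> and \<open>B\<close> is the new
    block.\<close>
  obtain B where B: "B \<in> ?P2" "fst ?j \<subseteq> fst B" "?j \<in> ?P2 \<longrightarrow> B = ?j" "?j \<notin> ?P2 \<longrightarrow> B = join t c d"
  proof (cases "?j \<in> ?P2")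
    case False
    then have "fst ?j \<subseteq> fst (join t c d)" using j_or by (auto simp: join_def)
    then show ?thesis using that[of "join t c d"] False eq[symmetric] by (auto simp: merge_def)
  qed (use that in auto)
  have sub: "fst a \<subseteq> fst B" "fst b \<subseteq> fst B" using B(2) by (auto simp: join_def)
  have ne: "fst a \<noteq> {}" "fst b \<noteq> {}" using P ab by (auto simp: disjoint_blocks_def)
  have key: "merge P q a b = merge P r' e f"
    if ef: "e \<in> P" "f \<in> P" "e \<noteq> f" "B = join r' e f" for e f r'
  proof -
    have e: "z = e \<or> z = f" if z: "z \<in> P" "fst z \<subseteq> fst B" "fst z \<noteq> {}" for z
    proof -
      obtain w where "w \<in> fst z" using z by blast
      then have "w \<in> fst e \<or> w \<in> fst f" using z ef by (auto simp: join_def)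
      then show ?thesis using disjoint_blocks_overlap[OF P] ef z \<open>w \<in> fst z\<close> by blast
    qed
    have ab_ef: "{a, b} = {e, f}" using e[of a] e[of b] sub ne ab by auto
    have fstB: "fst B = fst ?j" using ab_ef ef by (auto simp: join_def doubleton_eq_iff)
    \<comment> \<open>Were \<open>?j\<close> absorbed by the second merge, \<open>B\<close> would
      contain a further nonempty block disjoint from \<open>?j\<close>, although \<open>B\<close>
      and \<open>?j\<close> have the same elements.\<close>
    have "?j \<in> ?P2"
    proof (rule ccontr)
      assume n: "?j \<notin> ?P2"
      then have Bcd: "B = join t c d" "?j = c \<or> ?j = d" using B j_or by auto
      have "fst c \<noteq> {}" "fst d \<noteq> {}" "fst c \<inter> fst d = {}" using Q cd by (auto simp: disjoint_blocks_def)
      moreover have "fst ?j = fst c \<union> fst d" using Bcd(1) fstB by (simp add: join_def)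
      ultimately show False using Bcd(2) by auto
    qed
    then have "join r' e f = join q a b" using B ef by simp
    then have "r' = q" using ab_ef join_inject by (metis doubleton_eq_iff join_commute)
    then show ?thesis using ab_ef by (auto simp: doubleton_eq_iff merge_commute)
  qed
  have "B \<notin> P - {u, v, x, y}"
  proof
    assume B': "B \<in> P - {u, v, x, y}"
    then have "a = B" "b = B"
      using disjoint_blocks_overlap[OF P] ab ne sub by (meson DiffD1 all_not_in_conv subsetD)+
    then show False using ab by simp
  qed
  then have "B = join s x y \<or> B = join r u v" using B(1) P2_eq by auto
  then show ?thesis using key[of u v r] key[of x y s] in_P distinct by auto
qed

text \<open>Here everything happens inside the block \<open>?J\<close> with constituents
  \<open>x\<close>, \<open>y\<close>, \<open>z\<close>: the first merge picks two of them and the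
  second adds the third. Comparing weights restricts the type of the first step to \<open>r\<close>
  and \<open>s\<close>. Pair and type are independent choices, whence three fillings for
  \<open>r = s\<close> and six otherwise.\<close>

lemma two_merges_three:
  assumes P: "disjoint_blocks P" and in_P: "x \<in> P" "y \<in> P" "z \<in> P"
    and distinct: "distinct [x, y, z]"
    and ab: "a \<in> P" "b \<in> P" "a \<noteq> b"
    and cd: "c \<in> merge P q a b" "d \<in> merge P q a b" "c \<noteq> d"
    and eq: "merge (merge P q a b) t c d = merge (merge P r x y) s (join r x y) z"
  shows "(q = r \<or> q = s) \<and> ({a, b} = {x, y} \<or> {a, b} = {y, z} \<or> {a, b} = {z, x})"
proof -
  let ?P2 = "merge (merge P r x y) s (join r x y) z"
  let ?J = "join s (join r x y) z"
  let ?j = "join q a b"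
  have Q: "disjoint_blocks (merge P q a b)"
    using disjoint_blocks_merge P ab by blast
  have P2: "disjoint_blocks ?P2"
    using disjoint_blocks_merge[OF Q cd, of t] eq by simp
  have P2_eq: "?P2 = insert ?J (P - {x, y, z})"
    using join_neq[OF P, of x y _ r] in_P distinct by (auto simp: merge_def)
  have ne: "fst a \<noteq> {}" "fst b \<noteq> {}" using P ab by (auto simp: disjoint_blocks_def)
  have j_or: "?j \<in> ?P2 \<or> ?j = c \<or> ?j = d"
    using eq[symmetric] by (auto simp: merge_def)
  obtain B where B: "B \<in> ?P2" "fst ?j \<subseteq> fst B" "?j \<in> ?P2 \<longrightarrow> B = ?j" "?j \<notin> ?P2 \<longrightarrow> B = join t c d"
  proof (cases "?j \<in> ?P2")
    case False
    then have "fst ?j \<subseteq> fst (join t c d)" using j_or by (auto simp: join_def)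
    then show ?thesis using that[of "join t c d"] False eq[symmetric] by (auto simp: merge_def)
  qed (use that in auto)
  have sub: "fst a \<subseteq> fst B" "fst b \<subseteq> fst B" using B(2) by (auto simp: join_def)
  have "B \<notin> P - {x, y, z}"
  proof
    assume B': "B \<in> P - {x, y, z}"
    then have "a = B" "b = B"
      using disjoint_blocks_overlap[OF P] ab ne sub by (meson DiffD1 all_not_in_conv subsetD)+
    then show False using ab by simp
  qed
  then have BJ: "B = ?J" using B(1) P2_eq by auto
  have e: "w = x \<or> w = y \<or> w = z" if w: "w \<in> P" "fst w \<subseteq> fst B" "fst w \<noteq> {}" for w
  proof -
    obtain l where "l \<in> fst w" using w by blast
    then have "l \<in> fst x \<or> l \<in> fst y \<or> l \<in> fst z" using w BJ by (auto simp: join_def)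
    then show ?thesis using disjoint_blocks_overlap[OF P] in_P w \<open>l \<in> fst w\<close> by blast
  qed
  have abxyz: "{a, b} = {x, y} \<or> {a, b} = {y, z} \<or> {a, b} = {z, x}"
    using e[of a] e[of b] sub ne ab by auto
  \<comment> \<open>\<open>w\<close> is the constituent left over by the first merge; it turns out
    to be the partner of the join in the second merge.\<close>
  then obtain w where w6: "a = x \<and> b = y \<and> w = z \<or> a = y \<and> b = x \<and> w = z \<or> a = y \<and> b = z \<and> w = x \<or>
      a = z \<and> b = y \<and> w = x \<or> a = z \<and> b = x \<and> w = y \<or> a = x \<and> b = z \<and> w = y"
    unfolding doubleton_eq_iff by blast
  have w: "w \<in> P" "w \<noteq> a" "w \<noteq> b"
    using w6 distinct in_P by auto
  have J_sum: "fst ?J = fst a \<union> fst b \<union> fst w"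
      "snd ?J = snd a + snd b + snd w + Poly_Mapping.single r 1 + Poly_Mapping.single s 1"
    using w6 by (auto simp: join_def ac_simps)
  have w_ne: "fst w \<noteq> {}" "fst w \<inter> fst a = {}" "fst w \<inter> fst b = {}"
    using P w ab by (auto simp: disjoint_blocks_def)
  have "?j \<notin> ?P2"
  proof
    assume "?j \<in> ?P2"
    then have "?j = ?J" using B BJ by simp
    then have "fst ?j = fst ?J" by simp
    then show False using J_sum w_ne by (auto simp: join_def)
  qed
  then have jcd: "join t c d = ?J" "?j = c \<or> ?j = d" using B BJ j_or by auto
  define f where "f = (if ?j = c then d else c)"
  have f: "join t ?j f = ?J" "f \<in> merge P q a b" "f \<noteq> ?j"
    using jcd cd by (auto simp: f_def join_commute)
  have fP: "f \<in> P" "f \<noteq> a" "f \<noteq> b" using f by (auto simp: merge_def)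
  have "fst f \<subseteq> fst a \<union> fst b \<union> fst w" using f(1) J_sum by (auto simp: join_def)
  moreover have "fst f \<noteq> {}" using fP P by (auto simp: disjoint_blocks_def)
  ultimately obtain l where "l \<in> fst f" "l \<in> fst a \<or> l \<in> fst b \<or> l \<in> fst w" by blast
  then have "f = w" using disjoint_blocks_overlap[OF P] fP ab w by blast
  then have "snd ?J = snd a + snd b + snd w + Poly_Mapping.single q 1 + Poly_Mapping.single t 1"
    using f(1)[symmetric] by (simp add: join_def ac_simps)
  then have "Poly_Mapping.single q (1::nat) + Poly_Mapping.single t 1
      = Poly_Mapping.single r 1 + Poly_Mapping.single s 1"
    using J_sum by (metis (no_types, lifting) add.assoc add_left_cancel)
  then have "Poly_Mapping.lookup (Poly_Mapping.single q (1::nat) + Poly_Mapping.single t 1) q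
      = Poly_Mapping.lookup (Poly_Mapping.single r 1 + Poly_Mapping.single s 1) q"
    by simp
  then have "q = r \<or> q = s"
    by (auto simp: lookup_add lookup_single when_def split: if_splits)
  then show ?thesis using abxyz by simp
qed

text \<open>The defining relations are homogeneous in letters and bracket types. Hence all terms of
  a relation have the same weighted block, and the partitions recorded in a chain do not depend on
  the term; moreover a relation lies either entirely in content \<mu> or entirely outside.\<close>

lemma lie_rel_same: "lie_rel ts \<Longrightarrow> \<exists>M C. \<forall>t\<in>set ts. mset (letters t) = M \<and> content t = C"
proof (induction rule: lie_rel.induct)
  case (jacobi j x y z)
  show ?case
    by (intro exI[of _ "mset (letters x) + mset (letters y) + mset (letters z)"]
        exI[of _ "content x + content y + content z + Poly_Mapping.single j 1 + Poly_Mapping.single j 1"])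
      (simp add: ac_simps)
next
  case (mixed_jacobi i j x y z)
  show ?case
    by (intro exI[of _ "mset (letters x) + mset (letters y) + mset (letters z)"]
        exI[of _ "content x + content y + content z + Poly_Mapping.single i 1 + Poly_Mapping.single j 1"])
      (simp add: ac_simps)
next
  case (antisym j x y)
  show ?case
    by (intro exI[of _ "mset (letters x) + mset (letters y)"]
        exI[of _ "content x + content y + Poly_Mapping.single j 1"])
      (simp add: ac_simps)
next
  case (left_context ts j u)
  then obtain M C where "\<forall>t\<in>set ts. mset (letters t) = M \<and> content t = C" by blast
  then show ?case
    by (intro exI[of _ "M + mset (letters u)"] exI[of _ "C + content u + Poly_Mapping.single j 1"]) simp
next
  case (right_context ts j u)
  then obtain M C where "\<forall>t\<in>set ts. mset (letters t) = M \<and> content t = C" by blast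
  then show ?case
    by (intro exI[of _ "mset (letters u) + M"] exI[of _ "content u + C + Poly_Mapping.single j 1"]) simp
qed

lemma lie_rel_wblock: "lie_rel ts \<Longrightarrow> t \<in> set ts \<Longrightarrow> t' \<in> set ts \<Longrightarrow> wblock t = wblock t'"
  unfolding wblock_def using lie_rel_same[of ts] mset_eq_setD[of "letters t" "letters t'"] by auto

section \<open>Covers, paths and the forests that realise them\<close>

lemma wp_cover_merge:
  assumes "wp_cover n k P Q"
  shows "\<exists>a\<in>P. \<exists>b\<in>P. \<exists>r\<in>{1..k}. a \<noteq> b \<and> Q = merge P r a b"
proof -
  obtain A \<alpha> B \<beta> r where r: "r \<in> {1..k}" and ab: "(A, \<alpha>) \<in> P" "(B, \<beta>) \<in> P" "A \<noteq> B"
    and Q: "Q = (P - {(A, \<alpha>), (B, \<beta>)}) \<union> {(A \<union> B, \<alpha> + \<beta> + Poly_Mapping.single r 1)}"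
    using assms unfolding wp_cover_def by blast
  have "Q = merge P r (A, \<alpha>) (B, \<beta>)"
    using Q by (simp add: merge_def join_def)
  then show ?thesis
    using r ab by blast
qed

lemma disjoint_blocks_weighted_partitions:
  assumes "P \<in> weighted_partitions n k"
  shows "disjoint_blocks P"
proof -
  have "a = b \<or> fst a \<inter> fst b = {}" if "a \<in> P" "b \<in> P" for a b
  proof (rule disjCI)
    assume "fst a \<inter> fst b \<noteq> {}"
    then have "fst a = fst b"
      using assms that unfolding weighted_partitions_def partition_on_def disjoint_def by blast
    then show "a = b"
      using assms that unfolding weighted_partitions_def by (auto dest: inj_onD)
  qed
  moreover have "fst a \<noteq> {}" if "a \<in> P" for a
    using assms that unfolding weighted_partitions_def partition_on_def by (metis (no_types, lifting) imageI mem_Collect_eq)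
  ultimately show ?thesis
    unfolding disjoint_blocks_def by blast
qed

lemma wp_cover_weighted_partitions:
  "wp_cover n k P Q \<Longrightarrow> P \<in> weighted_partitions n k" "wp_cover n k P Q \<Longrightarrow> Q \<in> weighted_partitions n k"
  by (auto simp: wp_cover_def)

text \<open>The chain \<open>c\<close> of \<open>path n k P c E\<close> omits its lower end \<open>P\<close> and contains its upper end \<open>E\<close>.\<close>

fun path :: "nat \<Rightarrow> nat \<Rightarrow> wpartition \<Rightarrow> wpartition list \<Rightarrow> wpartition \<Rightarrow> bool" where
  "path n k P [] E \<longleftrightarrow> P = E"
| "path n k P (Q # c) E \<longleftrightarrow> wp_cover n k P Q \<and> path n k Q c E"

lemma path_append: "path n k P (c @ d) E \<longleftrightarrow> (\<exists>M. path n k P c M \<and> path n k M d E)"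
  by (induction c arbitrary: P) auto

text \<open>The fillings of the gap between \<open>P\<close> and \<open>P2\<close>. No condition on
  ranks is imposed: a cover lowers the number of blocks by one, so the set is empty unless the ranks
  differ by two.\<close>

definition mid :: "nat \<Rightarrow> nat \<Rightarrow> wpartition \<Rightarrow> wpartition \<Rightarrow> wpartition set" where
  "mid n k P P2 = {Q. wp_cover n k P Q \<and> wp_cover n k Q P2}"

text \<open>A list and not a set of trees, since the signs depend on their order.\<close>

definition forest :: "nat \<Rightarrow> nat \<Rightarrow> nat bracketing list \<Rightarrow> bool" where
  "forest n k L \<longleftrightarrow> distinct (concat (map letters L)) \<and> set (concat (map letters L)) = {1..n} \<and>
     (\<forall>t\<in>set L. set (bracket_types t) \<subseteq> {1..k})"

lemma forest_cong_mset:
  assumes "mset L = mset L'"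
  shows "forest n k L \<longleftrightarrow> forest n k L'"
proof -
  have "mset (concat (map letters L)) = sum_mset (image_mset (mset \<circ> letters) (mset L))"
    for L :: "nat bracketing list"
    by (induction L) auto
  then have "mset (concat (map letters L)) = mset (concat (map letters L'))"
    using assms by metis
  then show ?thesis
    unfolding forest_def using assms by (metis mset_eq_imp_distinct_iff mset_eq_setD)
qed

lemma forest_Bracket:
  "forest n k (L1 @ Bracket r x y # L2) \<longleftrightarrow> r \<in> {1..k} \<and> forest n k (L1 @ x # y # L2)"
  by (auto simp: forest_def)

lemma forest_Bracket_Cons: "forest n k (Bracket r x y # L2) \<longleftrightarrow> r \<in> {1..k} \<and> forest n k (x # y # L2)"
  using forest_Bracket[of n k "[]"] by simp

lemma forest_distinct_wblock:
  assumes "forest n k L"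
  shows "distinct (map wblock L)"
proof -
  have "distinct (map wblock L)" if "distinct (concat (map letters L))"
    using that
  proof (induction L)
    case (Cons t L)
    have "wblock t \<noteq> wblock s" if "s \<in> set L" for s
    proof
      assume "wblock t = wblock s"
      then have "set (letters t) = set (letters s)" by (simp add: wblock_def)
      moreover have "set (letters t) \<inter> set (letters s) = {}" using Cons.prems that by auto
      ultimately show False by simp
    qed
    with Cons show ?case by auto
  qed simp
  then show ?thesis using assms by (simp add: forest_def)
qed

lemma card_part: "forest n k L \<Longrightarrow> card (part L) = length L"
  unfolding part_def by (metis distinct_card forest_distinct_wblock length_map set_map)

lemma part_weighted_partitions:
  assumes L: "forest n k L"
  shows "part L \<in> weighted_partitions n k"
proof -
  have dist: "distinct (concat (map letters L))" using L by (simp add: forest_def)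
  have disj: "s = t" if "s \<in> set L" "t \<in> set L" "x \<in> set (letters s)" "x \<in> set (letters t)" for s t x
    using dist that
  proof (induction L)
    case (Cons u L)
    then show ?case by auto
  qed simp
  have "partition_on {1..n} (fst ` part L)"
  proof (rule partition_onI)
    show "\<Union> (fst ` part L) = {1..n}"
      using L by (auto simp: forest_def part_def wblock_def)
    show "disjnt p q" if "p \<in> fst ` part L" "q \<in> fst ` part L" "p \<noteq> q" for p q
      using that disj unfolding part_def wblock_def disjnt_def by fastforce
    show "{} \<notin> fst ` part L" by (auto simp: part_def wblock_def)
  qed
  moreover have "inj_on fst (part L)"
  proof (rule inj_onI)
    fix a b assume ab: "a \<in> part L" "b \<in> part L" "fst a = fst b"
    then obtain s t where st: "s \<in> set L" "t \<in> set L" "a = wblock s" "b = wblock t"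
      by (auto simp: part_def)
    then have "set (letters s) = set (letters t)" using ab by (simp add: wblock_def)
    moreover have "hd (letters s) \<in> set (letters s)" by simp
    ultimately have "s = t" using disj st by blast
    then show "a = b" using st by simp
  qed
  moreover have "\<beta> \<in> wcomp (card B - 1) \<and> Poly_Mapping.keys \<beta> \<subseteq> {1..k}" if B: "(B, \<beta>) \<in> part L" for B \<beta>
  proof -
    obtain t where t: "t \<in> set L" "B = set (letters t)" "\<beta> = content t"
      using B by (auto simp: part_def wblock_def)
    have "distinct (letters t)"
      using dist t(1) by (auto simp: distinct_concat_iff)
    then have "card B = length (letters t)" using t by (simp add: distinct_card)
    moreover have "set (bracket_types t) \<subseteq> {1..k}" using L t by (auto simp: forest_def)
    ultimately show ?thesis
      using t sum_content[of t] by (auto simp: wcomp_def keys_content)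
  qed
  ultimately show ?thesis by (auto simp: weighted_partitions_def)
qed

lemma disjoint_blocks_part: "forest n k L \<Longrightarrow> disjoint_blocks (part L)"
  by (rule disjoint_blocks_weighted_partitions[OF part_weighted_partitions])

lemma part_merge:
  "forest n k (x # y # R) \<Longrightarrow> part (Bracket r x y # R) = merge (part (x # y # R)) r (wblock x) (wblock y)"
  using forest_distinct_wblock[of n k "x # y # R"]
  by (auto simp: merge_def wblock_Bracket part_def)

lemma wp_cover_part_Cons:
  assumes "forest n k (x # y # R)" "r \<in> {1..k}"
  shows "wp_cover n k (part (x # y # R)) (part (Bracket r x y # R))"
proof -
  have "wblock x \<noteq> wblock y" "fst (wblock x) \<noteq> {}" "fst (wblock y) \<noteq> {}"
    using forest_distinct_wblock[OF assms(1)] by (auto simp: wblock_def)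
  then have "fst (wblock x) \<noteq> fst (wblock y)"
    using disjoint_blocks_part[OF assms(1)] by (auto simp: disjoint_blocks_def)
  then have "set (letters x) \<noteq> set (letters y)" by (simp add: wblock_def)
  moreover have "part (Bracket r x y # R) \<in> weighted_partitions n k"
    using assms by (intro part_weighted_partitions) (simp add: forest_Bracket_Cons)
  moreover have "part (x # y # R) \<in> weighted_partitions n k"
    using assms(1) by (rule part_weighted_partitions)
  moreover have "part (Bracket r x y # R) = part (x # y # R) - {wblock x, wblock y} \<union>
      {(set (letters x) \<union> set (letters y), content x + content y + Poly_Mapping.single r 1)}"
    using part_merge[OF assms(1), of r] by (auto simp: merge_def join_def wblock_def)
  moreover have "(set (letters x), content x) \<in> part (x # y # R)" "(set (letters y), content y) \<in> part (x # y # R)"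
    by (simp_all add: wblock_def)
  ultimately show ?thesis
    unfolding wp_cover_def wblock_def using assms(2) by blast
qed

lemma wp_cover_part:
  assumes "forest n k (L1 @ Bracket r x y # L2)"
  shows "wp_cover n k (part (L1 @ x # y # L2)) (part (L1 @ Bracket r x y # L2))"
proof -
  have "forest n k (Bracket r x y # L1 @ L2)"
    using assms forest_cong_mset[of "Bracket r x y # L1 @ L2" "L1 @ Bracket r x y # L2"] by simp
  then have "wp_cover n k (part (x # y # L1 @ L2)) (part (Bracket r x y # L1 @ L2))"
    using wp_cover_part_Cons[of n k x y "L1 @ L2" r] by (simp add: forest_Bracket_Cons)
  then show ?thesis by (simp add: insert_commute)
qed

text \<open>A cover of \<open>part L\<close> merges the blocks of two trees of \<open>L\<close>;
  after these are brought to the front, the cover is the effect of one new bracket. This lifts paths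
  of partitions to forests, step by step.\<close>

lemma wp_cover_partE:
  assumes L: "forest n k L" and cover: "wp_cover n k (part L) Q"
  obtains x y R r where "mset L = mset (x # y # R)" "r \<in> {1..k}" "Q = part (Bracket r x y # R)"
    "forest n k (Bracket r x y # R)"
proof -
  obtain a b r where ab: "a \<in> part L" "b \<in> part L" "r \<in> {1..k}" "a \<noteq> b" "Q = merge (part L) r a b"
    using wp_cover_merge[OF cover] by blast
  obtain x y where xy: "x \<in> set L" "y \<in> set L" "a = wblock x" "b = wblock y" "x \<noteq> y"
    using ab by (auto simp: part_def)
  obtain A B where AB: "L = A @ x # B" using xy by (meson split_list)
  then have "y \<in> set (A @ B)" using xy by auto
  then obtain C D where CD: "A @ B = C @ y # D" by (meson split_list)
  define R where "R = C @ D"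
  have "mset L = add_mset x (mset (A @ B))" by (simp add: AB)
  then have R: "mset L = mset (x # y # R)" by (simp add: CD R_def)
  have f: "forest n k (x # y # R)" using L forest_cong_mset[OF R] by simp
  have "Q = part (Bracket r x y # R)"
    using part_merge[OF f] part_cong_mset[OF R] ab xy by simp
  then show ?thesis using that R ab f by (simp add: forest_Bracket_Cons)
qed

text \<open>The two merges can be carried out in either order, and
  \<open>two_merges_disjoint\<close> excludes anything else. The fillings have to differ in order
  that the gap sum has two terms.\<close>

lemma mid_disjoint:
  assumes f: "forest n k (Bracket r u v # Bracket s x y # R)"
  shows "mid n k (part (u # v # x # y # R)) (part (Bracket r u v # Bracket s x y # R)) =
      {part (Bracket r u v # x # y # R), part (u # v # Bracket s x y # R)}"
    and "part (Bracket r u v # x # y # R) \<noteq> part (u # v # Bracket s x y # R)"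
proof -
  let ?P = "part (u # v # x # y # R)" and ?P2 = "part (Bracket r u v # Bracket s x y # R)"
  let ?Q1 = "part (Bracket r u v # x # y # R)" and ?Q2 = "part (u # v # Bracket s x y # R)"
  have f1: "forest n k (Bracket r u v # x # y # R)"
    using f forest_Bracket[of n k "[Bracket r u v]" s x y R] by simp
  then have f0: "forest n k (u # v # x # y # R)" and r: "r \<in> {1..k}"
    by (auto simp: forest_Bracket_Cons)
  have f2: "forest n k (u # v # Bracket s x y # R)" and s: "s \<in> {1..k}"
    using f forest_Bracket[of n k "[u, v]" s x y R] f0 by (auto simp: forest_Bracket_Cons)
  have f0': "forest n k (x # y # u # v # R)"
    using f0 forest_cong_mset[of "x # y # u # v # R" "u # v # x # y # R"] by simp
  have dist: "distinct [wblock u, wblock v, wblock x, wblock y]"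
    using forest_distinct_wblock[OF f0] by auto
  have Q1: "?Q1 = merge ?P r (wblock u) (wblock v)" using part_merge[OF f0] .
  have Q2: "?Q2 = merge ?P s (wblock x) (wblock y)"
    using part_merge[OF f0', of s] by (simp add: insert_commute)
  have f1': "forest n k (x # y # Bracket r u v # R)"
    using f1 forest_cong_mset[of "x # y # Bracket r u v # R" "Bracket r u v # x # y # R"] by simp
  have P2: "?P2 = merge ?Q1 s (wblock x) (wblock y)"
    using part_merge[OF f1', of s] by (simp add: insert_commute)
  have db: "disjoint_blocks ?P" using disjoint_blocks_part[OF f0] .
  show "?Q1 \<noteq> ?Q2"
    unfolding Q1 Q2 using merge_inject[OF db] dist by (auto simp: doubleton_eq_iff)
  show "mid n k ?P ?P2 = {?Q1, ?Q2}"
  proof (intro equalityI subsetI)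
    fix Q assume "Q \<in> mid n k ?P ?P2"
    then have c: "wp_cover n k ?P Q" "wp_cover n k Q ?P2" by (auto simp: mid_def)
    obtain a b q where ab: "a \<in> ?P" "b \<in> ?P" "a \<noteq> b" "Q = merge ?P q a b"
      using wp_cover_merge[OF c(1)] by blast
    obtain c d t where cd: "c \<in> Q" "d \<in> Q" "c \<noteq> d" "?P2 = merge Q t c d"
      using wp_cover_merge[OF c(2)] by blast
    have "merge ?P q a b = merge ?P r (wblock u) (wblock v) \<or> merge ?P q a b = merge ?P s (wblock x) (wblock y)"
      by (rule two_merges_disjoint[OF db _ _ _ _ dist ab(1-3), of c q d t r s])
        (use cd ab(4) P2 Q1 in auto)
    then show "Q \<in> {?Q1, ?Q2}" using ab(4) Q1 Q2 by auto
  next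
    fix Q assume "Q \<in> {?Q1, ?Q2}"
    then show "Q \<in> mid n k ?P ?P2"
      using wp_cover_part[of n k "[]" r u v "x # y # R"] wp_cover_part[of n k "[u, v]" s x y R]
        wp_cover_part[of n k "[Bracket r u v]" s x y R] wp_cover_part[of n k "[]" r u v "Bracket s x y # R"]
        f f1 f2
      by (auto simp: mid_def)
  qed
qed

text \<open>\<open>two_merges_three\<close> bounds the set of fillings from above. The pairs are
  taken in cyclic order, as in the Jacobi relation, and the fillings are distinct, so that the sum
  over the set becomes a sum of three or six terms.\<close>

lemma mid_three:
  assumes f: "forest n k (Bracket s (Bracket r x y) z # R)"
  shows "mid n k (part (x # y # z # R)) (part (Bracket s (Bracket r x y) z # R)) =
      (\<Union>q\<in>{r, s}. {part (Bracket q x y # z # R), part (Bracket q y z # x # R), part (Bracket q z x # y # R)})"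
    (is "mid n k ?P ?P2 = ?M")
    and "r = s \<Longrightarrow> (\<Sum>Q\<in>mid n k (part (x # y # z # R)) (part (Bracket s (Bracket r x y) z # R)). (h Q :: 'v::ab_group_add)) =
      h (part (Bracket r x y # z # R)) + h (part (Bracket r y z # x # R)) + h (part (Bracket r z x # y # R))"
    and "r \<noteq> s \<Longrightarrow> (\<Sum>Q\<in>mid n k (part (x # y # z # R)) (part (Bracket s (Bracket r x y) z # R)). h Q) =
      h (part (Bracket r x y # z # R)) + h (part (Bracket r y z # x # R)) + h (part (Bracket r z x # y # R)) +
      (h (part (Bracket s x y # z # R)) + h (part (Bracket s y z # x # R)) + h (part (Bracket s z x # y # R)))"
proof -
  have f1: "forest n k (Bracket r x y # z # R)" and s: "s \<in> {1..k}"
    using f by (auto simp: forest_Bracket_Cons)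
  then have f0: "forest n k (x # y # z # R)" and r: "r \<in> {1..k}"
    by (auto simp: forest_Bracket_Cons)
  have f2: "forest n k (y # z # x # R)"
    using f0 forest_cong_mset[of "y # z # x # R" "x # y # z # R"] by simp
  have f3: "forest n k (z # x # y # R)"
    using f0 forest_cong_mset[of "z # x # y # R" "x # y # z # R"] by simp
  have P2: "?P = part (y # z # x # R)" and P3: "?P = part (z # x # y # R)"
    by auto
  have dist: "distinct [wblock x, wblock y, wblock z]"
    using forest_distinct_wblock[OF f0] by auto
  have m: "part (Bracket q x y # z # R) = merge ?P q (wblock x) (wblock y)"
    "part (Bracket q y z # x # R) = merge ?P q (wblock y) (wblock z)"
    "part (Bracket q z x # y # R) = merge ?P q (wblock z) (wblock x)" for q
    using part_merge[OF f0, of q] part_merge[OF f2, of q] part_merge[OF f3, of q] P2 P3 by simp_all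
  have db: "disjoint_blocks ?P" using disjoint_blocks_part[OF f0] .
  have P2m: "?P2 = merge (merge ?P r (wblock x) (wblock y)) s (join r (wblock x) (wblock y)) (wblock z)"
    using part_merge[OF f1, of s] m(1)[of r] by (simp add: wblock_Bracket)
  show M: "mid n k ?P ?P2 = ?M"
  proof (intro equalityI subsetI)
    fix Q assume "Q \<in> mid n k ?P ?P2"
    then have c: "wp_cover n k ?P Q" "wp_cover n k Q ?P2" by (auto simp: mid_def)
    obtain a b q where ab: "a \<in> ?P" "b \<in> ?P" "a \<noteq> b" "Q = merge ?P q a b"
      using wp_cover_merge[OF c(1)] by blast
    obtain c d t where cd: "c \<in> Q" "d \<in> Q" "c \<noteq> d" "?P2 = merge Q t c d"
      using wp_cover_merge[OF c(2)] by blast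
    have abq: "(q = r \<or> q = s) \<and> ({a, b} = {wblock x, wblock y} \<or> {a, b} = {wblock y, wblock z} \<or> {a, b} = {wblock z, wblock x})"
      by (rule two_merges_three[OF db _ _ _ dist ab(1-3), of c q d t r s])
        (use cd ab(4) P2m in auto)
    have cong: "merge ?P q a b = merge ?P q c d" if "{a, b} = {c, d}" for c d
      using that merge_commute[of ?P q a b] by (metis doubleton_eq_iff)
    have "Q \<in> {part (Bracket q x y # z # R), part (Bracket q y z # x # R), part (Bracket q z x # y # R)}"
      unfolding m ab(4) using abq cong by blast
    then show "Q \<in> ?M" using abq by blast
  next
    have sr: "part (Bracket r (Bracket s x' y') z' # R') = part (Bracket s (Bracket r x' y') z' # R')" for x' y' z' R'
      by (simp add: wblock_def ac_simps)
    \<comment> \<open>A weighted block records only the leaf set and the total weight, so all three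
      nestings and both orders of the two types end in the same upper partition.\<close>
    have Pq: "?P2 = part (Bracket q' (Bracket q x y) z # R)" "?P2 = part (Bracket q' (Bracket q y z) x # R)"
       "?P2 = part (Bracket q' (Bracket q z x) y # R)" if "q = r \<and> q' = s \<or> q = s \<and> q' = r" for q q'
      using that by (auto simp: wblock_def ac_simps)
    fix Q assume "Q \<in> ?M"
    then obtain q where q: "q \<in> {r, s}"
      "Q \<in> {part (Bracket q x y # z # R), part (Bracket q y z # x # R), part (Bracket q z x # y # R)}"
      by blast
    \<comment> \<open>The type that remains for the second merge.\<close>
    define q' where "q' = (if q = r then s else r)"
    have qq: "q = r \<and> q' = s \<or> q = s \<and> q' = r" using q by (auto simp: q'_def)
    have qk: "q \<in> {1..k}" "q' \<in> {1..k}" using qq r s by auto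
    have "wp_cover n k (part (x' # y' # z' # R)) (part (Bracket q x' y' # z' # R)) \<and>
        wp_cover n k (part (Bracket q x' y' # z' # R)) (part (Bracket q' (Bracket q x' y') z' # R))"
      if "forest n k (x' # y' # z' # R)" for x' y' z'
      using that qk by (auto intro!: wp_cover_part_Cons simp: forest_Bracket_Cons simp del: part_simps)
    from this[OF f0] this[OF f2] this[OF f3]
    have "part (Bracket q x y # z # R) \<in> mid n k ?P ?P2" "part (Bracket q y z # x # R) \<in> mid n k ?P ?P2"
      "part (Bracket q z x # y # R) \<in> mid n k ?P ?P2"
      unfolding mid_def Pq(1)[OF qq, symmetric] Pq(2)[OF qq, symmetric] Pq(3)[OF qq, symmetric]
        P2[symmetric] P3[symmetric] by blast+
    then show "Q \<in> mid n k ?P ?P2"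
      using q(2) by blast
  qed
  have wP: "wblock x \<in> ?P" "wblock y \<in> ?P" "wblock z \<in> ?P" by auto
  have neq: "wblock x \<noteq> wblock y" "wblock y \<noteq> wblock z" "wblock z \<noteq> wblock x"
    using dist by auto
  have pairs: "{wblock x, wblock y} \<noteq> {wblock y, wblock z}" "{wblock x, wblock y} \<noteq> {wblock z, wblock x}"
    "{wblock y, wblock z} \<noteq> {wblock z, wblock x}"
    using neq by (auto simp: doubleton_eq_iff)
  have ne: "part (Bracket q x y # z # R) \<noteq> part (Bracket q' y z # x # R)"
    "part (Bracket q x y # z # R) \<noteq> part (Bracket q' z x # y # R)"
    "part (Bracket q y z # x # R) \<noteq> part (Bracket q' z x # y # R)" for q q'
    unfolding m
    using merge_inject[OF db wP(1,2) neq(1) wP(2,3) neq(2)] merge_inject[OF db wP(1,2) neq(1) wP(3,1) neq(3)]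
      merge_inject[OF db wP(2,3) neq(2) wP(3,1) neq(3)] pairs by blast+
  have ne': "part (Bracket r x y # z # R) \<noteq> part (Bracket s x y # z # R)"
    "part (Bracket r y z # x # R) \<noteq> part (Bracket s y z # x # R)"
    "part (Bracket r z x # y # R) \<noteq> part (Bracket s z x # y # R)" if "r \<noteq> s"
    unfolding m
    using merge_inject[OF db wP(1,2) neq(1) wP(1,2) neq(1)] merge_inject[OF db wP(2,3) neq(2) wP(2,3) neq(2)]
      merge_inject[OF db wP(3,1) neq(3) wP(3,1) neq(3)] that by blast+
  show "(\<Sum>Q\<in>mid n k ?P ?P2. h Q) =
      h (part (Bracket r x y # z # R)) + h (part (Bracket r y z # x # R)) + h (part (Bracket r z x # y # R))" if "r = s"
    unfolding M using that ne by (simp add: ac_simps del: part_simps)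
  show "(\<Sum>Q\<in>mid n k ?P ?P2. h Q) =
      h (part (Bracket r x y # z # R)) + h (part (Bracket r y z # x # R)) + h (part (Bracket r z x # y # R)) +
      (h (part (Bracket s x y # z # R)) + h (part (Bracket s y z # x # R)) + h (part (Bracket s z x # y # R)))" if "r \<noteq> s"
    unfolding M using ne ne[symmetric] ne'[OF that] by (simp add: ac_simps del: part_simps)
qed

section \<open>Alternating functions of a forest and a chain above it\<close>

definition chain_above :: "nat \<Rightarrow> nat \<Rightarrow> (nat \<Rightarrow>\<^sub>0 nat) \<Rightarrow> nat bracketing list \<Rightarrow> wpartition list \<Rightarrow> bool" where
  "chain_above n k \<mu> L c \<longleftrightarrow> forest n k L \<and> path n k (part L) c (wp_top n \<mu>)"

definition alternating ::
  "nat \<Rightarrow> nat \<Rightarrow> (nat \<Rightarrow>\<^sub>0 nat) \<Rightarrow> (nat bracketing list \<Rightarrow> wpartition list \<Rightarrow> 'v::ab_group_add) \<Rightarrow> bool" where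
  "alternating n k \<mu> H \<longleftrightarrow> (\<forall>L1 a b L2 c. chain_above n k \<mu> (L1 @ a # b # L2) c \<longrightarrow>
     H (L1 @ b # a # L2) c = - H (L1 @ a # b # L2) c)"

definition splitting ::
  "nat \<Rightarrow> nat \<Rightarrow> (nat \<Rightarrow>\<^sub>0 nat) \<Rightarrow> (nat bracketing list \<Rightarrow> wpartition list \<Rightarrow> 'v::ab_group_add) \<Rightarrow> bool" where
  "splitting n k \<mu> H \<longleftrightarrow> (\<forall>L1 r x y L2 c. chain_above n k \<mu> (L1 @ Bracket r x y # L2) c \<longrightarrow>
     H (L1 @ x # y # L2) (part (L1 @ Bracket r x y # L2) # c) = sg (length L1) (H (L1 @ Bracket r x y # L2) c))"

definition respects_rel ::
  "nat \<Rightarrow> nat \<Rightarrow> (nat \<Rightarrow>\<^sub>0 nat) \<Rightarrow> (nat bracketing list \<Rightarrow> wpartition list \<Rightarrow> 'v::ab_group_add) \<Rightarrow> bool" where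
  "respects_rel n k \<mu> H \<longleftrightarrow> (\<forall>ts R c. lie_rel ts \<longrightarrow> (\<forall>t\<in>set ts. chain_above n k \<mu> (t # R) c) \<longrightarrow>
     (\<Sum>t\<leftarrow>ts. H (t # R) c) = 0)"

text \<open>Only the lowest gap, directly above the forest, is tested. A gap further up in a chain
  is the lowest gap for the forest that is obtained by reading the elements below it as
  brackets.\<close>

definition respects_mid ::
  "nat \<Rightarrow> nat \<Rightarrow> (nat \<Rightarrow>\<^sub>0 nat) \<Rightarrow> (nat bracketing list \<Rightarrow> wpartition list \<Rightarrow> 'v::ab_group_add) \<Rightarrow> bool" where
  "respects_mid n k \<mu> H \<longleftrightarrow> (\<forall>L P c. forest n k L \<longrightarrow> path n k P c (wp_top n \<mu>) \<longrightarrow>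
     (\<Sum>Q\<in>mid n k (part L) P. H L (Q # P # c)) = 0)"

section \<open>Splitting brackets, and the expansion of Jacobi sums\<close>

lemma chain_above_cong_mset:
  "mset L = mset L' \<Longrightarrow> chain_above n k \<mu> L c \<longleftrightarrow> chain_above n k \<mu> L' c"
  unfolding chain_above_def using forest_cong_mset part_cong_mset by metis

lemma chain_above_split:
  "chain_above n k \<mu> (L1 @ Bracket r x y # L2) c \<Longrightarrow>
    chain_above n k \<mu> (L1 @ x # y # L2) (part (L1 @ Bracket r x y # L2) # c)"
  unfolding chain_above_def using wp_cover_part forest_Bracket by (simp del: part_simps)

lemma chain_above_split_Cons:
  "chain_above n k \<mu> (Bracket r x y # L) c \<Longrightarrow> chain_above n k \<mu> (x # y # L) (part (Bracket r x y # L) # c)"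
  using chain_above_split[of n k \<mu> "[]"] by simp

lemma chain_above_Nil:
  assumes "chain_above n k \<mu> L []"
  shows "\<exists>t. L = [t]"
proof -
  have "length L = card (wp_top n \<mu>)"
    using assms card_part[of n k L] unfolding chain_above_def path.simps by metis
  also have "\<dots> = 1"
    unfolding wp_top_def by (metis card_1_singleton_iff One_nat_def)
  finally show ?thesis
    by (metis One_nat_def length_0_conv length_Suc_conv)
qed

lemma part_letters: "part (map Letter w) = (\<lambda>i. ({i}, 0)) ` set w"
  unfolding part_def set_map image_image wblock_def letters.simps content.simps list.set by (rule refl)

lemma wp_bot_part: "wp_bot n = part (map Letter [1..<Suc n])"
  unfolding wp_bot_def part_letters set_upt atLeastLessThanSuc_atLeastAtMost by (rule refl)

lemma alternating_swaps:
  assumes alt: "alternating n k \<mu> H"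
  shows "swaps m L L' \<Longrightarrow> chain_above n k \<mu> L c \<Longrightarrow> H L c = sg m (H L' c)"
proof (induction rule: swaps.induct)
  case (swaps_step m as y x bs ys)
  have "chain_above n k \<mu> (as @ y # x # bs) c"
    using swaps_step.prems chain_above_cong_mset[of "as @ y # x # bs" "as @ x # y # bs"] by simp
  then show ?case
    using swaps_step.IH alt[unfolded alternating_def, rule_format, OF swaps_step.prems]
    by (metis minus_minus sg_simps(2))
qed simp

lemma alternating_front:
  assumes "alternating n k \<mu> H" "chain_above n k \<mu> (L1 @ x # L2) c"
  shows "H (L1 @ x # L2) c = sg (length L1) (H (x # L1 @ L2) c)"
  using alternating_swaps[OF assms(1) swaps_to_front assms(2)] .

lemma alternating_rotate:
  assumes "alternating n k \<mu> H" "chain_above n k \<mu> (x # y # z # R) c"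
  shows "H (y # z # x # R) c = H (x # y # z # R) c"
  using assms(2) alternating_front[OF assms(1), of "[y, z]" x R c] chain_above_cong_mset[of "y # z # x # R" "x # y # z # R" n k \<mu> c]
  by simp

lemma splitting_Cons:
  assumes "splitting n k \<mu> H" "chain_above n k \<mu> (Bracket r x y # L) c"
  shows "H (x # y # L) (part (Bracket r x y # L) # c) = H (Bracket r x y # L) c"
  using assms unfolding splitting_def by (metis append_Nil list.size(3) sg_simps(1))

text \<open>After the outer split the inner bracket stands behind \<open>x\<close>; moving it to the
  front before splitting it gives the sign.\<close>

lemma splitting_inner:
  assumes alt: "alternating n k \<mu> H" and split: "splitting n k \<mu> H"
    and c: "chain_above n k \<mu> (Bracket i x (Bracket j y z) # R) c"
  shows "H (Bracket i x (Bracket j y z) # R) c =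
    - H (y # z # x # R) (part (Bracket j y z # x # R) # part (Bracket i x (Bracket j y z) # R) # c)"
proof -
  let ?P = "part (Bracket i x (Bracket j y z) # R)"
  have c1: "chain_above n k \<mu> (x # Bracket j y z # R) (?P # c)"
    using chain_above_split_Cons[OF c] .
  have c2: "chain_above n k \<mu> (Bracket j y z # x # R) (?P # c)"
    using c1 chain_above_cong_mset[of "Bracket j y z # x # R" "x # Bracket j y z # R"] by simp
  have "H (Bracket i x (Bracket j y z) # R) c = H (x # Bracket j y z # R) (?P # c)"
    using splitting_Cons[OF split c] by simp
  also have "\<dots> = - H (Bracket j y z # x # R) (?P # c)"
    using alternating_front[OF alt, of "[x]" "Bracket j y z" R] c1 by simp
  also have "H (Bracket j y z # x # R) (?P # c) = H (y # z # x # R) (part (Bracket j y z # x # R) # ?P # c)"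
    using splitting_Cons[OF split c2] by simp
  finally show ?thesis .
qed

text \<open>Compared with \<open>splitting_inner\<close>, \<open>x\<close> moves past both
  \<open>y\<close> and \<open>z\<close>, which is an even permutation.\<close>

lemma splitting_nested:
  assumes alt: "alternating n k \<mu> H" and split: "splitting n k \<mu> H"
    and c: "chain_above n k \<mu> (Bracket i x (Bracket j y z) # R) c"
  shows "H (Bracket i x (Bracket j y z) # R) c =
      - H (x # y # z # R) (part (Bracket j y z # x # R) # part (Bracket i x (Bracket j y z) # R) # c)"
proof -
  let ?P = "part (Bracket i x (Bracket j y z) # R)"
  have "chain_above n k \<mu> (Bracket j y z # x # R) (?P # c)"
    using chain_above_split_Cons[OF c] chain_above_cong_mset[of "Bracket j y z # x # R" "x # Bracket j y z # R"] by simp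
  then have "chain_above n k \<mu> (y # z # x # R) (part (Bracket j y z # x # R) # ?P # c)"
    by (rule chain_above_split_Cons)
  then have "chain_above n k \<mu> (x # y # z # R) (part (Bracket j y z # x # R) # ?P # c)"
    using chain_above_cong_mset[of "y # z # x # R" "x # y # z # R"] by simp
  then show ?thesis
    using alternating_rotate[OF alt] splitting_inner[OF assms] by simp
qed

lemma part_nested:
  "part (Bracket i z (Bracket j x y) # R) = part (Bracket i x (Bracket j y z) # R)"
  "part (Bracket i y (Bracket j z x) # R) = part (Bracket i x (Bracket j y z) # R)"
  "part (Bracket i (Bracket j x y) z # R) = part (Bracket i x (Bracket j y z) # R)"
  by (auto simp: wblock_def ac_simps)

lemma part_nested_swap:
  "part (Bracket j x (Bracket i y z) # R) = part (Bracket i x (Bracket j y z) # R)"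
  by (simp add: wblock_def ac_simps)

lemma forest_nested:
  "forest n k (Bracket i z (Bracket j x y) # R) \<longleftrightarrow> forest n k (Bracket i x (Bracket j y z) # R)"
  "forest n k (Bracket i y (Bracket j z x) # R) \<longleftrightarrow> forest n k (Bracket i x (Bracket j y z) # R)"
  "forest n k (Bracket i (Bracket j x y) z # R) \<longleftrightarrow> forest n k (Bracket i x (Bracket j y z) # R)"
  by (auto simp: forest_def)

lemma forest_nested_swap:
  "forest n k (Bracket j x (Bracket i y z) # R) \<longleftrightarrow> forest n k (Bracket i x (Bracket j y z) # R)"
  by (auto simp: forest_def)

text \<open>All three terms are expanded over the same forest \<open>x # y # z # R\<close> and the
  same \<open>P\<close>, with a common sign; only the lowest partition varies, over the fillings
  with first type \<open>j\<close>. For \<open>i = j\<close> this is the whole gap sum; for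
  \<open>i \<noteq> j\<close> it is one half, and the other half arises by exchanging
  \<open>i\<close> and \<open>j\<close>.\<close>

lemma jacobi_mid:
  assumes alt: "alternating n k \<mu> H" and split: "splitting n k \<mu> H"
    and c: "chain_above n k \<mu> (Bracket i x (Bracket j y z) # R) c"
  defines "P \<equiv> part (Bracket i x (Bracket j y z) # R)"
  shows "H (Bracket i x (Bracket j y z) # R) c + H (Bracket i z (Bracket j x y) # R) c +
      H (Bracket i y (Bracket j z x) # R) c =
    - (H (x # y # z # R) (part (Bracket j x y # z # R) # P # c) +
       H (x # y # z # R) (part (Bracket j y z # x # R) # P # c) +
       H (x # y # z # R) (part (Bracket j z x # y # R) # P # c))"
proof -
  have c': "chain_above n k \<mu> (Bracket i z (Bracket j x y) # R) c" "chain_above n k \<mu> (Bracket i y (Bracket j z x) # R) c"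
    using c unfolding chain_above_def forest_nested part_nested by auto
  have c3: "chain_above n k \<mu> (x # y # z # R) (part (Bracket j x y # z # R) # P # c)"
    using chain_above_split_Cons[OF c'(1)]
      chain_above_split_Cons[of n k \<mu> j x y "z # R"] chain_above_cong_mset[of "z # Bracket j x y # R" "Bracket j x y # z # R"]
    unfolding P_def part_nested by (simp del: part_simps)
  have c4: "chain_above n k \<mu> (z # x # y # R) (part (Bracket j z x # y # R) # P # c)"
    using chain_above_split_Cons[OF c'(2)]
      chain_above_split_Cons[of n k \<mu> j z x "y # R"] chain_above_cong_mset[of "y # Bracket j z x # R" "Bracket j z x # y # R"]
    unfolding P_def part_nested by (simp del: part_simps)
  have 1: "H (Bracket i x (Bracket j y z) # R) c = - H (x # y # z # R) (part (Bracket j y z # x # R) # P # c)"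
    using splitting_nested[OF alt split c] by (simp add: P_def)
  have 2: "H (Bracket i z (Bracket j x y) # R) c = - H (x # y # z # R) (part (Bracket j x y # z # R) # P # c)"
    using splitting_inner[OF alt split c'(1)] unfolding part_nested P_def by simp
  have 3: "H (Bracket i y (Bracket j z x) # R) c = - H (x # y # z # R) (part (Bracket j z x # y # R) # P # c)"
    using splitting_inner[OF alt split c'(2)] alternating_rotate[OF alt c4] unfolding part_nested P_def by simp
  show ?thesis unfolding 1 2 3 by simp
qed

text \<open>Induction over the relation. Antisymmetry is alternation, the Jacobi relations are gap
  sums with three or six fillings, and a relation in a context is reduced by splitting the outer
  bracket, which turns the context into one more tree of the forest.\<close>

lemma respects_mid_imp_rel:
  assumes alt: "alternating n k \<mu> H" and split: "splitting n k \<mu> H" and mid: "respects_mid n k \<mu> H"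
  shows "respects_rel n k \<mu> H"
proof -
  have "(\<Sum>t\<leftarrow>ts. H (t # R) c) = 0" if "lie_rel ts" "\<forall>t\<in>set ts. chain_above n k \<mu> (t # R) c" for ts R c
    using that
  proof (induction arbitrary: R c rule: lie_rel.induct)
    case (antisym j x y)
    then have c: "chain_above n k \<mu> (Bracket j x y # R) c" "chain_above n k \<mu> (Bracket j y x # R) c" by auto
    have p: "part (Bracket j y x # R) = part (Bracket j x y # R)" by (auto simp: wblock_def ac_simps)
    have "H (y # x # R) (part (Bracket j x y # R) # c) = - H (x # y # R) (part (Bracket j x y # R) # c)"
      using alternating_front[OF alt, of "[x]" y R "part (Bracket j x y # R) # c"] chain_above_split_Cons[OF c(1)] by simp
    then have "H (Bracket j y x # R) c = - H (Bracket j x y # R) c"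
      using splitting_Cons[OF split c(1)] splitting_Cons[OF split c(2)] unfolding p by metis
    then show ?case by simp
  next
    case (jacobi j x y z)
    then have c: "chain_above n k \<mu> (Bracket j x (Bracket j y z) # R) c" by auto
    let ?P = "part (Bracket j x (Bracket j y z) # R)"
    have f: "forest n k (Bracket j (Bracket j x y) z # R)"
      using c by (simp add: chain_above_def forest_nested)
    have f0: "forest n k (x # y # z # R)"
      using f by (simp add: forest_Bracket_Cons)
    have "(\<Sum>Q\<in>mid n k (part (x # y # z # R)) ?P. H (x # y # z # R) (Q # ?P # c)) = 0"
      using mid f0 c unfolding respects_mid_def chain_above_def by blast
    then show ?case
      using jacobi_mid[OF alt split c] mid_three(2)[OF f refl, of "\<lambda>Q. H (x # y # z # R) (Q # ?P # c)"]
      unfolding part_nested by (simp del: part_simps add: ac_simps)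
  next
    case (mixed_jacobi i j x y z)
    then have c: "chain_above n k \<mu> (Bracket i x (Bracket j y z) # R) c"
      "chain_above n k \<mu> (Bracket j x (Bracket i y z) # R) c" by auto
    let ?P = "part (Bracket i x (Bracket j y z) # R)"
    have f: "forest n k (Bracket i (Bracket j x y) z # R)"
      using c by (simp add: chain_above_def forest_nested)
    have f0: "forest n k (x # y # z # R)"
      using f by (simp add: forest_Bracket_Cons)
    have "(\<Sum>Q\<in>mid n k (part (x # y # z # R)) ?P. H (x # y # z # R) (Q # ?P # c)) = 0"
      using mid f0 c unfolding respects_mid_def chain_above_def by blast
    then have "H (x # y # z # R) (part (Bracket j x y # z # R) # ?P # c) +
       H (x # y # z # R) (part (Bracket j y z # x # R) # ?P # c) +
       H (x # y # z # R) (part (Bracket j z x # y # R) # ?P # c) +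
       (H (x # y # z # R) (part (Bracket i x y # z # R) # ?P # c) +
       H (x # y # z # R) (part (Bracket i y z # x # R) # ?P # c) +
       H (x # y # z # R) (part (Bracket i z x # y # R) # ?P # c)) = 0"
      using mid_three(3)[OF f, of "\<lambda>Q. H (x # y # z # R) (Q # ?P # c)"] \<open>i \<noteq> j\<close>
      unfolding part_nested by (simp del: part_simps)
    moreover have "(\<Sum>t\<leftarrow>[Bracket i x (Bracket j y z), Bracket i z (Bracket j x y), Bracket i y (Bracket j z x),
             Bracket j x (Bracket i y z), Bracket j z (Bracket i x y), Bracket j y (Bracket i z x)]. H (t # R) c) =
       (H (Bracket i x (Bracket j y z) # R) c + H (Bracket i z (Bracket j x y) # R) c + H (Bracket i y (Bracket j z x) # R) c) +
       (H (Bracket j x (Bracket i y z) # R) c + H (Bracket j z (Bracket i x y) # R) c + H (Bracket j y (Bracket i z x) # R) c)"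
      by (simp add: add.assoc)
    ultimately show ?case
      unfolding jacobi_mid[OF alt split c(1)] jacobi_mid[OF alt split c(2), unfolded part_nested_swap[of j x i]]
      by (metis (no_types, lifting) minus_add_distrib neg_equal_0_iff_equal)
  next
    case (left_context ts j u)
    show ?case
    proof (cases ts)
      case (Cons t0 ts')
      define P where "P = part (Bracket j t0 u # R)"
      \<comment> \<open>By homogeneity all terms record the same partition, so the induction
        hypothesis applies to one fixed chain.\<close>
      have P: "part (Bracket j t u # R) = P" if "t \<in> set ts" for t
        using lie_rel_wblock[OF left_context.hyps that, of t0] Cons by (simp add: P_def wblock_Bracket)
      have c: "chain_above n k \<mu> (Bracket j t u # R) c" if "t \<in> set ts" for t
        using left_context.prems that by simp
      have "(\<Sum>t\<leftarrow>ts. H (Bracket j t u # R) c) = (\<Sum>t\<leftarrow>ts. H (t # u # R) (P # c))"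
        using splitting_Cons[OF split c] P by (intro arg_cong[of _ _ sum_list] map_cong) (simp_all del: part_simps)
      also have "\<dots> = 0"
        using left_context.IH[of "u # R" "P # c"] chain_above_split_Cons[OF c] P by (simp del: part_simps)
      finally show ?thesis by (simp add: comp_def)
    qed simp
  next
    case (right_context ts j u)
    show ?case
    proof (cases ts)
      case (Cons t0 ts')
      define P where "P = part (Bracket j u t0 # R)"
      have P: "part (Bracket j u t # R) = P" if "t \<in> set ts" for t
        using lie_rel_wblock[OF right_context.hyps that, of t0] Cons by (simp add: P_def wblock_Bracket)
      have c: "chain_above n k \<mu> (Bracket j u t # R) c" if "t \<in> set ts" for t
        using right_context.prems that by simp
      have c1: "chain_above n k \<mu> (u # t # R) (P # c)" if "t \<in> set ts" for t
        using chain_above_split_Cons[OF c[OF that]] P[OF that] by (simp del: part_simps)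
      then have c2: "chain_above n k \<mu> (t # u # R) (P # c)" if "t \<in> set ts" for t
        using that chain_above_cong_mset[of "u # t # R" "t # u # R" n k \<mu> "P # c"] by fastforce
      have "H (Bracket j u t # R) c = - H (t # u # R) (P # c)" if "t \<in> set ts" for t
        using splitting_Cons[OF split c[OF that]] P[OF that]
          alternating_front[OF alt, of "[u]" t R "P # c"] c1[OF that] by (simp del: part_simps)
      then have "(\<Sum>t\<leftarrow>ts. H (Bracket j u t # R) c) = (\<Sum>t\<leftarrow>ts. - H (t # u # R) (P # c))"
        by (intro arg_cong[of _ _ sum_list] map_cong) simp_all
      also have "\<dots> = - (\<Sum>t\<leftarrow>ts. H (t # u # R) (P # c))"
        by (simp add: uminus_sum_list_map comp_def)
      also have "\<dots> = 0"
        using right_context.IH[of "u # R" "P # c"] c2 by simp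
      finally show ?thesis by (simp add: comp_def)
    qed simp
  qed
  then show ?thesis unfolding respects_rel_def by blast
qed

text \<open>One filling already determines the kind of the gap: it is realised by a bracket of two
  trees followed by a second bracket, which either uses the first one or does not. In the first case
  the gap sum is a Jacobi relation, in the second the two fillings cancel.\<close>

lemma respects_rel_imp_mid:
  assumes alt: "alternating n k \<mu> H" and split: "splitting n k \<mu> H" and rel: "respects_rel n k \<mu> H"
  shows "respects_mid n k \<mu> H"
proof -
  have "(\<Sum>Q\<in>mid n k (part L) P. H L (Q # P # c)) = 0"
    if L: "forest n k L" and c: "path n k P c (wp_top n \<mu>)" for L P c
  proof (cases "mid n k (part L) P = {}")
    case False
    \<comment> \<open>The same exchanges reorder the forest for every filling \<open>Q\<close>, so
      the sign factors out of the sum.\<close>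
    have reorder: "(\<Sum>Q\<in>mid n k (part L) P. H L (Q # P # c)) = 0"
      if L': "mset L = mset L'" and z: "(\<Sum>Q\<in>mid n k (part L') P. H L' (Q # P # c)) = 0" for L'
    proof -
      obtain m where m: "swaps m L L'" using swaps_exists[OF L'] by blast
      have "H L (Q # P # c) = sg m (H L' (Q # P # c))" if "Q \<in> mid n k (part L) P" for Q
        using alternating_swaps[OF alt m] L c that by (simp add: chain_above_def mid_def)
      then have "(\<Sum>Q\<in>mid n k (part L) P. H L (Q # P # c)) = sg m (\<Sum>Q\<in>mid n k (part L) P. H L' (Q # P # c))"
        by (simp add: sg_sum)
      then show ?thesis using z part_cong_mset[OF L'] by simp
    qed
    obtain Q where Q: "wp_cover n k (part L) Q" "wp_cover n k Q P"
      using False by (auto simp: mid_def)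
    obtain x y R r where xy: "mset L = mset (x # y # R)" "r \<in> {1..k}" "Q = part (Bracket r x y # R)"
      "forest n k (Bracket r x y # R)"
      using wp_cover_partE[OF L Q(1)] by blast
    obtain u v S s where uv: "mset (Bracket r x y # R) = mset (u # v # S)" "s \<in> {1..k}"
      "P = part (Bracket s u v # S)" "forest n k (Bracket s u v # S)"
      using wp_cover_partE[of n k "Bracket r x y # R" P] Q(2) xy(3,4) by blast
    have "Bracket r x y \<in># mset (u # v # S)" by (metis uv(1) list.set_intros(1) set_mset_mset)
    then consider "Bracket r x y = u \<or> Bracket r x y = v" | "Bracket r x y \<noteq> u" "Bracket r x y \<noteq> v" "Bracket r x y \<in> set S"
      by auto
    then show ?thesis
    proof cases
      case 1
      \<comment> \<open>The partner of the first bracket in the second one, on whichever side it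
        stands.\<close>
      define z where "z = (if Bracket r x y = u then v else u)"
      have R: "mset R = mset (z # S)" using 1 uv(1) by (auto simp: z_def add_mset_commute split: if_splits)
      have Lxyz: "mset L = mset (x # y # z # S)" using xy(1) R by simp
      have P: "P = part (Bracket s x (Bracket r y z) # S)"
        using 1 unfolding uv(3) z_def by (auto simp: wblock_def ac_simps)
      have f0: "forest n k (x # y # z # S)" using L forest_cong_mset[OF Lxyz] by simp
      then have f: "forest n k (Bracket s (Bracket r x y) z # S)"
        using xy(2) uv(2) by (simp add: forest_Bracket_Cons)
      have c1: "chain_above n k \<mu> (Bracket s x (Bracket r y z) # S) c"
        using f c P by (simp add: chain_above_def forest_nested)
      have c2: "chain_above n k \<mu> (Bracket r x (Bracket s y z) # S) c"
        using c1 by (simp add: chain_above_def forest_nested_swap[of n k r] part_nested_swap[of r] del: part_simps)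
      have c1': "\<forall>t\<in>set [Bracket i x (Bracket j y z), Bracket i z (Bracket j x y), Bracket i y (Bracket j z x)].
          chain_above n k \<mu> (t # S) c" if "chain_above n k \<mu> (Bracket i x (Bracket j y z) # S) c" for i j
        using that by (simp add: chain_above_def forest_nested part_nested del: part_simps)
      show ?thesis
      proof (rule reorder[OF Lxyz], cases "r = s")
        case True
        have rel0: "(\<Sum>t\<leftarrow>[Bracket s x (Bracket r y z), Bracket s z (Bracket r x y), Bracket s y (Bracket r z x)].
            H (t # S) c) = 0"
          using rel[unfolded respects_rel_def, rule_format, OF lie_rel.jacobi[of s x y z], of S c] c1'[OF c1] True by blast
        have "0 = H (Bracket s x (Bracket r y z) # S) c + H (Bracket s z (Bracket r x y) # S) c + H (Bracket s y (Bracket r z x) # S) c"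
          using rel0 by (simp add: add.assoc)
        also have "\<dots> = - (\<Sum>Q\<in>mid n k (part (x # y # z # S)) P. H (x # y # z # S) (Q # P # c))"
          using mid_three(2)[OF f True, of "\<lambda>Q. H (x # y # z # S) (Q # P # c)"]
          unfolding jacobi_mid[OF alt split c1] part_nested P[symmetric] by simp
        finally show "(\<Sum>Q\<in>mid n k (part (x # y # z # S)) P. H (x # y # z # S) (Q # P # c)) = 0" by simp
      next
        case False
        have rel0: "(\<Sum>t\<leftarrow>[Bracket s x (Bracket r y z), Bracket s z (Bracket r x y), Bracket s y (Bracket r z x),
            Bracket r x (Bracket s y z), Bracket r z (Bracket s x y), Bracket r y (Bracket s z x)]. H (t # S) c) = 0"
          using rel[unfolded respects_rel_def, rule_format, OF lie_rel.mixed_jacobi[of s r x y z], of S c]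
            c1'[OF c1] c1'[OF c2] False by auto
        have "0 = (H (Bracket s x (Bracket r y z) # S) c + H (Bracket s z (Bracket r x y) # S) c + H (Bracket s y (Bracket r z x) # S) c) +
          (H (Bracket r x (Bracket s y z) # S) c + H (Bracket r z (Bracket s x y) # S) c + H (Bracket r y (Bracket s z x) # S) c)"
          using rel0 by (simp add: add.assoc)
        also have "\<dots> = - (\<Sum>Q\<in>mid n k (part (x # y # z # S)) P. H (x # y # z # S) (Q # P # c))"
          using mid_three(3)[OF f False, of "\<lambda>Q. H (x # y # z # S) (Q # P # c)"]
          unfolding jacobi_mid[OF alt split c1] jacobi_mid[OF alt split c2, unfolded part_nested_swap[of r x s]]
            part_nested P[symmetric] by simp
        finally show "(\<Sum>Q\<in>mid n k (part (x # y # z # S)) P. H (x # y # z # S) (Q # P # c)) = 0" by simp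
      qed
    next
      case 2
      then obtain S' where S': "mset S = mset (Bracket r x y # S')"
        by (metis ex_mset insert_DiffM mset.simps(2) set_mset_mset)
      have R: "mset R = mset (u # v # S')"
      proof -
        have "add_mset (Bracket r x y) (mset R) = add_mset (Bracket r x y) (mset (u # v # S'))"
          using uv(1) S' by (simp add: add_mset_commute)
        then show ?thesis by simp
      qed
      have Lm: "mset L = mset (x # y # u # v # S')" using xy(1) R by simp
      have f0: "forest n k (x # y # u # v # S')" using L forest_cong_mset[OF Lm] by simp
      have P: "P = part (Bracket r x y # Bracket s u v # S')"
        unfolding uv(3) using part_cong_mset[OF S'] by (simp add: insert_commute)
      have f: "forest n k (Bracket r x y # Bracket s u v # S')"
        using f0 xy(2) uv(2) forest_Bracket[of n k "[x, y]" s u v S'] by (simp add: forest_Bracket_Cons)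
      have c0: "chain_above n k \<mu> (Bracket r x y # Bracket s u v # S') c"
        using f c P by (simp add: chain_above_def)
      have c1: "chain_above n k \<mu> (x # y # Bracket s u v # S') (P # c)"
        using chain_above_split_Cons[OF c0] P by simp
      have c2: "chain_above n k \<mu> (Bracket r x y # u # v # S') (P # c)"
        using chain_above_split[of n k \<mu> "[Bracket r x y]" s u v S' c] c0 P by simp
      \<comment> \<open>The forest \<open>Bracket r x y # Bracket s u v # S'\<close> is split in
        both orders. In \<open>A\<close> the bracket of \<open>u\<close> and \<open>v\<close> is
        split while the other one is intact, at position 1; in \<open>B\<close> it is split after
        the other one, at position 2. Hence the opposite signs.\<close>
      have A: "H (x # y # u # v # S') (part (Bracket r x y # u # v # S') # P # c) =
          - H (Bracket r x y # Bracket s u v # S') c"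
        using splitting_Cons[OF split c2] split[unfolded splitting_def, rule_format, of "[Bracket r x y]" s u v S' c] c0 P
        by simp
      have B: "H (x # y # u # v # S') (part (x # y # Bracket s u v # S') # P # c) =
          H (Bracket r x y # Bracket s u v # S') c"
        using splitting_Cons[OF split c0] split[unfolded splitting_def, rule_format, of "[x, y]" s u v S' "P # c"] c1 P
        by simp
      show ?thesis
      proof (rule reorder[OF Lm])
        show "(\<Sum>Q\<in>mid n k (part (x # y # u # v # S')) P. H (x # y # u # v # S') (Q # P # c)) = 0"
          unfolding P mid_disjoint(1)[OF f] using mid_disjoint(2)[OF f] A B unfolding P by (simp del: part_simps)
      qed
    qed
  qed simp
  then show ?thesis unfolding respects_mid_def by blast
qed

section \<open>Uniqueness of alternating functions, and propagation of alternation from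
  leaves\<close>

lemma forest_letters_or_Bracket:
  "(\<exists>w. L = map Letter w) \<or> (\<exists>L1 r x y L2. L = L1 @ Bracket r x y # L2)"
proof (induction L)
  case (Cons t L)
  show ?case
  proof (cases t)
    case (Letter a)
    show ?thesis
      using Cons.IH
    proof (elim disjE exE)
      fix w assume "L = map Letter w"
      then have "t # L = map Letter (a # w)" using Letter by simp
      then show ?thesis by (intro disjI1 exI)
    next
      fix L1 r x y L2 assume "L = L1 @ Bracket r x y # L2"
      then have "t # L = (t # L1) @ Bracket r x y # L2" by simp
      then show ?thesis by (intro disjI2 exI)
    qed
  next
    case (Bracket r x y)
    then have "t # L = [] @ Bracket r x y # L" by simp
    then show ?thesis by (intro disjI2 exI)
  qed
qed simp

definition total_brackets :: "'a bracketing list \<Rightarrow> nat" where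
  "total_brackets L = length (concat (map bracket_types L))"

text \<open>Each split removes a bracket, so the forest shrinks to leaves while the chain grows
  downwards.\<close>

lemma splitting_unique_letters:
  assumes "splitting n k \<mu> H" "splitting n k \<mu> H'"
    and letters: "\<And>w c. chain_above n k \<mu> (map Letter w) c \<Longrightarrow> H (map Letter w) c = H' (map Letter w) c"
  shows "chain_above n k \<mu> L c \<Longrightarrow> H L c = H' L c"
proof (induction "total_brackets L" arbitrary: L c rule: less_induct)
  case less
  consider w where "L = map Letter w" | L1 r x y L2 where "L = L1 @ Bracket r x y # L2"
    using forest_letters_or_Bracket[of L] by blast
  then show ?case
  proof cases
    case 1
    then show ?thesis using letters less.prems by simp
  next
    case 2
    have "H (L1 @ x # y # L2) (part L # c) = H' (L1 @ x # y # L2) (part L # c)"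
      using less.hyps[of "L1 @ x # y # L2"] chain_above_split[of n k \<mu> L1 r x y L2 c] less.prems
      unfolding 2 by (simp add: total_brackets_def del: part_simps)
    then show ?thesis
      using assms(1,2)[unfolded splitting_def, rule_format, OF less.prems[unfolded 2]] 2 by (simp del: part_simps)
  qed
qed

text \<open>The opposite direction: each element of the chain is turned into a bracket, until the
  chain is used up and a single tree is left.\<close>

lemma alternating_splitting_unique_tree:
  assumes "alternating n k \<mu> H" "splitting n k \<mu> H" "alternating n k \<mu> H'" "splitting n k \<mu> H'"
    and tree: "\<And>t. chain_above n k \<mu> [t] [] \<Longrightarrow> H [t] [] = H' [t] []"
  shows "chain_above n k \<mu> L c \<Longrightarrow> H L c = H' L c"
proof (induction c arbitrary: L)
  case Nil
  then show ?case using chain_above_Nil tree by blast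
next
  case (Cons Q c)
  then have f: "forest n k L" and cov: "wp_cover n k (part L) Q" and p: "path n k Q c (wp_top n \<mu>)"
    by (auto simp: chain_above_def)
  obtain x y R r where xy: "mset L = mset (x # y # R)" "r \<in> {1..k}" "Q = part (Bracket r x y # R)"
    "forest n k (Bracket r x y # R)"
    by (rule wp_cover_partE[OF f cov])
  obtain m where m: "swaps m L (x # y # R)" using swaps_exists[OF xy(1)] by blast
  have c: "chain_above n k \<mu> (Bracket r x y # R) c" using xy p by (simp add: chain_above_def)
  show ?case
    using alternating_swaps[OF assms(1) m Cons.prems] alternating_swaps[OF assms(3) m Cons.prems]
      splitting_Cons[OF assms(2) c] splitting_Cons[OF assms(4) c] Cons.IH[OF c] unfolding xy(3) by simp
qed

text \<open>A prefix of the chain is absorbed into the forest by turning its elements into brackets.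
  The new forest and the sign do not depend on the remaining chain \<open>d\<close>, so the lemma
  can be applied under a sum over the fillings behind the prefix.\<close>

lemma alternating_splitting_prefix:
  assumes "alternating n k \<mu> H" "splitting n k \<mu> H"
  shows "forest n k L \<Longrightarrow> path n k (part L) pre P \<Longrightarrow>
    \<exists>L' m. forest n k L' \<and> part L' = P \<and> (\<forall>d. path n k P d (wp_top n \<mu>) \<longrightarrow> H L (pre @ d) = sg m (H L' d))"
proof (induction pre arbitrary: L)
  case Nil
  then show ?case by (intro exI[of _ L] exI[of _ 0]) auto
next
  case (Cons Q pre)
  then have cov: "wp_cover n k (part L) Q" and p: "path n k Q pre P"
    by auto
  obtain x y R r where xy: "mset L = mset (x # y # R)" "r \<in> {1..k}" "Q = part (Bracket r x y # R)"
    "forest n k (Bracket r x y # R)"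
    by (rule wp_cover_partE[OF Cons.prems(1) cov])
  obtain m where m: "swaps m L (x # y # R)" using swaps_exists[OF xy(1)] by blast
  obtain L' m' where L': "forest n k L'" "part L' = P"
    "\<And>d. path n k P d (wp_top n \<mu>) \<Longrightarrow> H (Bracket r x y # R) (pre @ d) = sg m' (H L' d)"
    using Cons.IH[OF xy(4)] p xy(3) by blast
  have "H L ((Q # pre) @ d) = sg (m + m') (H L' d)" if d: "path n k P d (wp_top n \<mu>)" for d
  proof -
    have pd: "path n k Q (pre @ d) (wp_top n \<mu>)" using p d path_append by blast
    have "chain_above n k \<mu> L (Q # pre @ d)" using Cons.prems(1) cov pd by (simp add: chain_above_def)
    moreover have "chain_above n k \<mu> (Bracket r x y # R) (pre @ d)" using xy pd by (simp add: chain_above_def)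
    ultimately show ?thesis
      using alternating_swaps[OF assms(1) m] splitting_Cons[OF assms(2)] L'(3)[OF d] unfolding xy(3) by simp
  qed
  then show ?case using L' by blast
qed

text \<open>By splitting, alternation has to be checked on leaves only. A bracket apart from the two
  exchanged trees is split on both sides alike; if one of the exchanged trees is a bracket, the
  other tree passes both of its halves.\<close>

lemma splitting_alternating:
  assumes split: "splitting n k \<mu> H"
    and letters: "\<And>v a b w c. chain_above n k \<mu> (map Letter (v @ a # b # w)) c \<Longrightarrow>
      H (map Letter (v @ b # a # w)) c = - H (map Letter (v @ a # b # w)) c"
  shows "alternating n k \<mu> H"
proof -
  note sp = split[unfolded splitting_def, rule_format]
  have "H (L1 @ b # a # L2) c = - H (L1 @ a # b # L2) c" if "chain_above n k \<mu> (L1 @ a # b # L2) c" for L1 a b L2 c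
    using that
  proof (induction "total_brackets (L1 @ a # b # L2)" arbitrary: L1 a b L2 c rule: less_induct)
    case less
    note c = less.prems
    have c': "chain_above n k \<mu> (L1 @ b # a # L2) c"
      using c chain_above_cong_mset[of "L1 @ b # a # L2" "L1 @ a # b # L2"] by (simp add: add_mset_commute)
    consider (L1) A r x y B where "L1 = A @ Bracket r x y # B" | (L2) A r x y B where "L2 = A @ Bracket r x y # B"
      | (a) r x y where "a = Bracket r x y" | (b) r x y where "b = Bracket r x y"
      | (none) v a' b' w where "L1 = map Letter v" "L2 = map Letter w" "a = Letter a'" "b = Letter b'"
      using forest_letters_or_Bracket[of L1] forest_letters_or_Bracket[of L2]
      by (cases a; cases b) blast+
    then show ?case
    proof cases
      case L1
      let ?P = "part (L1 @ a # b # L2)"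
      have P: "part (L1 @ b # a # L2) = ?P" by auto
      have "chain_above n k \<mu> ((A @ x # y # B) @ a # b # L2) (?P # c)"
        using chain_above_split[of n k \<mu> A r x y "B @ a # b # L2" c] c unfolding L1 by (simp del: part_simps)
      moreover have "total_brackets ((A @ x # y # B) @ a # b # L2) < total_brackets (L1 @ a # b # L2)"
        by (simp add: total_brackets_def L1)
      ultimately have "H ((A @ x # y # B) @ b # a # L2) (?P # c) = - H ((A @ x # y # B) @ a # b # L2) (?P # c)"
        using less.hyps by blast
      then show ?thesis
        using sp[of A r x y "B @ a # b # L2" c] sp[of A r x y "B @ b # a # L2" c] c c' P L1
        by (simp del: part_simps flip: sg_simps(3))
    next
      case L2
      let ?P = "part (L1 @ a # b # L2)"
      have P: "part (L1 @ b # a # L2) = ?P" by auto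
      have "chain_above n k \<mu> (L1 @ a # b # A @ x # y # B) (?P # c)"
        using chain_above_split[of n k \<mu> "L1 @ a # b # A" r x y "B" c] c unfolding L2 by (simp del: part_simps)
      moreover have "total_brackets (L1 @ a # b # A @ x # y # B) < total_brackets (L1 @ a # b # L2)"
        by (simp add: total_brackets_def L2)
      ultimately have "H (L1 @ b # a # A @ x # y # B) (?P # c) = - H (L1 @ a # b # A @ x # y # B) (?P # c)"
        using less.hyps by blast
      then show ?thesis
        using sp[of "L1 @ a # b # A" r x y B c] sp[of "L1 @ b # a # A" r x y B c] c c' P L2
        by (simp del: part_simps flip: sg_simps(3))
    next
      case a
      let ?P = "part (L1 @ a # b # L2)"
      have P: "part (L1 @ b # a # L2) = ?P" by auto
      have c1: "chain_above n k \<mu> (L1 @ x # y # b # L2) (?P # c)"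
        using chain_above_split[of n k \<mu> L1 r x y "b # L2" c] c unfolding a by (simp del: part_simps)
      have lt1: "total_brackets ((L1 @ [x]) @ y # b # L2) < total_brackets (L1 @ a # b # L2)"
        by (simp add: total_brackets_def a)
      have lt2: "total_brackets (L1 @ x # b # y # L2) < total_brackets (L1 @ a # b # L2)"
        by (simp add: total_brackets_def a)
      have 1: "H (L1 @ x # b # y # L2) (?P # c) = - H (L1 @ x # y # b # L2) (?P # c)"
        using less.hyps[OF lt1, of "?P # c"] c1 by simp
      have "chain_above n k \<mu> (L1 @ x # b # y # L2) (?P # c)"
        using c1 chain_above_cong_mset[of "L1 @ x # b # y # L2" "L1 @ x # y # b # L2"] by (simp add: add_mset_commute)
      then have 2: "H (L1 @ b # x # y # L2) (?P # c) = - H (L1 @ x # b # y # L2) (?P # c)"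
        using less.hyps[OF lt2, of "?P # c"] by simp
      \<comment> \<open>Passing two trees costs no sign; the sign comes from the position of the
        split, which is higher by one when \<open>a\<close> stands behind \<open>b\<close>.\<close>
      have "H (L1 @ b # x # y # L2) (?P # c) = H (L1 @ x # y # b # L2) (?P # c)"
        using 1 2 by simp
      moreover have "H (L1 @ x # y # b # L2) (?P # c) = sg (length L1) (H (L1 @ a # b # L2) c)"
        using sp[of L1 r x y "b # L2" c] c a by (simp del: part_simps)
      moreover have "H (L1 @ b # x # y # L2) (?P # c) = - sg (length L1) (H (L1 @ b # a # L2) c)"
        using sp[of "L1 @ [b]" r x y "L2" c] c' a P by (simp del: part_simps)
      ultimately show ?thesis by (metis minus_minus sg_simps(3,7))
    next
      case b
      let ?P = "part (L1 @ a # b # L2)"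
      have P: "part (L1 @ b # a # L2) = ?P" by auto
      have c1: "chain_above n k \<mu> (L1 @ a # x # y # L2) (?P # c)"
        using chain_above_split[of n k \<mu> "L1 @ [a]" r x y "L2" c] c unfolding b by (simp del: part_simps)
      have lt1: "total_brackets (L1 @ a # x # y # L2) < total_brackets (L1 @ a # b # L2)"
        by (simp add: total_brackets_def b)
      have lt2: "total_brackets ((L1 @ [x]) @ a # y # L2) < total_brackets (L1 @ a # b # L2)"
        by (simp add: total_brackets_def b)
      have 1: "H (L1 @ x # a # y # L2) (?P # c) = - H (L1 @ a # x # y # L2) (?P # c)"
        using less.hyps[OF lt1, of "?P # c"] c1 by simp
      have "chain_above n k \<mu> (L1 @ x # a # y # L2) (?P # c)"
        using c1 chain_above_cong_mset[of "L1 @ x # a # y # L2" "L1 @ a # x # y # L2"] by (simp add: add_mset_commute)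
      then have 2: "H (L1 @ x # y # a # L2) (?P # c) = - H (L1 @ x # a # y # L2) (?P # c)"
        using less.hyps[OF lt2, of "?P # c"] by simp
      have "H (L1 @ x # y # a # L2) (?P # c) = H (L1 @ a # x # y # L2) (?P # c)"
        using 1 2 by simp
      moreover have "H (L1 @ x # y # a # L2) (?P # c) = sg (length L1) (H (L1 @ b # a # L2) c)"
        using sp[of L1 r x y "a # L2" c] c' b P by (simp del: part_simps)
      moreover have "H (L1 @ a # x # y # L2) (?P # c) = - sg (length L1) (H (L1 @ a # b # L2) c)"
        using sp[of "L1 @ [a]" r x y "L2" c] c b by (simp del: part_simps)
      ultimately show ?thesis by (metis sg_simps(3,7))
    next
      case none
      then show ?thesis using letters[of v a' b' w c] c by simp
    qed
  qed
  then show ?thesis unfolding alternating_def by blast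
qed

section \<open>From chains to trees\<close>

text \<open>The number of pairs with \<open>False\<close> before \<open>True\<close>, that is, of
  adjacent exchanges that bring the marked entries to the front while both groups keep their
  order.\<close>

fun inversions :: "bool list \<Rightarrow> nat" where
  "inversions [] = 0"
| "inversions (b # bs) = (if b then 0 else count_list bs True) + inversions bs"

lemma inversions_swap: "inversions (as @ False # True # bs) = Suc (inversions (as @ True # False # bs))"
  by (induction as) auto

text \<open>The trees whose block is missing from \<open>Q\<close> are the two that the step to
  \<open>Q\<close> merges. They are moved to the front in their given order, at the cost of the sign
  of this move, and bracketed with the only type that leads to \<open>Q\<close>. At the end of the
  chain one tree is left, which \<open>hd\<close> picks. The result is, up to sign, a single value
  of \<phi>.\<close>

fun tree_sum :: "(nat bracketing \<Rightarrow> 'v::ab_group_add) \<Rightarrow> nat bracketing list \<Rightarrow> wpartition list \<Rightarrow> 'v" where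
  "tree_sum \<phi> L [] = \<phi> (hd L)"
| "tree_sum \<phi> L (Q # c) =
    (let new = (\<lambda>t. wblock t \<notin> Q); R = filter (\<lambda>t. wblock t \<in> Q) L;
         x = filter new L ! 0; y = filter new L ! 1; r = (THE r. part (Bracket r x y # R) = Q)
     in sg (inversions (map new L)) (tree_sum \<phi> (Bracket r x y # R) c))"

declare tree_sum.simps(2) [simp del]

text \<open>The type is visible in the weight of the new block. This makes the choice by
  \<open>THE\<close> in \<open>tree_sum\<close> well defined.\<close>

lemma part_Bracket_inject:
  assumes "forest n k (x # y # R)"
  shows "part (Bracket r x y # R) = part (Bracket s x y # R) \<longleftrightarrow> r = s"
proof -
  have "wblock x \<noteq> wblock y" using forest_distinct_wblock[OF assms] by simp
  then show ?thesis
    unfolding part_merge[OF assms] using merge_inject[OF disjoint_blocks_part[OF assms]] by simp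
qed

text \<open>Replaces the recursion equation for chains above a forest: exactly two blocks disappear
  in a cover, so the filter leaves exactly two trees.\<close>

lemma tree_sum_step:
  assumes c: "chain_above n k \<mu> L (Q # c)"
  obtains x y r where "filter (\<lambda>t. wblock t \<notin> Q) L = [x, y]"
    "chain_above n k \<mu> (Bracket r x y # filter (\<lambda>t. wblock t \<in> Q) L) c"
    "Q = part (Bracket r x y # filter (\<lambda>t. wblock t \<in> Q) L)"
    "\<And>\<phi>. tree_sum \<phi> L (Q # c) = sg (inversions (map (\<lambda>t. wblock t \<notin> Q) L))
       (tree_sum \<phi> (Bracket r x y # filter (\<lambda>t. wblock t \<in> Q) L) c)"
proof -
  have f: "forest n k L" and cov: "wp_cover n k (part L) Q" and p: "path n k Q c (wp_top n \<mu>)"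
    using c by (auto simp: chain_above_def)
  obtain x0 y0 R0 r where xy: "mset L = mset (x0 # y0 # R0)" "r \<in> {1..k}" "Q = part (Bracket r x0 y0 # R0)"
    "forest n k (Bracket r x0 y0 # R0)"
    by (rule wp_cover_partE[OF f cov])
  have f0: "forest n k (x0 # y0 # R0)" using f forest_cong_mset[OF xy(1)] by simp
  have Qm: "Q = merge (part (x0 # y0 # R0)) r (wblock x0) (wblock y0)"
    using part_merge[OF f0] xy(3) by simp
  have d: "wblock x0 \<noteq> wblock y0" using forest_distinct_wblock[OF f0] by simp
  have "wblock x0 \<notin> Q" "wblock y0 \<notin> Q"
    using merge_diff(1)[OF disjoint_blocks_part[OF f0] _ _ d, of r] Qm by auto
  moreover have "wblock t \<in> Q" if "t \<in> set R0" for t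
    using that xy(3) by (auto simp: part_def)
  ultimately have new: "filter_mset (\<lambda>t. wblock t \<notin> Q) (mset L) = {#x0, y0#}"
    and old: "filter_mset (\<lambda>t. wblock t \<in> Q) (mset L) = mset R0"
    unfolding xy(1) by (auto simp: filter_mset_eq_conv)
  define R where "R = filter (\<lambda>t. wblock t \<in> Q) L"
  have R: "mset R = mset R0" using old by (simp add: R_def)
  have "mset (filter (\<lambda>t. wblock t \<notin> Q) L) = {#x0, y0#}" using new by simp
  then have m2: "mset (filter (\<lambda>t. wblock t \<notin> Q) L) = {#x0, y0#}" .
  then have "size (mset (filter (\<lambda>t. wblock t \<notin> Q) L)) = 2" by (simp only: size_add_mset size_empty)
  then have "length (filter (\<lambda>t. wblock t \<notin> Q) L) = 2" by (simp only: size_mset)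
  then obtain x y where fx: "filter (\<lambda>t. wblock t \<notin> Q) L = [x, y]"
    by (auto simp: numeral_2_eq_2 length_Suc_conv)
  then have fxy: "filter (\<lambda>t. wblock t \<notin> Q) L = [x, y]" "{#x, y#} = {#x0, y0#}"
    using m2 unfolding fx by simp_all
  \<comment> \<open>The order of \<open>x\<close> and \<open>y\<close> in \<open>L\<close> may be
    opposite to that of \<open>x0\<close> and \<open>y0\<close>; the partition does not see this
    because \<open>join\<close> is commutative.\<close>
  have Q: "Q = part (Bracket r x y # R)"
    using xy(3) part_cong_mset[OF R] fxy(2)
    by (auto simp: add_eq_conv_ex wblock_Bracket join_commute)
  have "mset (x # y # R) = {#x, y#} + mset R" "mset (x0 # y0 # R0) = {#x0, y0#} + mset R0" by simp_all
  then have "mset (x # y # R) = mset (x0 # y0 # R0)" using R fxy(2) by metis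
  then have fxyR: "forest n k (x # y # R)"
    using f0 forest_cong_mset by blast
  then have fB: "forest n k (Bracket r x y # R)" using xy(2) by (simp add: forest_Bracket_Cons)
  have the: "(THE r'. part (Bracket r' x y # R) = Q) = r"
    unfolding Q part_Bracket_inject[OF fxyR] by simp
  show ?thesis
  proof (rule that[OF fxy(1)])
    show "chain_above n k \<mu> (Bracket r x y # filter (\<lambda>t. wblock t \<in> Q) L) c"
      using fB p Q unfolding R_def[symmetric] chain_above_def by simp
    show "Q = part (Bracket r x y # filter (\<lambda>t. wblock t \<in> Q) L)"
      using Q R_def by simp
    show "tree_sum \<phi> L (Q # c) = sg (inversions (map (\<lambda>t. wblock t \<notin> Q) L))
       (tree_sum \<phi> (Bracket r x y # filter (\<lambda>t. wblock t \<in> Q) L) c)" for \<phi>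
      using the fxy(1) unfolding R_def by (simp add: tree_sum.simps(2) Let_def del: part_simps)
  qed
qed

text \<open>The functions on trees of content \<mu> that factor through the Lie relations;
  \<open>chain_above n k \<mu> [t] []\<close> says that \<open>t\<close> is such a tree.\<close>

definition tree_function :: "nat \<Rightarrow> nat \<Rightarrow> (nat \<Rightarrow>\<^sub>0 nat) \<Rightarrow> (nat bracketing \<Rightarrow> 'v::ab_group_add) \<Rightarrow> bool" where
  "tree_function n k \<mu> \<phi> \<longleftrightarrow> (\<forall>ts. lie_rel ts \<longrightarrow> (\<forall>t\<in>set ts. chain_above n k \<mu> [t] []) \<longrightarrow> (\<Sum>t\<leftarrow>ts. \<phi> t) = 0)"

lemma tree_sum_rel:
  assumes \<phi>: "tree_function n k \<mu> \<phi>"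
  shows "lie_rel ts \<Longrightarrow> (\<And>t. t \<in> set ts \<Longrightarrow> chain_above n k \<mu> (L1 @ t # L2) c) \<Longrightarrow>
    (\<Sum>t\<leftarrow>ts. tree_sum \<phi> (L1 @ t # L2) c) = 0"
proof (induction c arbitrary: ts L1 L2)
  case Nil
  show ?case
  proof (cases ts)
    case (Cons t0 ts')
    then obtain t' where "L1 @ t0 # L2 = [t']" using chain_above_Nil[OF Nil(2)[of t0]] by auto
    then have "L1 = []" "L2 = []" by (auto simp: append_eq_Cons_conv)
    then show ?thesis using \<phi> Nil by (simp add: tree_function_def)
  qed simp
next
  case (Cons Q c)
  show ?case
  proof (cases ts)
    case ts: (Cons t0 ts')
    then have t0: "t0 \<in> set ts" by simp
    let ?new = "\<lambda>t. wblock t \<notin> Q" and ?old = "\<lambda>t. wblock t \<in> Q"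
    let ?R1 = "filter ?old L1" and ?R2 = "filter ?old L2"
    have wb: "wblock t = wblock t0" if "t \<in> set ts" for t
      using lie_rel_wblock[OF Cons.prems(1) that t0] .
    obtain m where m: "inversions (map ?new (L1 @ t # L2)) = m" if "t \<in> set ts" for t
      using wb by simp
    obtain x y r where xyr: "filter ?new (L1 @ t0 # L2) = [x, y]" 
       "chain_above n k \<mu> (Bracket r x y # filter ?old (L1 @ t0 # L2)) c"
       "Q = part (Bracket r x y # filter ?old (L1 @ t0 # L2))"
      using tree_sum_step[OF Cons.prems(2)[OF t0]] by metis
    show ?thesis
    proof (cases "?old t0")
      case True
      have step: "tree_sum \<phi> (L1 @ t # L2) (Q # c) = sg m (tree_sum \<phi> ((Bracket r x y # ?R1) @ t # ?R2) c) \<and>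
          chain_above n k \<mu> ((Bracket r x y # ?R1) @ t # ?R2) c" if t: "t \<in> set ts" for t
      proof -
        obtain x' y' r' where s: "filter ?new (L1 @ t # L2) = [x', y']"
          "chain_above n k \<mu> (Bracket r' x' y' # filter ?old (L1 @ t # L2)) c"
          "Q = part (Bracket r' x' y' # filter ?old (L1 @ t # L2))"
          "tree_sum \<phi> (L1 @ t # L2) (Q # c) = sg (inversions (map ?new (L1 @ t # L2)))
             (tree_sum \<phi> (Bracket r' x' y' # filter ?old (L1 @ t # L2)) c)"
          using tree_sum_step[OF Cons.prems(2)[OF t]] by metis
        have xy: "x' = x" "y' = y" using s(1) xyr(1) True wb[OF t] by auto
        have fo: "filter ?old (L1 @ t # L2) = ?R1 @ t # ?R2" using True wb[OF t] by simp
        have "part (Bracket r' x y # ?R1 @ t # ?R2) = part (Bracket r x y # ?R1 @ t # ?R2)"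
          using s(3)[unfolded fo xy] xyr(3) True wb[OF t] by auto
        moreover have "forest n k (x # y # ?R1 @ t # ?R2)"
          using s(2)[unfolded fo xy] by (simp add: chain_above_def forest_Bracket_Cons)
        ultimately have "r' = r" using part_Bracket_inject by blast
        then show ?thesis using s(2,4) m[OF t] unfolding fo xy by simp
      qed
      have "(\<Sum>t\<leftarrow>ts. tree_sum \<phi> (L1 @ t # L2) (Q # c)) = (\<Sum>t\<leftarrow>ts. sg m (tree_sum \<phi> ((Bracket r x y # ?R1) @ t # ?R2) c))"
        using step by (intro arg_cong[of _ _ sum_list] map_cong) blast+
      also have "\<dots> = sg m (\<Sum>t\<leftarrow>ts. tree_sum \<phi> ((Bracket r x y # ?R1) @ t # ?R2) c)"
        by (simp add: sg_sum_list)
      also have "\<dots> = 0"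
        using Cons.IH[OF Cons.prems(1), of "Bracket r x y # ?R1" ?R2] step by simp
      finally show ?thesis .
    next
      case False
      have fo: "filter ?old (L1 @ t # L2) = ?R1 @ ?R2" if "t \<in> set ts" for t
        using False wb[OF that] by simp
      have "filter ?new L1 @ t0 # filter ?new L2 = [x, y]" using xyr(1) False by simp
      then consider (l) "filter ?new L1 = []" "filter ?new L2 = [y]" "x = t0"
        | (r) "filter ?new L1 = [x]" "filter ?new L2 = []" "y = t0"
        by (auto simp: append_eq_Cons_conv)
      \<comment> \<open>\<open>C\<close> is the context that the step puts around the varying tree,
        as its left or its right argument.\<close>
      then obtain C where C: "C = (\<lambda>t. Bracket r t y) \<and> (\<forall>t\<in>set ts. filter ?new (L1 @ t # L2) = [t, y]) \<and> x = t0 \<or>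
          C = (\<lambda>t. Bracket r x t) \<and> (\<forall>t\<in>set ts. filter ?new (L1 @ t # L2) = [x, t]) \<and> y = t0"
      proof cases
        case l
        then show thesis using that[of "\<lambda>t. Bracket r t y"] False wb by simp
      next
        case r
        then show thesis using that[of "\<lambda>t. Bracket r x t"] False wb by simp
      qed
      have step: "tree_sum \<phi> (L1 @ t # L2) (Q # c) = sg m (tree_sum \<phi> (C t # ?R1 @ ?R2) c) \<and>
          chain_above n k \<mu> (C t # ?R1 @ ?R2) c" if t: "t \<in> set ts" for t
      proof -
        obtain x' y' r' where s: "filter ?new (L1 @ t # L2) = [x', y']"
          "chain_above n k \<mu> (Bracket r' x' y' # filter ?old (L1 @ t # L2)) c"
          "Q = part (Bracket r' x' y' # filter ?old (L1 @ t # L2))"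
          "tree_sum \<phi> (L1 @ t # L2) (Q # c) = sg (inversions (map ?new (L1 @ t # L2)))
             (tree_sum \<phi> (Bracket r' x' y' # filter ?old (L1 @ t # L2)) c)"
          using tree_sum_step[OF Cons.prems(2)[OF t]] by metis
        have Ct: "C t = Bracket r x' y'" "wblock x' = wblock x" "wblock y' = wblock y"
          using C s(1) t wb[OF t] by auto
        have "part (Bracket r' x' y' # ?R1 @ ?R2) = part (Bracket r x' y' # ?R1 @ ?R2)"
          using s(3)[unfolded fo[OF t]] xyr(3)[unfolded fo[OF t0]] Ct by (simp add: wblock_Bracket)
        moreover have "forest n k (x' # y' # ?R1 @ ?R2)"
          using s(2)[unfolded fo[OF t]] by (simp add: chain_above_def forest_Bracket_Cons)
        ultimately have "r' = r" using part_Bracket_inject by blast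
        then show ?thesis using s(2,4) m[OF t] Ct(1) unfolding fo[OF t] by simp
      qed
      have rel: "lie_rel (map C ts)"
        using C lie_rel.left_context[OF Cons.prems(1)] lie_rel.right_context[OF Cons.prems(1)] by auto
      have "(\<Sum>t\<leftarrow>ts. tree_sum \<phi> (L1 @ t # L2) (Q # c)) = (\<Sum>t\<leftarrow>ts. sg m (tree_sum \<phi> (C t # ?R1 @ ?R2) c))"
        using step by (intro arg_cong[of _ _ sum_list] map_cong) blast+
      also have "\<dots> = sg m (\<Sum>t\<leftarrow>ts. tree_sum \<phi> (C t # ?R1 @ ?R2) c)"
        by (simp add: sg_sum_list)
      also have "(\<Sum>t\<leftarrow>ts. tree_sum \<phi> (C t # ?R1 @ ?R2) c) = (\<Sum>t\<leftarrow>map C ts. tree_sum \<phi> ([] @ t # ?R1 @ ?R2) c)"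
        by (simp add: comp_def)
      also have "\<dots> = 0"
        using step by (intro Cons.IH[OF rel]) auto
      finally show ?thesis by simp
    qed
  qed simp
qed

lemma tree_sum_respects_rel:
  assumes "tree_function n k \<mu> \<phi>"
  shows "respects_rel n k \<mu> (tree_sum \<phi>)"
  using tree_sum_rel[OF assms, of _ "[]"] by (simp add: respects_rel_def)

text \<open>Exchanging two neighbours changes the inversion count by one if exactly one of them is
  merged in the next step. If both are merged, the count stays and the sign comes from antisymmetry
  of the bracket; if neither is, it comes from the rest of the chain.\<close>

lemma tree_sum_alternating:
  assumes \<phi>: "tree_function n k \<mu> \<phi>"
  shows "alternating n k \<mu> (tree_sum \<phi>)"
proof -
  have "tree_sum \<phi> (L1 @ b # a # L2) c = - tree_sum \<phi> (L1 @ a # b # L2) c"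
    if "chain_above n k \<mu> (L1 @ a # b # L2) c" for L1 a b L2 c
    using that
  proof (induction c arbitrary: L1 a b L2)
    case Nil
    then show ?case using chain_above_Nil by (fastforce simp: append_eq_Cons_conv)
  next
    case (Cons Q c)
    let ?new = "\<lambda>t. wblock t \<notin> Q" and ?old = "\<lambda>t. wblock t \<in> Q"
    let ?R1 = "filter ?old L1" and ?R2 = "filter ?old L2"
    let ?L = "L1 @ a # b # L2" and ?L' = "L1 @ b # a # L2"
    have c': "chain_above n k \<mu> ?L' (Q # c)"
      using Cons.prems chain_above_cong_mset[of ?L' ?L] by (simp add: add_mset_commute)
    obtain x y r where s: "filter ?new ?L = [x, y]" "chain_above n k \<mu> (Bracket r x y # filter ?old ?L) c"
      "Q = part (Bracket r x y # filter ?old ?L)"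
      "tree_sum \<phi> ?L (Q # c) = sg (inversions (map ?new ?L)) (tree_sum \<phi> (Bracket r x y # filter ?old ?L) c)"
      using tree_sum_step[OF Cons.prems] by metis
    obtain x' y' r' where s': "filter ?new ?L' = [x', y']" "chain_above n k \<mu> (Bracket r' x' y' # filter ?old ?L') c"
      "Q = part (Bracket r' x' y' # filter ?old ?L')"
      "tree_sum \<phi> ?L' (Q # c) = sg (inversions (map ?new ?L')) (tree_sum \<phi> (Bracket r' x' y' # filter ?old ?L') c)"
      using tree_sum_step[OF c'] by metis
    have f: "forest n k (x # y # filter ?old ?L)"
      using s(2) by (simp add: chain_above_def forest_Bracket_Cons)
    have po: "part (filter ?old ?L') = part (filter ?old ?L)" by auto
    have xy: "wblock (Bracket r' x' y') = wblock (Bracket r' x y)"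
      using s(1) s'(1) by (cases "?new a"; cases "?new b") (auto simp: append_eq_Cons_conv wblock_Bracket join_commute)
    have "part (Bracket r' x y # filter ?old ?L) = part (Bracket r x y # filter ?old ?L)"
      using s(3) s'(3) xy po unfolding part_simps(2) by metis
    then have r': "r' = r" using part_Bracket_inject[OF f] by blast
    consider "?new a" "?new b" | "?new a" "?old b" | "?old a" "?new b" | "?old a" "?old b" by blast
    then show ?case
    proof cases
      case 1
      then have e: "x = a" "y = b" "x' = b" "y' = a" using s(1) s'(1) by (auto simp: append_eq_Cons_conv)
      have o: "filter ?old ?L' = filter ?old ?L" using 1 by simp
      have "chain_above n k \<mu> (Bracket r a b # filter ?old ?L) c" "chain_above n k \<mu> (Bracket r b a # filter ?old ?L) c"
        using s(2) s'(2) unfolding e r' o by blast+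
      then have "(\<Sum>t\<leftarrow>[Bracket r a b, Bracket r b a]. tree_sum \<phi> ([] @ t # filter ?old ?L) c) = 0"
        by (intro tree_sum_rel[OF \<phi> lie_rel.antisym]) (simp only: append_Nil set_simps, blast)
      then have "tree_sum \<phi> (Bracket r b a # filter ?old ?L) c = - tree_sum \<phi> (Bracket r a b # filter ?old ?L) c"
        by (simp add: eq_neg_iff_add_eq_0 add.commute)
      then show ?thesis unfolding s(4) s'(4) using e r' o 1 by simp
    next
      case 2
      then have "x' = x" "y' = y" "filter ?old ?L' = filter ?old ?L" using s(1) s'(1) by auto
      then show ?thesis unfolding s(4) s'(4) using 2 r' inversions_swap by simp
    next
      case 3
      then have "x' = x" "y' = y" "filter ?old ?L' = filter ?old ?L" using s(1) s'(1) by auto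
      then show ?thesis unfolding s(4) s'(4) using 3 r' inversions_swap by simp
    next
      case 4
      then have e: "x' = x" "y' = y" using s(1) s'(1) by auto
      have "tree_sum \<phi> ((Bracket r x y # ?R1) @ b # a # ?R2) c = - tree_sum \<phi> ((Bracket r x y # ?R1) @ a # b # ?R2) c"
        using s(2) 4 by (intro Cons.IH) simp
      then show ?thesis unfolding s(4) s'(4) using 4 e r' by simp
    qed
  qed
  then show ?thesis unfolding alternating_def by blast
qed

lemma inversions_pair: "inversions (map (\<lambda>_. False) as @ True # True # map (\<lambda>_. False) bs) = 2 * length as"
proof -
  have "count_list (map (\<lambda>_. False) bs) True = 0" by (induction bs) auto
  moreover have "inversions (map (\<lambda>_. False) bs) = 0" by (induction bs) (auto simp: count_list_0_iff)
  moreover have "count_list (map (\<lambda>_. False) as) True = 0" for as :: "'a list" by (induction as) auto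
  ultimately show ?thesis by (induction as) auto
qed

text \<open>The two halves are adjacent, so moving them to the front takes
  \<open>2 * length L1\<close> exchanges and costs no sign. The sign arises when the bracket moves
  from the front back to its position.\<close>

lemma tree_sum_splitting:
  assumes \<phi>: "tree_function n k \<mu> \<phi>"
  shows "splitting n k \<mu> (tree_sum \<phi>)"
proof -
  have "tree_sum \<phi> (L1 @ x # y # L2) (part (L1 @ Bracket r x y # L2) # c) =
      sg (length L1) (tree_sum \<phi> (L1 @ Bracket r x y # L2) c)"
    if c: "chain_above n k \<mu> (L1 @ Bracket r x y # L2) c" for L1 r x y L2 c
  proof -
    define Q where "Q = part (L1 @ Bracket r x y # L2)"
    let ?new = "\<lambda>t. wblock t \<notin> Q" and ?old = "\<lambda>t. wblock t \<in> Q"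
    let ?L = "L1 @ x # y # L2"
    have c0: "chain_above n k \<mu> ?L (Q # c)"
      using chain_above_split[OF c] by (simp add: Q_def del: part_simps)
    then have f0: "forest n k (x # y # L1 @ L2)"
      using forest_cong_mset[of "x # y # L1 @ L2" ?L] by (simp add: chain_above_def)
    have d: "wblock x \<noteq> wblock y" using forest_distinct_wblock[OF f0] by simp
    have "Q = part (Bracket r x y # L1 @ L2)" by (auto simp: Q_def)
    then have Qm: "Q = merge (part (x # y # L1 @ L2)) r (wblock x) (wblock y)"
      using part_merge[OF f0] by simp
    have n: "?new x" "?new y"
      using merge_diff(1)[OF disjoint_blocks_part[OF f0] _ _ d, of r] Qm by auto
    have o: "?old t" if "t \<in> set (L1 @ L2)" for t
      using that by (auto simp: Q_def part_def)
    obtain x' y' r' where s: "filter ?new ?L = [x', y']" "chain_above n k \<mu> (Bracket r' x' y' # filter ?old ?L) c"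
      "Q = part (Bracket r' x' y' # filter ?old ?L)"
      "tree_sum \<phi> ?L (Q # c) = sg (inversions (map ?new ?L)) (tree_sum \<phi> (Bracket r' x' y' # filter ?old ?L) c)"
      using tree_sum_step[OF c0] by metis
    have fo: "filter ?old ?L = L1 @ L2" using n o by simp
    have fn: "filter ?new ?L = [x, y]" using n o by (simp add: filter_empty_conv)
    have e: "x' = x" "y' = y" using s(1) fn by auto
    have "r' = r" using s(3) \<open>Q = part (Bracket r x y # L1 @ L2)\<close> part_Bracket_inject[OF f0] unfolding fo e by blast
    have "map ?new L1 = map (\<lambda>_. False) L1" "map ?new L2 = map (\<lambda>_. False) L2" using o by simp_all
    then have "map ?new ?L = map (\<lambda>_. False) L1 @ True # True # map (\<lambda>_. False) L2"
      using n by simp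
    then have "inversions (map ?new ?L) = 2 * length L1"
      by (simp only: inversions_pair)
    then have "tree_sum \<phi> ?L (Q # c) = tree_sum \<phi> (Bracket r x y # L1 @ L2) c"
      unfolding s(4) fo e \<open>r' = r\<close> by (simp add: sg_def)
    also have "\<dots> = sg (length L1) (tree_sum \<phi> (L1 @ Bracket r x y # L2) c)"
      using alternating_front[OF tree_sum_alternating[OF \<phi>] c] by simp
    finally show ?thesis by (simp add: Q_def)
  qed
  then show ?thesis unfolding splitting_def by blast
qed

section \<open>From trees to chains\<close>

definition perm_parity :: "(nat \<Rightarrow> nat) \<Rightarrow> nat" where
  "perm_parity p = (if sign p = 1 then 0 else 1)"

lemma sg_perm_parity: "sg (perm_parity p) x = (if sign p = 1 then x else - x)"
  by (simp add: perm_parity_def)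

lemma perm_parity_id [simp]: "perm_parity id = 0"
  by (simp add: perm_parity_def)

lemma perm_parity_comp:
  assumes "permutation p" "permutation q"
  shows "sg (perm_parity (p \<circ> q)) x = sg (perm_parity p) (sg (perm_parity q) x)"
  using sign_compose[OF assms] by (auto simp: sg_perm_parity sign_def split: if_splits)

text \<open>One-line notation: positions are counted from 1, hence the \<open>i - 1\<close>, and all
  other numbers are fixed, so that the result is a permutation with a sign.\<close>

definition word_perm :: "nat list \<Rightarrow> nat \<Rightarrow> nat" where
  "word_perm w i = (if i \<in> {1..length w} then w ! (i - 1) else i)"

lemma length_word: "distinct w \<Longrightarrow> set w = {1..n} \<Longrightarrow> length w = n"
  using distinct_card[of w] by simp

lemma word_perm_permutes:
  assumes "distinct w" "set w = {1..n}"
  shows "word_perm w permutes {1..n}"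
proof (rule bij_imp_permutes)
  have n: "length w = n" using length_word[OF assms] .
  have "bij_betw ((!) w) {..<n} {1..n}"
    using bij_betw_nth[OF assms(1), of "{..<n}" "{1..n}"] n assms(2) by simp
  moreover have "bij_betw (\<lambda>i. i - 1) {1..n} {..<n}"
    by (rule bij_betwI[where g = Suc]) auto
  ultimately have "bij_betw ((!) w \<circ> (\<lambda>i. i - 1)) {1..n} {1..n}"
    using bij_betw_trans by blast
  then show "bij_betw (word_perm w) {1..n} {1..n}"
    by (rule bij_betw_cong[THEN iffD1, rotated]) (simp add: word_perm_def n)
  show "word_perm w i = i" if "i \<notin> {1..n}" for i
    using that n by (auto simp: word_perm_def)
qed

lemma word_perm_permutation:
  assumes "distinct w" "set w = {1..n}"
  shows "permutation (word_perm w)"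
  using word_perm_permutes[OF assms] by (rule permutes_imp_permutation[rotated]) simp

text \<open>Exchanging entries acts on positions and hence multiplies from the right, whereas
  renaming letters, in \<open>word_perm_map\<close>, multiplies from the left.\<close>

lemma word_perm_swap:
  "word_perm (v @ b # a # w) = word_perm (v @ a # b # w) \<circ> transpose (Suc (length v)) (Suc (Suc (length v)))"
proof
  fix i
  consider "i = Suc (length v)" | "i = Suc (Suc (length v))" | "i \<noteq> Suc (length v)" "i \<noteq> Suc (Suc (length v))" by blast
  then show "word_perm (v @ b # a # w) i =
      (word_perm (v @ a # b # w) \<circ> transpose (Suc (length v)) (Suc (Suc (length v)))) i"
  proof cases
    case 3
    then have "i - 1 < length v \<or> (\<exists>m. i - 1 = length v + Suc (Suc m)) \<or> i = 0"
      by presburger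
    then show ?thesis using 3 by (auto simp: word_perm_def nth_append transpose_def)
  qed (auto simp: word_perm_def nth_append)
qed

lemma sg_word_swap:
  assumes "distinct (v @ a # b # w)" "set (v @ a # b # w) = {1..n}"
  shows "sg (perm_parity (word_perm (v @ b # a # w))) x = - sg (perm_parity (word_perm (v @ a # b # w))) x"
proof -
  have "perm_parity (transpose (Suc (length v)) (Suc (Suc (length v)))) = 1"
    by (simp add: perm_parity_def sign_swap_id)
  then show ?thesis
    unfolding word_perm_swap[of v b a w] perm_parity_comp[OF word_perm_permutation[OF assms] permutation_swap_id]
    by simp
qed

lemma sg_word_swaps:
  assumes "swaps m v w" "distinct v" "set v = {1..n}"
  shows "sg (perm_parity (word_perm v)) x = sg m (sg (perm_parity (word_perm w)) x)"
  using assms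
proof (induction rule: swaps.induct)
  case (swaps_step m v a b u w)
  then show ?case
    using sg_word_swap[of v a b u n x] by (auto simp: insert_commute)
qed simp

lemma word_perm_upt: "word_perm [1..<Suc n] = id"
  by (rule ext) (auto simp: word_perm_def simp del: upt_Suc)

lemma word_perm_map:
  assumes "\<tau> permutes {1..n}" "length w = n"
  shows "word_perm (map \<tau> w) = \<tau> \<circ> word_perm w"
  using assms permutes_not_in[OF assms(1)] by (auto simp: word_perm_def fun_eq_iff)

text \<open>
  The leaves already met are collected in \<open>w\<close>; the sign of the word \<open>w\<close> at the end is what makes the
  result alternating in the trees of the forest.
\<close>

function chain_sum :: "(wpartition list \<Rightarrow> 'v::ab_group_add) \<Rightarrow> nat list \<Rightarrow> nat bracketing list \<Rightarrow> wpartition list \<Rightarrow> 'v" where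
  "chain_sum \<psi> w [] c = sg (perm_parity (word_perm w)) (\<psi> c)"
| "chain_sum \<psi> w (Letter a # L) c = chain_sum \<psi> (w @ [a]) L c"
| "chain_sum \<psi> w (Bracket r x y # L) c =
    sg (length w) (chain_sum \<psi> w (x # y # L) (part (map Letter w @ Bracket r x y # L) # c))"
  by pat_completeness auto
termination
  \<comment> \<open>A bracket has size at least one more than its halves together; by the factor 2
    this outweighs the additional summand 1 of the second half. For a leaf the summand 1 makes its
    removal count.\<close>
  by (relation "measure (\<lambda>(\<psi>, w, L, c). sum_list (map (\<lambda>t. 2 * size t + 1) L))") auto

lemma chain_sum_letters: "chain_sum \<psi> w (map Letter v) c = sg (perm_parity (word_perm (w @ v))) (\<psi> c)"
  by (induction v arbitrary: w) auto

text \<open>Vanishing on the gap sums at every place of a maximal chain means that \<psi> factors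
  through the top cohomology. No signs occur because the coboundary gives all fillings of one gap
  the same sign.\<close>

definition chain_function :: "nat \<Rightarrow> nat \<Rightarrow> (nat \<Rightarrow>\<^sub>0 nat) \<Rightarrow> (wpartition list \<Rightarrow> 'v::ab_group_add) \<Rightarrow> bool" where
  "chain_function n k \<mu> \<psi> \<longleftrightarrow> (\<forall>pre P P' c. path n k (wp_bot n) pre P \<longrightarrow> path n k P' c (wp_top n \<mu>) \<longrightarrow>
     (\<Sum>Q\<in>mid n k P P'. \<psi> (pre @ Q # P' # c)) = 0)"

text \<open>The lower part \<open>pre\<close> of the chain and the sign are determined by the
  forest, whatever \<psi> and the rest \<open>d\<close> are. So \<open>chain_sum\<close> is, up to
  sign, one value of \<psi>, and gap sums above the forest become gap sums in chains from the
  bottom.\<close>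

lemma chain_sum_prefix:
  "forest n k (map Letter w @ L) \<Longrightarrow>
    \<exists>m pre. path n k (wp_bot n) pre (part (map Letter w @ L)) \<and>
      (\<forall>(\<psi> :: _ \<Rightarrow> 'v::ab_group_add) d. chain_sum \<psi> w L d = sg m (\<psi> (pre @ d)))"
proof (induction "sum_list (map (\<lambda>t. 2 * size t + 1) L)" arbitrary: w L rule: less_induct)
  case less
  show ?case
  proof (cases L)
    case Nil
    then have "set w = {1..n}" using less.prems by (simp add: forest_def comp_def)
    then have "part (map Letter w @ L) = wp_bot n"
      unfolding Nil append_Nil2 part_letters wp_bot_def by simp
    then show ?thesis
      unfolding Nil by (intro exI[of _ "perm_parity (word_perm w)"] exI[of _ "[]"]) simp
  next
    case (Cons t L')
    show ?thesis
    proof (cases t)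
      case (Letter a)
      have "forest n k (map Letter (w @ [a]) @ L')" using less.prems Cons Letter by simp
      from less.hyps[OF _ this] show ?thesis using Cons Letter by simp
    next
      case (Bracket r x y)
      let ?P = "part (map Letter w @ Bracket r x y # L')"
      have f: "forest n k (map Letter w @ Bracket r x y # L')" using less.prems Cons Bracket by simp
      have "forest n k (map Letter w @ x # y # L')" using f forest_Bracket by blast
      moreover have "sum_list (map (\<lambda>t. 2 * size t + 1) (x # y # L')) < sum_list (map (\<lambda>t. 2 * size t + 1) L)"
        using Cons Bracket by simp
      ultimately obtain m pre where m: "path n k (wp_bot n) pre (part (map Letter w @ x # y # L'))"
        "\<And>(\<psi> :: _ \<Rightarrow> 'v) d. chain_sum \<psi> w (x # y # L') d = sg m (\<psi> (pre @ d))"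
        using less.hyps by blast
      have "path n k (wp_bot n) (pre @ [?P]) ?P"
        using m(1) wp_cover_part[OF f] unfolding path_append by (simp del: part_simps) blast
      moreover have "chain_sum \<psi> w L d = sg (length w + m) (\<psi> ((pre @ [?P]) @ d))" for \<psi> :: "_ \<Rightarrow> 'v" and d
        unfolding Cons Bracket using m(2) by simp
      ultimately show ?thesis unfolding Cons Bracket by blast
    qed
  qed
qed

lemma chain_sum_mid:
  assumes \<psi>: "chain_function n k \<mu> \<psi>"
    and f: "forest n k (map Letter w @ L)" and c: "path n k P c (wp_top n \<mu>)"
  shows "(\<Sum>Q\<in>mid n k (part (map Letter w @ L)) P. chain_sum \<psi> w L (Q # P # c)) = 0"
proof -
  obtain m pre where m: "path n k (wp_bot n) pre (part (map Letter w @ L))"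
    "\<And>d. chain_sum \<psi> w L d = sg m (\<psi> (pre @ d))"
    using chain_sum_prefix[OF f] by blast
  have "(\<Sum>Q\<in>mid n k (part (map Letter w @ L)) P. \<psi> (pre @ Q # P # c)) = 0"
    using \<psi> m(1) c unfolding chain_function_def by blast
  then show ?thesis unfolding m(2) sg_sum[symmetric] by simp
qed

lemma chain_sum_cong:
  assumes "chain_above n k \<mu> L c" and eq: "\<And>c. path n k (wp_bot n) c (wp_top n \<mu>) \<Longrightarrow> \<psi> c = \<psi>' c"
  shows "chain_sum \<psi> [] L c = chain_sum \<psi>' [] L c"
proof -
  have L: "forest n k (map Letter [] @ L)" and c: "path n k (part L) c (wp_top n \<mu>)"
    using assms(1) by (simp_all add: chain_above_def)
  obtain m pre where m: "path n k (wp_bot n) pre (part (map Letter [] @ L))"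
    "\<And>\<psi> d. chain_sum \<psi> [] L d = sg m (\<psi> (pre @ d) :: 'a)"
    using chain_sum_prefix[OF L] by blast
  have "path n k (wp_bot n) (pre @ c) (wp_top n \<mu>)"
    using m(1) c unfolding path_append by auto
  then show ?thesis unfolding m(2) using eq by simp
qed

lemma chain_sum_respects_mid:
  assumes "chain_function n k \<mu> \<psi>"
  shows "respects_mid n k \<mu> (chain_sum \<psi> [])"
  using chain_sum_mid[OF assms, of "[]"] by (simp add: respects_mid_def)

text \<open>\<open>chain_sum\<close> always splits the leftmost bracket first; here any other
  bracket may be split before it. If a bracket precedes the one to be split, the two orders are the
  two fillings of a gap of disjoint merges, whose values are opposite.\<close>

lemma chain_sum_split:
  assumes \<psi>: "chain_function n k \<mu> \<psi>"
  shows "chain_above n k \<mu> (map Letter w @ M @ Bracket r x y # L) c \<Longrightarrow>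
    chain_sum \<psi> w (M @ x # y # L) (part (map Letter w @ M @ Bracket r x y # L) # c) =
      sg (length w + length M) (chain_sum \<psi> w (M @ Bracket r x y # L) c)"
proof (induction "sum_list (map (\<lambda>t. 2 * size t + 1) M)" arbitrary: w M c rule: less_induct)
  case less
  show ?case
  proof (cases M)
    case Nil
    then show ?thesis by simp
  next
    case (Cons t M')
    show ?thesis
    proof (cases t)
      case (Letter a)
      have "chain_above n k \<mu> (map Letter (w @ [a]) @ M' @ Bracket r x y # L) c"
        using less.prems Cons Letter by simp
      from less.hyps[OF _ this] show ?thesis using Cons Letter by simp
    next
      case (Bracket s u v)
      let ?w = "map Letter w :: nat bracketing list"
      let ?P = "part (?w @ Bracket s u v # M' @ Bracket r x y # L)"
      let ?Q1 = "part (?w @ u # v # M' @ Bracket r x y # L)"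
      let ?Q2 = "part (?w @ Bracket s u v # M' @ x # y # L)"
      \<comment> \<open>In \<open>Z\<close> both brackets are split. Splitting the right one first
        passes through \<open>?Q2\<close>, splitting the left one first passes through
        \<open>?Q1\<close>.\<close>
      define Z where "Z Q = chain_sum \<psi> w (u # v # M' @ x # y # L) (Q # ?P # c)" for Q
      have c0: "chain_above n k \<mu> (?w @ Bracket s u v # M' @ Bracket r x y # L) c"
        using less.prems Cons Bracket by simp
      have c1: "chain_above n k \<mu> (?w @ (u # v # M') @ Bracket r x y # L) (?P # c)"
        using chain_above_split[OF c0] by (simp del: part_simps)
      have lt: "sum_list (map (\<lambda>t. 2 * size t + 1) (u # v # M')) < sum_list (map (\<lambda>t. 2 * size t + 1) M)"
        using Cons Bracket by simp
      have 1: "Z ?Q1 = sg (length w + length M') (chain_sum \<psi> w (u # v # M' @ Bracket r x y # L) (?P # c))"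
        using less.hyps[OF lt c1] by (simp add: Z_def del: part_simps)
      have 2: "chain_sum \<psi> w (M @ x # y # L) (?P # c) = sg (length w) (Z ?Q2)"
        unfolding Cons Bracket Z_def by (simp del: part_simps)
      have 3: "chain_sum \<psi> w (M @ Bracket r x y # L) c =
          sg (length w) (chain_sum \<psi> w (u # v # M' @ Bracket r x y # L) (?P # c))"
        unfolding Cons Bracket by (simp del: part_simps)
      let ?R = "?w @ M' @ L"
      have f0: "forest n k (Bracket s u v # Bracket r x y # ?R)"
        using c0 forest_cong_mset[of "Bracket s u v # Bracket r x y # ?R" "?w @ Bracket s u v # M' @ Bracket r x y # L"]
        by (simp add: chain_above_def add_mset_commute)
      have fz: "forest n k (?w @ u # v # M' @ x # y # L)"
        using c0 forest_Bracket[of n k "?w" s u v "M' @ Bracket r x y # L"]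
          forest_Bracket[of n k "?w @ u # v # M'" r x y L] by (simp add: chain_above_def)
      have parts: "part (?w @ u # v # M' @ x # y # L) = part (u # v # x # y # ?R)"
        "?P = part (Bracket s u v # Bracket r x y # ?R)"
        "?Q2 = part (Bracket s u v # x # y # ?R)" "?Q1 = part (u # v # Bracket r x y # ?R)"
        by auto
      have p: "path n k ?P c (wp_top n \<mu>)" using c0 by (simp add: chain_above_def del: part_simps)
      have "0 = (\<Sum>Q\<in>mid n k (part (?w @ u # v # M' @ x # y # L)) ?P. Z Q)"
        unfolding Z_def using chain_sum_mid[OF \<psi> fz p] by (simp del: part_simps)
      also have "\<dots> = Z ?Q2 + Z ?Q1"
        unfolding parts(1,2) mid_disjoint(1)[OF f0] unfolding parts(3,4)
        using mid_disjoint(2)[OF f0] by (simp del: part_simps)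
      \<comment> \<open>This sign compensates that splitting the left bracket first moves the right
        one to a position higher by one.\<close>
      finally have "Z ?Q2 = - Z ?Q1" by (simp add: eq_neg_iff_add_eq_0)
      moreover have "part (?w @ M @ Bracket r x y # L) = ?P" unfolding Cons Bracket by simp
      ultimately show ?thesis
        using 1 2 3 Cons by (simp del: part_simps) (auto simp: sg_def simp del: part_simps)
    qed
  qed
qed

lemma chain_sum_splitting: "chain_function n k \<mu> \<psi> \<Longrightarrow> splitting n k \<mu> (chain_sum \<psi> [])"
  using chain_sum_split[of n k \<mu> \<psi> "[]"] by (simp add: splitting_def del: part_simps)

lemma chain_above_letters:
  "chain_above n k \<mu> (map Letter w) c \<Longrightarrow> distinct w \<and> set w = {1..n}"
  by (simp add: chain_above_def forest_def comp_def)

lemma chain_sum_alternating: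
  assumes \<psi>: "chain_function n k \<mu> \<psi>"
  shows "alternating n k \<mu> (chain_sum \<psi> [])"
proof (rule splitting_alternating[OF chain_sum_splitting[OF \<psi>]])
  fix v a b w c
  assume "chain_above n k \<mu> (map Letter (v @ a # b # w)) c"
  then have "distinct (v @ a # b # w)" "set (v @ a # b # w) = {1..n}"
    using chain_above_letters by blast+
  then show "chain_sum \<psi> [] (map Letter (v @ b # a # w)) c = - chain_sum \<psi> [] (map Letter (v @ a # b # w)) c"
    unfolding chain_sum_letters append_Nil by (rule sg_word_swap)
qed

section \<open>The two constructions are inverse to each other\<close>

lemma swaps_map: "swaps m xs ys \<Longrightarrow> swaps m (map f xs) (map f ys)"
  by (induction rule: swaps.induct) (auto intro: swaps.intros)

abbreviation leaves :: "nat \<Rightarrow> nat bracketing list" where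
  "leaves n \<equiv> map Letter [1..<Suc n]"

lemma forest_leaves: "forest n k (leaves n)"
proof -
  have "concat (map letters (leaves n)) = [1..<Suc n]"
    by (simp add: comp_def del: upt_Suc)
  then show ?thesis by (auto simp: forest_def simp del: upt_Suc)
qed

lemma part_leaves: "part (leaves n) = wp_bot n"
  by (simp add: wp_bot_part)

lemma alternating_letters:
  assumes alt: "alternating n k \<mu> H" and c: "chain_above n k \<mu> (map Letter w) c"
  shows "H (map Letter w) c = sg (perm_parity (word_perm w)) (H (leaves n) c)"
proof -
  have w: "distinct w" "set w = {1..n}" using chain_above_letters[OF c] by auto
  have "set w = set [1..<Suc n]"
    unfolding w(2) set_upt atLeastLessThanSuc_atLeastAtMost by (rule refl)
  then have "mset w = mset [1..<Suc n]"
    using set_eq_iff_mset_eq_distinct[OF w(1) distinct_upt[of 1 "Suc n"]] by blast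
  then obtain m where m: "swaps m w [1..<Suc n]" using swaps_exists by blast
  show ?thesis
    using alternating_swaps[OF alt swaps_map[OF m] c] sg_word_swaps[OF m w, of "H (leaves n) c"]
    unfolding word_perm_upt by simp
qed

text \<open>\<open>respects_mid\<close> covers the lowest gap above any forest; for a gap inside the
  chain, the part below it is first absorbed into a forest.\<close>

lemma chain_function_tree_sum:
  assumes \<phi>: "tree_function n k \<mu> \<phi>"
  shows "chain_function n k \<mu> (tree_sum \<phi> (leaves n))"
proof -
  let ?H = "tree_sum \<phi>"
  note alt = tree_sum_alternating[OF \<phi>] and split = tree_sum_splitting[OF \<phi>]
  have mid: "respects_mid n k \<mu> ?H"
    using respects_rel_imp_mid[OF alt split tree_sum_respects_rel[OF \<phi>]] .
  have "(\<Sum>Q\<in>mid n k P P'. ?H (leaves n) (pre @ Q # P' # c)) = 0"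
    if pre: "path n k (wp_bot n) pre P" and c: "path n k P' c (wp_top n \<mu>)" for pre P P' c
  proof -
    obtain L' m where L': "forest n k L'" "part L' = P"
      "\<And>d. path n k P d (wp_top n \<mu>) \<Longrightarrow> ?H (leaves n) (pre @ d) = sg m (?H L' d)"
      using alternating_splitting_prefix[OF alt split forest_leaves pre[folded part_leaves]] by metis
    have "(\<Sum>Q\<in>mid n k P P'. ?H (leaves n) (pre @ Q # P' # c)) = (\<Sum>Q\<in>mid n k P P'. sg m (?H L' (Q # P' # c)))"
    proof (rule sum.cong[OF refl])
      fix Q assume "Q \<in> mid n k P P'"
      then have "path n k P (Q # P' # c) (wp_top n \<mu>)" using c by (simp add: mid_def)
      then show "?H (leaves n) (pre @ Q # P' # c) = sg m (?H L' (Q # P' # c))" by (rule L'(3))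
    qed
    also have "\<dots> = sg m (\<Sum>Q\<in>mid n k P P'. ?H L' (Q # P' # c))"
      by (rule sg_sum[symmetric])
    also have "\<dots> = 0"
      using mid[unfolded respects_mid_def, rule_format, OF L'(1) c] unfolding L'(2) by simp
    finally show ?thesis .
  qed
  then show ?thesis unfolding chain_function_def by blast
qed

text \<open>Both sides have the splitting property, so they are compared on leaves, where both are
  the sign of the word times the value on the sorted leaves.\<close>

lemma chain_sum_tree_sum:
  assumes \<phi>: "tree_function n k \<mu> \<phi>" and c: "chain_above n k \<mu> L c"
  shows "chain_sum (tree_sum \<phi> (leaves n)) [] L c = tree_sum \<phi> L c"
proof (rule splitting_unique_letters[OF _ tree_sum_splitting[OF \<phi>] _ c])
  show "splitting n k \<mu> (chain_sum (tree_sum \<phi> (leaves n)) [])"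
    using chain_sum_splitting chain_function_tree_sum \<phi> by blast
  show "chain_sum (tree_sum \<phi> (leaves n)) [] (map Letter w) c = tree_sum \<phi> (map Letter w) c"
    if "chain_above n k \<mu> (map Letter w) c" for w c
    using alternating_letters[OF tree_sum_alternating[OF \<phi>] that] unfolding chain_sum_letters append_Nil by simp
qed

lemma tree_function_chain_sum:
  assumes \<psi>: "chain_function n k \<mu> \<psi>"
  shows "tree_function n k \<mu> (\<lambda>t. chain_sum \<psi> [] [t] [])"
  using respects_mid_imp_rel[OF chain_sum_alternating chain_sum_splitting chain_sum_respects_mid, OF \<psi> \<psi> \<psi>]
  unfolding respects_rel_def tree_function_def by blast

text \<open>\<open>tree_sum\<close> and \<open>chain_sum\<close> agree on single trees by the choice
  of \<open>?\<phi>\<close>, hence everywhere. On the sorted leaves \<open>chain_sum\<close> is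
  \<psi> itself, because the identity word has sign 1.\<close>

lemma tree_sum_chain_sum:
  assumes \<psi>: "chain_function n k \<mu> \<psi>" and c: "path n k (wp_bot n) c (wp_top n \<mu>)"
  shows "tree_sum (\<lambda>t. chain_sum \<psi> [] [t] []) (leaves n) c = \<psi> c"
proof -
  let ?\<phi> = "\<lambda>t. chain_sum \<psi> [] [t] []"
  note \<phi> = tree_function_chain_sum[OF \<psi>]
  have "chain_above n k \<mu> (leaves n) c"
    unfolding chain_above_def part_leaves using forest_leaves c by blast
  then have "tree_sum ?\<phi> (leaves n) c = chain_sum \<psi> [] (leaves n) c"
    by (rule alternating_splitting_unique_tree[OF tree_sum_alternating[OF \<phi>] tree_sum_splitting[OF \<phi>]
        chain_sum_alternating[OF \<psi>] chain_sum_splitting[OF \<psi>], rotated]) simp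
  also have "\<dots> = \<psi> c"
    unfolding chain_sum_letters append_Nil word_perm_upt by simp
  finally show ?thesis .
qed

text \<open>Tree and sign depend on the forest and the chain only, so they serve all \<phi> at
  once.\<close>

lemma tree_sum_single:
  "chain_above n k \<mu> L c \<Longrightarrow>
    \<exists>m t. chain_above n k \<mu> [t] [] \<and> (\<forall>\<phi> :: _ \<Rightarrow> 'v::ab_group_add. tree_sum \<phi> L c = sg m (\<phi> t))"
proof (induction c arbitrary: L)
  case Nil
  then obtain t where "L = [t]" using chain_above_Nil by blast
  then show ?case using Nil by (intro exI[of _ 0] exI[of _ t]) simp
next
  case (Cons Q c)
  obtain x y r where s: "chain_above n k \<mu> (Bracket r x y # filter (\<lambda>t. wblock t \<in> Q) L) c"
    "\<And>\<phi> :: _ \<Rightarrow> 'v. tree_sum \<phi> L (Q # c) = sg (inversions (map (\<lambda>t. wblock t \<notin> Q) L))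
       (tree_sum \<phi> (Bracket r x y # filter (\<lambda>t. wblock t \<in> Q) L) c)"
    using tree_sum_step[OF Cons.prems] by metis
  obtain m t where "chain_above n k \<mu> [t] []"
    "\<And>\<phi> :: _ \<Rightarrow> 'v. tree_sum \<phi> (Bracket r x y # filter (\<lambda>t. wblock t \<in> Q) L) c = sg m (\<phi> t)"
    using Cons.IH[OF s(1)] by blast
  then show ?case
    unfolding s(2) by (intro exI[of _ "inversions (map (\<lambda>t. wblock t \<notin> Q) L) + m"] exI[of _ t]) simp
qed

lemma tree_sum_cong:
  assumes "chain_above n k \<mu> L c" and "\<And>t. chain_above n k \<mu> [t] [] \<Longrightarrow> \<phi> t = \<phi>' t"
  shows "tree_sum \<phi> L c = tree_sum \<phi>' L c"
  using tree_sum_single[OF assms(1)] assms(2) by metis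

section \<open>Equivariance\<close>

lemma letters_map_bracketing [simp]: "letters (map_bracketing f t) = map f (letters t)"
  by (induction t) auto

lemma bracket_types_map_bracketing [simp]: "bracket_types (map_bracketing f t) = bracket_types t"
  by (induction t) auto

lemma content_map_bracketing [simp]: "content (map_bracketing f t) = content t"
  by (induction t) auto

lemma part_map_bracketing: "part (map (map_bracketing \<tau>) L) = wp_act \<tau> (part L)"
  by (simp add: part_def wp_act_def wblock_def image_image)

text \<open>Relabelling commutes with each split, and only the sign of the final word of leaves
  changes: \<open>word_perm_map\<close> multiplies its permutation by \<tau>.\<close>

lemma chain_sum_equivariant:
  assumes \<tau>: "\<tau> permutes {1..n}"
  shows "forest n k (map Letter w @ L) \<Longrightarrow>
    chain_sum \<psi> (map \<tau> w) (map (map_bracketing \<tau>) L) (map (wp_act \<tau>) c) =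
    sg (perm_parity \<tau>) (chain_sum (\<lambda>d. \<psi> (map (wp_act \<tau>) d)) w L c)"
proof (induction "sum_list (map (\<lambda>t. 2 * size t + 1) L)" arbitrary: w L c rule: less_induct)
  case less
  show ?case
  proof (cases L)
    case Nil
    then have w: "distinct w" "set w = {1..n}" using less.prems by (simp_all add: forest_def comp_def)
    have "permutation \<tau>" using \<tau> permutation_permutes by blast
    then show ?thesis
      unfolding Nil using perm_parity_comp[OF _ word_perm_permutation[OF w]]
      by (simp add: word_perm_map[OF \<tau> length_word[OF w]])
  next
    case (Cons t L')
    show ?thesis
    proof (cases t)
      case (Letter a)
      have "forest n k (map Letter (w @ [a]) @ L')" using less.prems Cons Letter by simp
      from less.hyps[OF _ this] show ?thesis using Cons Letter by simp
    next
      case (Bracket r x y)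
      let ?P = "part (map Letter w @ Bracket r x y # L')"
      have f: "forest n k (map Letter w @ x # y # L')"
        using less.prems Cons Bracket forest_Bracket by blast
      have lt: "sum_list (map (\<lambda>t. 2 * size t + 1) (x # y # L')) < sum_list (map (\<lambda>t. 2 * size t + 1) L)"
        using Cons Bracket by simp
      have P: "part (map Letter (map \<tau> w) @ Bracket r (map_bracketing \<tau> x) (map_bracketing \<tau> y) # map (map_bracketing \<tau>) L') =
          wp_act \<tau> ?P"
        unfolding part_map_bracketing[symmetric] by (simp add: comp_def)
      have "chain_sum \<psi> (map \<tau> w) (map (map_bracketing \<tau>) L) (map (wp_act \<tau>) c) =
          sg (length w) (chain_sum \<psi> (map \<tau> w) (map (map_bracketing \<tau>) (x # y # L')) (map (wp_act \<tau>) (?P # c)))"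
        unfolding Cons Bracket using P by (simp del: part_simps map_map)
      also have "\<dots> = sg (length w) (sg (perm_parity \<tau>) (chain_sum (\<lambda>d. \<psi> (map (wp_act \<tau>) d)) w (x # y # L') (?P # c)))"
        using less.hyps[OF lt f, of "?P # c"] by (simp del: part_simps)
      also have "\<dots> = sg (perm_parity \<tau>) (chain_sum (\<lambda>d. \<psi> (map (wp_act \<tau>) d)) w L c)"
        unfolding Cons Bracket by (simp add: sg_commute[of "length w"] del: part_simps)
      finally show ?thesis .
    qed
  qed
qed

section \<open>Naturality\<close>

lemma additive_sg:
  assumes "additive h"
  shows "h (sg m x) = sg m (h x)"
  using additive.minus[OF assms] by (simp add: sg_def)

text \<open>The construction uses only signs and values of \<psi>. With \<psi> valued in cochains
  and \<open>h\<close> a projection, this passes from the actual map to its image modulo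
  coboundaries, where the gap relations are equations.\<close>

lemma additive_chain_sum:
  assumes "additive h"
  shows "h (chain_sum \<psi> w L c) = chain_sum (\<lambda>d. h (\<psi> d)) w L c"
  by (induction \<psi> w L c rule: chain_sum.induct) (simp_all add: additive_sg[OF assms] del: part_simps)

lemma additive_tree_sum:
  assumes "additive h"
  shows "h (tree_sum \<phi> L c) = tree_sum (\<lambda>t. h (\<phi> t)) L c"
  by (induction \<phi> L c rule: tree_sum.induct) (simp_all add: additive_sg[OF assms] tree_sum.simps(2) Let_def del: part_simps)

section \<open>Faces of the order complex\<close>

lemma path_end: "path n k P c E \<Longrightarrow> last (P # c) = E"
  by (induction c arbitrary: P) auto

lemma path_unique: "path n k P c E \<Longrightarrow> path n k P c E' \<Longrightarrow> E = E'"
  using path_end by metis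

lemma finite_weighted_partition: "P \<in> weighted_partitions n k \<Longrightarrow> finite P"
proof -
  assume P: "P \<in> weighted_partitions n k"
  then have "finite (fst ` P)"
    using finite_elements[of "{1..n}" "fst ` P"] by (auto simp: weighted_partitions_def)
  then show "finite P"
    using P finite_imageD by (auto simp: weighted_partitions_def)
qed

text \<open>The number of blocks serves as the rank: two blocks disappear and, by
  \<open>join_neq\<close>, a new one appears. Lengths of chains and gaps are measured by it.\<close>

lemma wp_cover_card:
  assumes "wp_cover n k P Q"
  shows "card P = Suc (card Q)"
proof -
  obtain a b r where ab: "a \<in> P" "b \<in> P" "a \<noteq> b" "Q = merge P r a b"
    using wp_cover_merge[OF assms] by blast
  have P: "disjoint_blocks P" "finite P"
    using assms wp_cover_weighted_partitions(1) disjoint_blocks_weighted_partitions finite_weighted_partition by blast+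
  have "join r a b \<notin> P" using join_neq[OF P(1) ab(1,2,3)] by blast
  then have "finite (P - {a, b})" "join r a b \<notin> P - {a, b}"
    using P by simp_all
  then have "card Q = Suc (card (P - {a, b}))"
    unfolding ab(4) merge_def by simp
  moreover have "card P = Suc (Suc (card (P - {a, b})))"
  proof -
    have "P = insert a (insert b (P - {a, b}))" using ab by blast
    then have "card P = card (insert a (insert b (P - {a, b})))" by (rule arg_cong)
    then show ?thesis using P(2) ab(3) by simp
  qed
  ultimately show ?thesis by simp
qed

lemma finite_mid: 
  assumes "finite P"
  shows "finite (mid n k P P')"
proof (rule finite_subset)
  show "mid n k P P' \<subseteq> (\<lambda>(a, b, r). merge P r a b) ` (P \<times> P \<times> {1..k})"
    using wp_cover_merge unfolding mid_def by fastforce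
qed (use assms in simp)

lemma path_card: "path n k P c E \<Longrightarrow> card P = card E + length c"
  by (induction c arbitrary: P) (auto dest: wp_cover_card)

lemma path_wp_less: "path n k P c E \<Longrightarrow> c \<noteq> [] \<Longrightarrow> wp_less n k P E"
proof (induction c arbitrary: P)
  case (Cons Q c)
  then show ?case
    unfolding wp_less_def by (cases "c = []") (auto intro: tranclp_into_tranclp2)
qed simp

lemma wp_less_path: "wp_less n k P E \<Longrightarrow> \<exists>c. c \<noteq> [] \<and> path n k P c E"
  unfolding wp_less_def
proof (induction rule: tranclp_induct)
  case (base Q)
  then show ?case by (intro exI[of _ "[Q]"]) simp
next
  case (step Q R)
  then obtain c where "path n k P c Q" by blast
  then have "path n k P (c @ [R]) R" using step.hyps by (auto simp: path_append)
  then show ?case by blast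
qed

lemma wp_less_trans: "wp_less n k P Q \<Longrightarrow> wp_less n k Q R \<Longrightarrow> wp_less n k P R"
  unfolding wp_less_def by (rule tranclp_trans)

lemma wp_less_card: "wp_less n k P Q \<Longrightarrow> card Q < card P"
  using wp_less_path path_card by fastforce

lemma wp_less_cover:
  assumes "wp_less n k P Q" "card P = Suc (card Q)"
  shows "wp_cover n k P Q"
proof -
  obtain c where c: "path n k P c Q" using wp_less_path[OF assms(1)] by blast
  then have "length c = 1" using path_card[OF c] assms(2) by simp
  then obtain R where "c = [R]" by (auto simp: length_Suc_conv)
  then show ?thesis using c by auto
qed

lemma path_sorted: "path n k P c E \<Longrightarrow> sorted_wrt (wp_less n k) (P # c)"
proof (induction c arbitrary: P)
  case (Cons Q c)
  then have "sorted_wrt (wp_less n k) (Q # c)" "wp_less n k P Q"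
    using path_wp_less[of n k P "[Q]" Q] by auto
  then show ?case using wp_less_trans by auto
qed simp

lemma sorted_card: "sorted_wrt (wp_less n k) (P # d @ [E]) \<Longrightarrow> card E + length d < card P"
proof (induction d arbitrary: P)
  case (Cons Q d)
  then have "card E + length d < card Q" "wp_less n k P Q" by auto
  then show ?case using wp_less_card by fastforce
qed (simp add: wp_less_card)

text \<open>Every step loses at least one block, and there are as many steps as blocks to lose, so
  each step is a cover.\<close>

lemma sorted_path:
  "sorted_wrt (wp_less n k) (P # d @ [E]) \<Longrightarrow> card P = Suc (card E + length d) \<Longrightarrow> path n k P (d @ [E]) E"
proof (induction d arbitrary: P)
  case Nil
  then show ?case using wp_less_cover by simp
next
  case (Cons Q d)
  then have s: "sorted_wrt (wp_less n k) (Q # d @ [E])" and less: "wp_less n k P Q" by auto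
  have Q: "card Q = Suc (card E + length d)"
    using sorted_card[OF s] wp_less_card[OF less] Cons.prems(2) by simp
  have "wp_cover n k P Q" using wp_less_cover[OF less] Q Cons.prems(2) by simp
  then show ?case using Cons.IH[OF s Q] by simp
qed

text \<open>With one element fewer than in a saturated chain, exactly one step loses two blocks. Its
  ends are \<open>P1\<close> and \<open>P2\<close>; here \<open>P2\<close> is in the list, while
  \<open>P1\<close> is the last element of \<open>pre\<close>, or \<open>P\<close> if
  \<open>pre\<close> is empty.\<close>

lemma sorted_gap:
  "sorted_wrt (wp_less n k) (P # d @ [E]) \<Longrightarrow> card P = Suc (Suc (card E + length d)) \<Longrightarrow>
    \<exists>pre P1 P2 c. d @ [E] = pre @ P2 # c \<and> path n k P pre P1 \<and> path n k P2 c E \<and> card P1 = Suc (Suc (card P2))"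
proof (induction d arbitrary: P)
  case Nil
  then show ?case by (intro exI[of _ "[]"] exI[of _ P] exI[of _ E]) simp
next
  case (Cons Q d)
  then have s: "sorted_wrt (wp_less n k) (Q # d @ [E])" and less: "wp_less n k P Q" by auto
  show ?case
  proof (cases "card P = Suc (card Q)")
    case True
    then have cov: "wp_cover n k P Q" using wp_less_cover[OF less] by simp
    obtain pre P1 P2 c where "d @ [E] = pre @ P2 # c" "path n k Q pre P1" "path n k P2 c E" "card P1 = Suc (Suc (card P2))"
      using Cons.IH[OF s] Cons.prems(2) True by auto
    then show ?thesis using cov by (intro exI[of _ "Q # pre"] exI[of _ P1] exI[of _ P2] exI[of _ c]) simp
  next
    case False
    then have Q: "card Q = Suc (card E + length d)"
      using sorted_card[OF s] wp_less_card[OF less] Cons.prems(2) by simp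
    have "path n k Q (d @ [E]) E" using sorted_path[OF s Q] .
    then show ?thesis
      using Q Cons.prems(2) by (intro exI[of _ "[]"] exI[of _ P] exI[of _ Q] exI[of _ "d @ [E]"]) simp
  qed
qed

section \<open>Existence of maximal chains\<close>

lemma card_wp_bot: "card (wp_bot n) = n"
  using card_part[OF forest_leaves[of n 0]] unfolding part_leaves by simp

lemma card_wp_top: "card (wp_top n \<mu>) = 1"
  by (simp add: wp_top_def)

lemma exists_list_count:
  assumes "\<mu> \<in> wcomp m"
  shows "\<exists>js. length js = m \<and> (\<forall>j. count_list js j = Poly_Mapping.lookup \<mu> j)"
proof -
  define M where "M = Abs_multiset (Poly_Mapping.lookup \<mu>)"
  have c: "count M = Poly_Mapping.lookup \<mu>"
    unfolding M_def by (rule count_Abs_multiset) (use finite_lookup[of \<mu>] in simp)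
  obtain js where js: "mset js = M" using ex_mset by blast
  have "count_list js j = Poly_Mapping.lookup \<mu> j" for j
    using js c by (metis count_mset)
  moreover have "length js = m"
  proof -
    have "set_mset M = Poly_Mapping.keys \<mu>"
      by (auto simp: set_mset_def c in_keys_iff)
    then have "size M = m"
      using assms by (simp add: size_multiset_overloaded_eq c wcomp_def)
    then show ?thesis using js by auto
  qed
  ultimately show ?thesis by blast
qed

text \<open>A left comb on the sorted letters realises any list of bracket types, hence any
  content.\<close>

lemma exists_tree:
  assumes "n \<ge> 1" "\<mu> \<in> wcomp (n - 1)" "Poly_Mapping.keys \<mu> \<subseteq> {1..k}"
  shows "\<exists>t. forest n k [t] \<and> content t = \<mu>"
proof -
  have "\<exists>t. letters t = [1..<Suc (Suc (length js))] \<and> bracket_types t = js" for js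
  proof (induction js)
    case Nil
    show ?case by (intro exI[of _ "Letter 1"]) simp
  next
    case (Cons j js)
    then obtain t where "letters t = [1..<Suc (Suc (length js))]" "bracket_types t = js" by blast
    then show ?case by (intro exI[of _ "Bracket j t (Letter (Suc (Suc (length js))))"]) simp
  qed
  moreover obtain js where js: "length js = n - 1" "\<And>j. count_list js j = Poly_Mapping.lookup \<mu> j"
    using exists_list_count[OF assms(2)] by blast
  ultimately obtain t where t: "letters t = [1..<Suc n]" "bracket_types t = js"
    using assms(1) by (metis Suc_diff_1 less_eq_Suc_le One_nat_def)
  have "content t = \<mu>" by (rule poly_mapping_eqI) (simp add: lookup_content t js)
  moreover have "set js \<subseteq> {1..k}" using keys_content[of t] \<open>content t = \<mu>\<close> t assms(3) by auto
  moreover have "set (letters t) = {1..n}" unfolding t set_upt by auto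
  moreover have "distinct (letters t)" unfolding t by (rule distinct_upt)
  ultimately show ?thesis using t(2) by (auto simp: forest_def simp del: upt_Suc)
qed

lemma chain_above_single:
  "chain_above n k \<mu> [t] [] \<longleftrightarrow> forest n k [t] \<and> content t = \<mu>"
  by (auto simp: chain_above_def forest_def wp_top_def wblock_def)

lemma exists_maximal_chain:
  assumes "n \<ge> 1" "\<mu> \<in> wcomp (n - 1)" "Poly_Mapping.keys \<mu> \<subseteq> {1..k}"
  shows "\<exists>c. path n k (wp_bot n) c (wp_top n \<mu>)"
proof -
  obtain t where "chain_above n k \<mu> [t] []" using exists_tree[OF assms] chain_above_single by blast
  then show ?thesis
    \<comment> \<open>The path below the tree is what is wanted; \<open>int\<close> is an arbitrary
      instance for the values of \<psi>.\<close>
    using chain_sum_prefix[where 'v = int, of n k "[]" "[t]"] by (auto simp: chain_above_def)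
qed

text \<open>Faces omit both ends of the interval, paths contain the upper one. For
  \<open>n = 1\<close> the ends coincide, and the formal face \<open>[]\<close> of degree -2
  corresponds to the empty path.\<close>

definition close_chain :: "nat \<Rightarrow> (nat \<Rightarrow>\<^sub>0 nat) \<Rightarrow> wpartition list \<Rightarrow> wpartition list" where
  "close_chain n \<mu> d = (if n = 1 then [] else d @ [wp_top n \<mu>])"

abbreviation interval_complex :: "nat \<Rightarrow> nat \<Rightarrow> (nat \<Rightarrow>\<^sub>0 nat) \<Rightarrow> wpartition list set" where
  "interval_complex n k \<mu> \<equiv> open_interval_complex (wp_less n k) (wp_bot n) (wp_top n \<mu>)"

lemma wp_bot_neq_top: "n \<ge> 2 \<Longrightarrow> wp_bot n \<noteq> wp_top n \<mu>"
  using card_wp_bot[of n] card_wp_top[of n \<mu>] by auto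

lemma wp_bot_eq_top: "\<mu> \<in> wcomp 0 \<Longrightarrow> wp_bot 1 = wp_top 1 \<mu>"
proof -
  assume "\<mu> \<in> wcomp 0"
  then have "Poly_Mapping.lookup \<mu> j = 0" for j by (auto simp: wcomp_def in_keys_iff)
  then have "\<mu> = 0" by (intro poly_mapping_eqI) simp
  then show ?thesis by (simp add: wp_bot_def wp_top_def)
qed

lemma faces_eq:
  assumes "n \<ge> 2"
  shows "d \<in> faces (interval_complex n k \<mu>) r \<longleftrightarrow> int (length d) = r + 1 \<and>
    sorted_wrt (wp_less n k) d \<and> (\<forall>z\<in>set d. wp_less n k (wp_bot n) z \<and> wp_less n k z (wp_top n \<mu>))"
proof -
  have "interval_complex n k \<mu> \<noteq> {}"
    unfolding open_interval_complex_def using wp_bot_neq_top[OF assms]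
    by (auto intro!: exI[of _ "[]"])
  then show ?thesis
    unfolding faces_def open_interval_complex_def using wp_bot_neq_top[OF assms] by auto
qed

lemma faces_sorted:
  assumes "n \<ge> 2" "wp_less n k (wp_bot n) (wp_top n \<mu>)" "d \<in> faces (interval_complex n k \<mu>) r"
  shows "sorted_wrt (wp_less n k) (wp_bot n # d @ [wp_top n \<mu>])"
  using assms by (auto simp: faces_eq sorted_wrt_append)

lemma wp_bot_less_top:
  assumes "n \<ge> 2" "\<mu> \<in> wcomp (n - 1)" "Poly_Mapping.keys \<mu> \<subseteq> {1..k}"
  shows "wp_less n k (wp_bot n) (wp_top n \<mu>)"
proof -
  obtain c where c: "path n k (wp_bot n) c (wp_top n \<mu>)"
    using exists_maximal_chain[OF _ assms(2,3)] assms(1) by auto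
  moreover have "c \<noteq> []" using c wp_bot_neq_top[OF assms(1), of \<mu>] by auto
  ultimately show ?thesis by (rule path_wp_less)
qed

text \<open>A path from bottom to top has \<open>n - 1\<close> elements; without the top there
  remain \<open>n - 2\<close>, which is a face of dimension \<open>n - 3\<close>. For
  \<open>n = 1\<close> the path is empty and \<open>butlast\<close> leaves it so, which is the
  formal face.\<close>

lemma path_butlast_face:
  assumes "n \<ge> 1" "\<mu> \<in> wcomp (n - 1)" and c: "path n k (wp_bot n) c (wp_top n \<mu>)"
  shows "butlast c \<in> faces (interval_complex n k \<mu>) (int n - 3)" and "close_chain n \<mu> (butlast c) = c"
proof -
  have len: "n = Suc (length c)" using path_card[OF c] by (simp add: card_wp_bot card_wp_top)
  have "butlast c \<in> faces (interval_complex n k \<mu>) (int n - 3) \<and> close_chain n \<mu> (butlast c) = c"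
  proof (cases "n = 1")
    case True
    then show ?thesis
      using len wp_bot_eq_top[of \<mu>] assms(2)
      by (simp add: close_chain_def faces_def open_interval_complex_def)
  next
    case False
    then have ne: "c \<noteq> []" and n2: "n \<ge> 2" using len by (auto simp: Suc_le_eq)
    then have cc: "c = butlast c @ [wp_top n \<mu>]"
      using path_end[OF c] by (metis append_butlast_last_id last_ConsR)
    have "sorted_wrt (wp_less n k) (wp_bot n # butlast c @ [wp_top n \<mu>])"
      using path_sorted[OF c] cc by simp
    moreover have "int (length (butlast c)) = int n - 3 + 1" using len ne by (cases c) simp_all
    ultimately have "butlast c \<in> faces (interval_complex n k \<mu>) (int n - 3)"
      unfolding faces_eq[OF n2] by (auto simp: sorted_wrt_append)
    moreover have "close_chain n \<mu> (butlast c) = c"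
      unfolding close_chain_def using False cc by simp
    ultimately show ?thesis by blast
  qed
  then show "butlast c \<in> faces (interval_complex n k \<mu>) (int n - 3)" "close_chain n \<mu> (butlast c) = c" by auto
qed

lemma face_close_path:
  assumes "n \<ge> 1" and \<mu>: "\<mu> \<in> wcomp (n - 1)" "Poly_Mapping.keys \<mu> \<subseteq> {1..k}"
    and d: "d \<in> faces (interval_complex n k \<mu>) (int n - 3)"
  shows "path n k (wp_bot n) (close_chain n \<mu> d) (wp_top n \<mu>)" and "butlast (close_chain n \<mu> d) = d"
proof -
  have "path n k (wp_bot n) (close_chain n \<mu> d) (wp_top n \<mu>) \<and> butlast (close_chain n \<mu> d) = d"
  proof (cases "n = 1")
    case True
    then show ?thesis
      using d wp_bot_eq_top[of \<mu>] \<mu>(1)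
      by (auto simp: close_chain_def faces_def open_interval_complex_def)
  next
    case False
    then have n2: "n \<ge> 2" using assms(1) by simp
    have len: "n = Suc (Suc (length d))" using d n2 by (simp add: faces_eq[OF n2])
    show ?thesis
      using sorted_path[OF faces_sorted[OF n2 wp_bot_less_top[OF n2 \<mu>] d]] len False
      by (simp add: close_chain_def card_wp_bot card_wp_top)
  qed
  then show "path n k (wp_bot n) (close_chain n \<mu> d) (wp_top n \<mu>)" "butlast (close_chain n \<mu> d) = d" by auto
qed

text \<open>A longer chain would need more ranks than lie between bottom and top; for
  \<open>n = 1\<close> the formal generator in degree -2 is the only face.\<close>

lemma faces_above_empty:
  assumes "n \<ge> 1" "\<mu> \<in> wcomp (n - 1)" "Poly_Mapping.keys \<mu> \<subseteq> {1..k}"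
  shows "faces (interval_complex n k \<mu>) (int n - 3 + 1) = {}"
proof (cases "n = 1")
  case True
  then show ?thesis using wp_bot_eq_top[of \<mu>] assms(2) by (simp add: faces_def open_interval_complex_def)
next
  case False
  then have n2: "n \<ge> 2" using assms(1) by simp
  have False if d: "d \<in> faces (interval_complex n k \<mu>) (int n - 3 + 1)" for d
    using sorted_card[OF faces_sorted[OF n2 wp_bot_less_top[OF n2 assms(2,3)] d]] d
    by (simp add: faces_eq[OF n2] card_wp_bot card_wp_top)
  then show ?thesis by blast
qed

lemma faces_below_empty:
  assumes "n \<ge> 1" "\<mu> \<in> wcomp (n - 1)" "n \<le> 2"
  shows "faces (interval_complex n k \<mu>) (int n - 3 - 1) = {}"
proof (cases "n = 1")
  case True
  then show ?thesis using wp_bot_eq_top[of \<mu>] assms(2) by (simp add: faces_def open_interval_complex_def)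
next
  case False
  then have n2: "n \<ge> 2" using assms(1) by simp
  show ?thesis using faces_eq[OF n2] assms(3) by auto
qed

lemma finite_bounded_poly_mapping:
  "finite {\<beta> :: nat \<Rightarrow>\<^sub>0 nat. Poly_Mapping.keys \<beta> \<subseteq> {1..k} \<and> (\<forall>j. Poly_Mapping.lookup \<beta> j \<le> m)}"
    (is "finite ?S")
proof (rule inj_on_finite)
  show "inj_on Poly_Mapping.lookup ?S" by (auto intro: inj_onI simp: lookup_inject)
  show "Poly_Mapping.lookup ` ?S \<subseteq> {f. \<forall>j. (j \<in> {1..k} \<longrightarrow> f j \<in> {..m}) \<and> (j \<notin> {1..k} \<longrightarrow> f j = 0)}"
    by (auto simp: in_keys_iff subset_iff)
  show "finite {f :: nat \<Rightarrow> nat. \<forall>j. (j \<in> {1..k} \<longrightarrow> f j \<in> {..m}) \<and> (j \<notin> {1..k} \<longrightarrow> f j = 0)}"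
    by (rule finite_set_of_finite_funs) simp_all
qed

text \<open>The weights are supported in \<open>{1..k}\<close> and bounded by \<open>n\<close>.
  Finiteness allows cochains to be written as linear combinations of basis functions.\<close>

lemma finite_weighted_partitions: "finite (weighted_partitions n k)"
proof (rule finite_subset)
  let ?W = "{\<beta> :: nat \<Rightarrow>\<^sub>0 nat. Poly_Mapping.keys \<beta> \<subseteq> {1..k} \<and> (\<forall>j. Poly_Mapping.lookup \<beta> j \<le> n)}"
  show "weighted_partitions n k \<subseteq> Pow (Pow {1..n} \<times> ?W)"
  proof (intro subsetI PowI)
    fix P a assume P: "P \<in> weighted_partitions n k" and a: "a \<in> P"
    obtain B \<beta> where B: "a = (B, \<beta>)" by (cases a)
    have "B \<in> fst ` P" using a B by force
    then have sub: "B \<subseteq> {1..n}" using P unfolding weighted_partitions_def partition_on_def by blast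
    have \<beta>: "\<beta> \<in> wcomp (card B - 1)" "Poly_Mapping.keys \<beta> \<subseteq> {1..k}"
      using P a B unfolding weighted_partitions_def by blast+
    have "card B \<le> n" using card_mono[OF _ sub] by simp
    have "Poly_Mapping.lookup \<beta> j \<le> n" for j
    proof (cases "j \<in> Poly_Mapping.keys \<beta>")
      case True
      then have "Poly_Mapping.lookup \<beta> j \<le> (\<Sum>j\<in>Poly_Mapping.keys \<beta>. Poly_Mapping.lookup \<beta> j)"
        by (intro member_le_sum) simp_all
      then show ?thesis using \<beta>(1) \<open>card B \<le> n\<close> by (simp add: wcomp_def)
    qed (simp add: in_keys_iff)
    then show "a \<in> Pow {1..n} \<times> ?W" using sub \<beta> B by auto
  qed
  show "finite (Pow (Pow {1..n} \<times> ?W))" using finite_bounded_poly_mapping by simp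
qed

lemma finite_faces:
  assumes "n \<ge> 1"  "\<mu> \<in> wcomp (n - 1)"
  shows "finite (faces (interval_complex n k \<mu>) r)"
proof (cases "n = 1")
  case True
  then show ?thesis using wp_bot_eq_top[of \<mu>] assms(2) by (simp add: faces_def open_interval_complex_def)
next
  case False
  then have n2: "n \<ge> 2" using assms(1) by simp
  show ?thesis
  proof (rule finite_subset)
    have wp: "z \<in> weighted_partitions n k" if "wp_less n k (wp_bot n) z" for z
      using that unfolding wp_less_def by (induction rule: tranclp_induct) (auto dest: wp_cover_weighted_partitions)
    show "faces (interval_complex n k \<mu>) r \<subseteq> {d. set d \<subseteq> weighted_partitions n k \<and> length d = nat (r + 1)}"
      using wp by (auto simp: faces_eq[OF n2])
    show "finite {d. set d \<subseteq> weighted_partitions n k \<and> length d = nat (r + 1)}"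
      using finite_lists_length_eq[OF finite_weighted_partitions] .
  qed
qed

section \<open>The coboundary of a face with one gap\<close>

lemma sum_fun_apply: "(\<Sum>i\<in>A. f i) x = (\<Sum>i\<in>A. f i x :: 'v::comm_monoid_add)"
  by (induction A rule: infinite_finite_induct) auto

text \<open>The coboundary of the basis function of a face collects the faces from which it arises
  by deleting an element, with the sign of the position. If there is a single gap, the deleted
  element must fill it, so its position is always \<open>length pre\<close>.\<close>

lemma coboundary_gap:
  fixes c :: "wpartition list"
  assumes "n \<ge> 2" and \<mu>: "\<mu> \<in> wcomp (n - 1)" "Poly_Mapping.keys \<mu> \<subseteq> {1..k}"
    and pre: "path n k (wp_bot n) pre P" and c: "path n k P' c (wp_top n \<mu>)"
    and gap: "card P = Suc (Suc (card P'))"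
  shows "coboundary (interval_complex n k \<mu>) (int n - 3 - 1) (basis_fun (butlast (pre @ P' # c))) =
    sg (length pre) (\<Sum>Q\<in>mid n k P P'. basis_fun (butlast (pre @ Q # P' # c)) :: wpartition list \<Rightarrow> 'k::field)"
proof
  fix x
  let ?top = "wp_top n \<mu>"
  let ?e = "butlast (pre @ P' # c)"
  let ?f = "\<lambda>Q. butlast (pre @ Q # P' # c)"
  have n1: "n \<ge> 1" using assms(1) by simp
  have e: "?e @ [?top] = pre @ P' # c"
    using path_end[OF c] append_butlast_last_id[of "pre @ P' # c"] by simp
  have P: "finite P" using gap card_ge_0_finite[of P] by simp
  have f: "?f Q = pre @ Q # butlast (P' # c)" for Q by (simp add: butlast_append)
  have inj: "?f Q = ?f Q' \<longleftrightarrow> Q = Q'" for Q Q' unfolding f by simp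
  have sum: "(\<Sum>Q\<in>mid n k P P'. basis_fun (?f Q) x) = (if \<exists>Q\<in>mid n k P P'. x = ?f Q then 1 else (0::'k))"
  proof (cases "\<exists>Q\<in>mid n k P P'. x = ?f Q")
    case True
    then obtain Q where Q: "Q \<in> mid n k P P'" "x = ?f Q" by blast
    have "basis_fun (?f Q') x = (if Q' = Q then 1 else (0::'k))" for Q'
      unfolding Q(2) basis_fun_def inj by auto
    then show ?thesis using Q finite_mid[OF P] by auto
  next
    case False
    then show ?thesis by (auto simp: basis_fun_def intro!: sum.neutral)
  qed
  \<comment> \<open>\<open>x\<close> is a maximal chain, so the rank of each of its elements is
    known from its position; this pins down where an element can be deleted.\<close>
  have deleted: "i = length pre \<and> (\<exists>Q\<in>mid n k P P'. x = ?f Q)"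
    if x: "x \<in> faces (interval_complex n k \<mu>) (int n - 3)" and i: "i < length x"
      and del: "take i x @ drop (Suc i) x = ?e" for i
  proof -
    define Q where "Q = x ! i"
    have xQ: "x = take i x @ Q # drop (Suc i) x" using id_take_nth_drop[OF i] by (simp add: Q_def)
    have "(take i x @ drop (Suc i) x) @ [?top] = pre @ P' # c"
      unfolding del by (rule e)
    then have eq: "take i x @ drop (Suc i) x @ [?top] = pre @ P' # c" by simp
    have p: "path n k (wp_bot n) (x @ [?top]) ?top"
      using face_close_path(1)[OF n1 \<mu> x] assms(1) by (simp add: close_chain_def)
    have split: "x @ [?top] = take i x @ Q # (drop (Suc i) x @ [?top])" using xQ by (metis append.assoc append_Cons)
    obtain M where M: "path n k (wp_bot n) (take i x) M" "wp_cover n k M Q" "path n k Q (drop (Suc i) x @ [?top]) ?top"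
      using p[unfolded split path_append[of n k "wp_bot n" "take i x"] path.simps] by blast
    have li: "length (take i x) = i" using i by simp
    have cM: "n = card M + i" using path_card[OF M(1)] li by (simp add: card_wp_bot)
    have cQ: "card M = Suc (card Q)" using wp_cover_card[OF M(2)] .
    have cP: "n = card P + length pre" using path_card[OF pre] by (simp add: card_wp_bot)
    have "i = length pre"
    proof (rule ccontr)
      assume "i \<noteq> length pre"
      then consider "i < length pre" | "i > length pre" by linarith
      then show False
      proof cases
        case 1
        have "drop i (pre @ P' # c) = drop (Suc i) x @ [?top]" using arg_cong[OF eq, of "drop i"] li by simp
        moreover have "drop i (pre @ P' # c) = pre ! i # drop (Suc i) pre @ P' # c"
          using Cons_nth_drop_Suc[OF 1] 1 by (simp add: )
        ultimately have tail: "drop (Suc i) x @ [?top] = pre ! i # (drop (Suc i) pre @ P' # c)" by simp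
        \<comment> \<open>\<open>Q\<close> is covered by \<open>pre ! i\<close>, but both have the
          same rank, as each is reached from the bottom in \<open>i + 1\<close> steps.\<close>
        have cov: "wp_cover n k Q (pre ! i)" using M(3) unfolding tail by simp
        have "pre = take i pre @ pre ! i # drop (Suc i) pre" using id_take_nth_drop[OF 1] .
        then obtain M' where "path n k (wp_bot n) (take i pre) M'" "wp_cover n k M' (pre ! i)"
          using pre path_append[of n k "wp_bot n" "take i pre" "pre ! i # drop (Suc i) pre" P] by auto
        then have "n = card M' + i" "card M' = Suc (card (pre ! i))"
          using path_card[of n k "wp_bot n" "take i pre" M'] wp_cover_card 1 by (auto simp: card_wp_bot)
        then show False using wp_cover_card[OF cov] cM cQ by simp
      next
        case 2
        have "take i (take i x @ drop (Suc i) x @ [?top]) = take i x" using li by simp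
        then have "take i x = pre @ P' # take (i - Suc (length pre)) c"
          unfolding eq using 2 by (simp add: take_Cons' )
        then obtain M' where M': "path n k (wp_bot n) pre M'" "wp_cover n k M' P'"
          using M(1) path_append[of n k "wp_bot n" pre "P' # take (i - Suc (length pre)) c" M] by auto
        \<comment> \<open>Then \<open>P'\<close> would cover \<open>P\<close>, contrary to the gap
          between them.\<close>
        have "M' = P" using path_unique[OF M'(1) pre] .
        then show False using wp_cover_card[OF M'(2)] gap by simp
      qed
    qed
    then have t: "take i x = pre" "drop (Suc i) x @ [?top] = P' # c"
      using eq li by (metis append_eq_append_conv)+
    have "M = P" using path_unique[of n k "wp_bot n" pre M P] M(1) pre t(1) by simp
    then have "Q \<in> mid n k P P'" using M(2,3) unfolding t mid_def by simp
    moreover have "x = ?f Q"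
    proof -
      have "drop (Suc i) x = butlast (P' # c)" using t(2) by (metis butlast_snoc)
      then show ?thesis unfolding f using xQ t(1) by simp
    qed
    ultimately show ?thesis using \<open>i = length pre\<close> by blast
  qed
  have face: "?f Q \<in> faces (interval_complex n k \<mu>) (int n - 3)" if "Q \<in> mid n k P P'" for Q
  proof -
    have "path n k (wp_bot n) (pre @ Q # P' # c) ?top"
      using that pre c unfolding path_append mid_def by auto
    then show ?thesis using path_butlast_face(1)[OF n1 \<mu>(1)] by blast
  qed
  have "coboundary (interval_complex n k \<mu>) (int n - 3 - 1) (basis_fun ?e) x =
      (if \<exists>Q\<in>mid n k P P'. x = ?f Q then (- 1) ^ length pre else (0::'k))"
  proof (cases "x \<in> faces (interval_complex n k \<mu>) (int n - 3)")
    case False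
    then show ?thesis using face by (auto simp: coboundary_def)
  next
    case True
    have "coboundary (interval_complex n k \<mu>) (int n - 3 - 1) (basis_fun ?e) x =
        (\<Sum>i<length x. (- 1) ^ i * basis_fun ?e (take i x @ drop (Suc i) x))"
      using True by (simp add: coboundary_def)
    also have "\<dots> = (if \<exists>Q\<in>mid n k P P'. x = ?f Q then (- 1) ^ length pre else (0::'k))"
    proof (cases "\<exists>Q\<in>mid n k P P'. x = ?f Q")
      case ex: True
      then obtain Q where Q: "x = ?f Q" by blast
      have l: "length pre < length x" unfolding Q f by simp
      have d: "take (length pre) x @ drop (Suc (length pre)) x = ?e" unfolding Q f by (simp add: butlast_append)
      have "(- 1) ^ i * basis_fun ?e (take i x @ drop (Suc i) x) = (if i = length pre then (- 1) ^ length pre else (0::'k))"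
        if "i < length x" for i
      proof (cases "i = length pre")
        case i: True
        show ?thesis unfolding i d by (simp add: basis_fun_def)
      next
        case False
        then have "take i x @ drop (Suc i) x \<noteq> ?e" using deleted[OF True that] by blast
        then show ?thesis using False by (simp add: basis_fun_def)
      qed
      then show ?thesis using ex l by simp
    next
      case False
      then have "take i x @ drop (Suc i) x \<noteq> ?e" if "i < length x" for i
        using deleted[OF True that] by blast
      then have "basis_fun ?e (take i x @ drop (Suc i) x) = (0::'k)" if "i < length x" for i
        using that by (simp add: basis_fun_def)
      then show ?thesis using False by simp
    qed
    finally show ?thesis .
  qed
  also have "\<dots> = sg (length pre) (\<Sum>Q\<in>mid n k P P'. basis_fun (?f Q) x)"
    unfolding sum by (auto simp: sg_def)
  also have "\<dots> = sg (length pre) (\<Sum>Q\<in>mid n k P P'. basis_fun (?f Q)) x"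
    by (simp add: sg_def sum_fun_apply)
  finally show "coboundary (interval_complex n k \<mu>) (int n - 3 - 1) (basis_fun ?e) x =
    (sg (length pre) (\<Sum>Q\<in>mid n k P P'. basis_fun (?f Q)) x :: 'k)" .
qed

lemma gap_face:
  assumes "n \<ge> 1" and \<mu>: "\<mu> \<in> wcomp (n - 1)"
    and pre: "path n k (wp_bot n) pre P" and c: "path n k P' c (wp_top n \<mu>)"
    and Q: "Q \<in> mid n k P P'"
  shows "butlast (pre @ P' # c) \<in> faces (interval_complex n k \<mu>) (int n - 3 - 1)" "n \<ge> 2"
    "card P = Suc (Suc (card P'))"
proof -
  have p: "path n k (wp_bot n) (pre @ Q # P' # c) (wp_top n \<mu>)"
    using Q pre c unfolding path_append mid_def by auto
  then show n2: "n \<ge> 2" using path_card[OF p] by (simp add: card_wp_bot card_wp_top)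
  have "butlast (pre @ Q # P' # c) \<in> faces (interval_complex n k \<mu>) (int n - 3)"
    using path_butlast_face(1)[OF assms(1,2) p] .
  then show "butlast (pre @ P' # c) \<in> faces (interval_complex n k \<mu>) (int n - 3 - 1)"
    by (auto simp: faces_eq[OF n2] butlast_append sorted_wrt_append split: if_splits)
  show "card P = Suc (Suc (card P'))"
    using Q by (auto simp: mid_def dest!: wp_cover_card)
qed

text \<open>A face of codimension one, closed by the top, has one gap, so
  \<open>coboundary_gap\<close> applies to every generator of the coboundaries.\<close>

lemma face_gap:
  assumes "n \<ge> 1" and \<mu>: "\<mu> \<in> wcomp (n - 1)" "Poly_Mapping.keys \<mu> \<subseteq> {1..k}"
    and e: "e \<in> faces (interval_complex n k \<mu>) (int n - 3 - 1)"
  shows "\<exists>pre P P' c. e = butlast (pre @ P' # c) \<and> path n k (wp_bot n) pre P \<and> path n k P' c (wp_top n \<mu>) \<and>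
    card P = Suc (Suc (card P')) \<and> n \<ge> 2"
proof -
  have n2: "n \<ge> 2" using faces_below_empty[OF assms(1) \<mu>(1)] e by (cases "n \<le> 2") auto
  have "card (wp_bot n) = Suc (Suc (card (wp_top n \<mu>) + length e))"
    using e by (simp add: faces_eq[OF n2] card_wp_bot card_wp_top)
  then obtain pre P P' c where g: "e @ [wp_top n \<mu>] = pre @ P' # c" "path n k (wp_bot n) pre P"
    "path n k P' c (wp_top n \<mu>)" "card P = Suc (Suc (card P'))"
    using sorted_gap[OF faces_sorted[OF n2 wp_bot_less_top[OF n2 \<mu>] e]] by blast
  have "e = butlast (pre @ P' # c)" using g(1) by (metis butlast_snoc)
  then show ?thesis using g n2 by blast
qed

text \<open>Each cover is lifted to a new bracket in a forest, where \<tau> acts by relabelling the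
  letters and visibly preserves brackets.\<close>

lemma wp_act_path:
  assumes \<tau>: "\<tau> permutes {1..n}"
  shows "forest n k L \<Longrightarrow> path n k (part L) c E \<Longrightarrow> path n k (wp_act \<tau> (part L)) (map (wp_act \<tau>) c) (wp_act \<tau> E)"
proof (induction c arbitrary: L)
  case (Cons Q c)
  then have cov: "wp_cover n k (part L) Q" and p: "path n k Q c E" by auto
  obtain x y R r where xy: "mset L = mset (x # y # R)" "r \<in> {1..k}" "Q = part (Bracket r x y # R)"
    "forest n k (Bracket r x y # R)"
    by (rule wp_cover_partE[OF Cons.prems(1) cov])
  let ?m = "map_bracketing \<tau>"
  have "forest n k (map ?m L)" if "forest n k L" for L
  proof -
    have eq: "concat (map letters (map ?m L)) = map \<tau> (concat (map letters L))"
      by (simp add: map_concat comp_def)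
    have "\<tau> ` {1..n} = {1..n}" using \<tau> permutes_image by blast
    moreover have "inj \<tau>" using \<tau> permutes_inj by blast
    ultimately show ?thesis
      using that unfolding forest_def eq by (auto simp: distinct_map intro: inj_on_subset)
  qed
  from this[OF xy(4)] have "wp_cover n k (part (map ?m (x # y # R))) (part (map ?m (Bracket r x y # R)))"
    using wp_cover_part_Cons xy(2) by (simp add: forest_Bracket_Cons)
  then have "wp_cover n k (wp_act \<tau> (part L)) (wp_act \<tau> Q)"
    unfolding part_map_bracketing xy(3) part_cong_mset[OF xy(1)] .
  moreover have "path n k (wp_act \<tau> Q) (map (wp_act \<tau>) c) (wp_act \<tau> E)"
    using Cons.IH[OF xy(4)] p unfolding xy(3) by blast
  ultimately show ?case by simp
qed simp

section \<open>Linear maps between function spaces and subquotients\<close>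

lemma vector_space_pair_fun:
  "vector_space_pair (fscale :: 'k::field \<Rightarrow> ('x \<Rightarrow> 'k) \<Rightarrow> 'x \<Rightarrow> 'k)
    (fscale :: 'k::field \<Rightarrow> ('y \<Rightarrow> 'k) \<Rightarrow> 'y \<Rightarrow> 'k)"
  by unfold_locales

abbreviation flinear :: "(('x \<Rightarrow> 'k::field) \<Rightarrow> 'y \<Rightarrow> 'k) \<Rightarrow> bool" where
  "flinear \<equiv> Vector_Spaces.linear fscale fscale"

lemma flinear_iff:
  "flinear F \<longleftrightarrow> (\<forall>f g. F (f + g) = F f + F g) \<and> (\<forall>c f. F (fscale c f) = fscale c (F f))"
  unfolding module_hom_iff_linear[symmetric] module_hom_iff
  by (simp add: fun_space.module_axioms)

lemma flinearI:
  assumes "\<And>f g. F (f + g) = F f + F g" "\<And>c f. F (fscale c f) = fscale c (F f)"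
  shows "flinear F"
  using assms by (simp add: flinear_iff)

lemma flinear_add: "flinear F \<Longrightarrow> F (f + g) = F f + F g"
  and flinear_scale: "flinear F \<Longrightarrow> F (fscale c f) = fscale c (F f)"
  by (simp_all add: flinear_iff)

lemma flinear_0: "flinear F \<Longrightarrow> F 0 = 0"
  using flinear_add[of F 0 0] by simp

lemma flinear_diff: "flinear F \<Longrightarrow> F (f - g) = F f - F g"
  using flinear_add[of F "f - g" g] by (simp add: eq_diff_eq)

lemma flinear_compose: "flinear F \<Longrightarrow> flinear G \<Longrightarrow> flinear (\<lambda>x. G (F x))"
  by (simp add: flinear_iff)

lemma flinear_fscale: "flinear (fscale c)"
  by (rule flinearI) (simp_all add: fscale_def fun_eq_iff algebra_simps)

lemma additive_flinear: "flinear F \<Longrightarrow> additive F"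
  by (simp add: additive_def flinear_iff)

lemma flinear_sum_list: "flinear F \<Longrightarrow> F (\<Sum>t\<leftarrow>ts. f t) = (\<Sum>t\<leftarrow>ts. F (f t))"
proof (induction ts)
  case (Cons t ts)
  have "F (\<Sum>t\<leftarrow>t # ts. f t) = F (f t) + F (\<Sum>t\<leftarrow>ts. f t)"
    unfolding list.map sum_list.Cons by (rule flinear_add[OF Cons.prems])
  then show ?case unfolding Cons.IH[OF Cons.prems] list.map sum_list.Cons .
qed (simp add: flinear_0[of F])

text \<open>Evaluating a linear combination at \<open>x\<close> isolates the coefficient of
  \<open>basis_fun x\<close>.\<close>

lemma independent_basis_fun: "fun_space.independent (range (basis_fun :: 'x \<Rightarrow> 'x \<Rightarrow> 'k::field))"
proof
  assume "fun_space.dependent (range (basis_fun :: 'x \<Rightarrow> 'x \<Rightarrow> 'k))"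
  then obtain t and u :: "('x \<Rightarrow> 'k) \<Rightarrow> 'k" and v where t: "finite t" "t \<subseteq> range basis_fun" "(\<Sum>v\<in>t. fscale (u v) v) = 0"
    and v: "v \<in> t" "u v \<noteq> 0"
    unfolding fun_space.dependent_explicit by blast
  obtain x where x: "v = basis_fun x" using t v by blast
  have "fscale (u w) w x = (if w = v then u v else 0)" if w: "w \<in> t" for w
  proof -
    obtain y where y: "w = basis_fun y" using w t(2) by blast
    show ?thesis
    proof (cases "y = x")
      case True
      then show ?thesis using x y by (simp add: fscale_def basis_fun_def)
    next
      case False
      then have "w \<noteq> v" using x y by (metis basis_fun_def zero_neq_one)
      then show ?thesis using False y by (simp add: fscale_def basis_fun_def)
    qed
  qed
  then have "(\<Sum>w\<in>t. fscale (u w) w) x = (\<Sum>w\<in>t. if w = v then u v else 0)"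
    unfolding sum_fun_apply by (intro sum.cong) auto
  also have "\<dots> = u v" using t(1) v(1) by simp
  finally show False using t(3) v(2) by simp
qed

lemma inj_basis_fun: "inj (basis_fun :: 'x \<Rightarrow> 'x \<Rightarrow> 'k::field)"
  by (rule injI) (metis basis_fun_def zero_neq_one)

text \<open>The functions \<open>basis_fun x\<close> do not span if there are infinitely many
  \<open>x\<close>; being independent, they extend to a basis, and so do prescribed values to a
  linear map.\<close>

lemma exists_flinear:
  fixes g :: "'x \<Rightarrow> 'y \<Rightarrow> 'k::field"
  shows "\<exists>F. flinear F \<and> (\<forall>x. F (basis_fun x) = g x)"
proof -
  obtain F where F: "flinear F" "\<forall>b\<in>range basis_fun. F b = g (inv basis_fun b)"
    using vector_space_pair.linear_independent_extend[OF vector_space_pair_fun independent_basis_fun, of "\<lambda>b. g (inv basis_fun b)"] by (elim exE conjE)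
  then have "F (basis_fun x) = g x" for x
    by (simp add: inv_f_f[OF inj_basis_fun])
  then show ?thesis using F(1) by blast
qed

text \<open>The map kills a basis of \<open>W\<close> and fixes the vectors that complete it to a
  basis of the whole space. Membership in \<open>W\<close> becomes the equation
  \<open>\<pi> v = 0\<close> in an abelian group, as the constructions require.\<close>

lemma exists_projection:
  fixes W :: "('x \<Rightarrow> 'k::field) set"
  assumes W: "fun_space.subspace W"
  shows "\<exists>\<pi> :: ('x \<Rightarrow> 'k) \<Rightarrow> 'x \<Rightarrow> 'k. flinear \<pi> \<and> (\<forall>v. \<pi> v = 0 \<longleftrightarrow> v \<in> W)"
proof -
  obtain B where B: "B \<subseteq> W" "fun_space.independent B" "W \<subseteq> fun_space.span B"
    using fun_space.maximal_independent_subset by metis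
  obtain C where C: "B \<subseteq> C" "fun_space.independent C" "UNIV \<subseteq> fun_space.span C"
    using fun_space.maximal_independent_subset_extend[of B UNIV] B(2) by auto
  obtain \<pi> where \<pi>: "flinear \<pi>" "\<forall>b\<in>C. \<pi> b = (if b \<in> B then 0 else b)"
    using vector_space_pair.linear_independent_extend[OF vector_space_pair_fun C(2), of "\<lambda>b. if b \<in> B then 0 else b"] by (elim exE conjE)
  have WB: "W = fun_space.span B" using B fun_space.span_minimal[OF B(1) W] by blast
  have zero: "\<pi> v = 0" if "v \<in> fun_space.span B" for v
    using that
  proof (induction rule: fun_space.span_induct_alt)
    case (step c x y)
    then have "\<pi> x = 0" using \<pi>(2) C(1) by (simp add: subset_iff)
    then show ?case unfolding flinear_add[OF \<pi>(1)] flinear_scale[OF \<pi>(1)] step(2) by simp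
  qed (rule flinear_0[OF \<pi>(1)])
  have id: "\<pi> v = v" if "v \<in> fun_space.span (C - B)" for v
    using that
  proof (induction rule: fun_space.span_induct_alt)
    case (step c x y)
    then have "\<pi> x = x" using \<pi>(2) by simp
    then show ?case unfolding flinear_add[OF \<pi>(1)] flinear_scale[OF \<pi>(1)] step(2) by simp
  qed (rule flinear_0[OF \<pi>(1)])
  have "v \<in> W" if "\<pi> v = 0" for v
  proof -
    have "v \<in> fun_space.span (B \<union> (C - B))"
      using C(1,3) by (simp add: Un_absorb1 set_mp)
    then obtain b d where bd: "b \<in> fun_space.span B" "d \<in> fun_space.span (C - B)" "v = b + d"
      unfolding fun_space.span_Un by blast
    have "\<pi> v = d" unfolding bd(3) flinear_add[OF \<pi>(1)] using zero[OF bd(1)] id[OF bd(2)] by simp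
    then have "d = 0" using that by simp
    then show ?thesis using bd(1,3) WB by simp
  qed
  then show ?thesis using \<pi>(1) zero WB by blast
qed

section \<open>Cosets and actions on subquotients\<close>

lemma coset_eq_iff:
  assumes "fun_space.subspace W"
  shows "v +o W = u +o W \<longleftrightarrow> v - u \<in> W"
proof
  assume "v +o W = u +o W"
  moreover have "v \<in> v +o W"
    using fun_space.subspace_0[OF assms] by (auto simp: elt_set_plus_def intro: bexI[of _ 0])
  ultimately obtain w where "w \<in> W" "v = u + w" by (auto simp: elt_set_plus_def)
  then show "v - u \<in> W" by simp
next
  assume d: "v - u \<in> W"
  have "x +o W \<subseteq> y +o W" if "x - y \<in> W" for x y
  proof
    fix z assume "z \<in> x +o W"
    then obtain w where w: "w \<in> W" "z = x + w" by (auto simp: elt_set_plus_def)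
    have "z = y + ((x - y) + w)" using w(2) by simp
    moreover have "(x - y) + w \<in> W" using fun_space.subspace_add[OF assms that w(1)] .
    ultimately show "z \<in> y +o W" unfolding elt_set_plus_def by blast
  qed
  moreover have "u - v \<in> W" using fun_space.subspace_neg[OF assms d] by simp
  ultimately show "v +o W = u +o W" using d by blast
qed

lemma coset_add:
  assumes "fun_space.subspace W"
  shows "(v +o W) + (u +o W) = (v + u) +o W"
proof -
  have "W + W = W"
    using fun_space.subspace_add[OF assms] fun_space.subspace_0[OF assms]
    by (auto simp: set_plus_def) (metis add_0)
  then show ?thesis by (simp add: set_plus_rearrange)
qed

text \<open>\<open>W'\<close> is added because \<open>F\<close> maps \<open>W\<close> into
  \<open>W'\<close> but perhaps not onto it, so that the image alone need not be a full
  coset.\<close>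

lemma coset_image:
  assumes F: "flinear F" and W: "fun_space.subspace W" "fun_space.subspace W'" and sub: "F ` W \<subseteq> W'"
  shows "F ` (v +o W) + W' = F v +o W'"
proof (intro equalityI subsetI)
  fix z assume "z \<in> F ` (v +o W) + W'"
  then obtain w w' where w: "w \<in> W" "w' \<in> W'" "z = F (v + w) + w'"
    by (auto simp: elt_set_plus_def set_plus_def)
  then have "z = F v + (F w + w')" by (simp add: flinear_add[OF F])
  moreover have "F w + w' \<in> W'" using w sub fun_space.subspace_add[OF W(2)] by blast
  ultimately show "z \<in> F v +o W'" by (auto simp: elt_set_plus_def)
next
  fix z assume "z \<in> F v +o W'"
  then obtain w' where w: "w' \<in> W'" "z = F v + w'" by (auto simp: elt_set_plus_def)
  have "v \<in> v +o W"
    using fun_space.subspace_0[OF W(1)] by (auto simp: elt_set_plus_def intro: bexI[of _ 0])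
  then show "z \<in> F ` (v +o W) + W'" using w by (auto simp: set_plus_def)
qed

lemma coset_image_eq:
  assumes F: "flinear F" and eq: "F ` W = W'"
  shows "F ` (v +o W) = F v +o W'"
proof -
  have "v +o W = (+) v ` W" "F v +o F ` W = (+) (F v) ` F ` W" by (auto simp: elt_set_plus_def)
  then show ?thesis unfolding eq[symmetric] by (simp add: image_image flinear_add[OF F])
qed

lemma coset_fscale:
  assumes "fun_space.subspace W"
  shows "fscale c ` (v +o W) + W = fscale c v +o W"
  by (rule coset_image[OF flinear_fscale assms assms]) (auto intro: fun_space.subspace_scale[OF assms])

text \<open>The last condition, together with stability under the inverse permutation, makes
  \<open>a \<tau>\<close> map \<open>W\<close> onto itself and hence cosets to cosets.\<close>

definition stable_action ::
  "nat \<Rightarrow> ('x \<Rightarrow> 'k::field) set \<Rightarrow> ('x \<Rightarrow> 'k) set \<Rightarrow> ((nat \<Rightarrow> nat) \<Rightarrow> ('x \<Rightarrow> 'k) \<Rightarrow> ('x \<Rightarrow> 'k)) \<Rightarrow> bool" where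
  "stable_action n V W a \<longleftrightarrow> fun_space.subspace V \<and> fun_space.subspace W \<and>
     (\<forall>\<tau>. \<tau> permutes {1..n} \<longrightarrow> flinear (a \<tau>) \<and> a \<tau> ` V \<subseteq> V \<and> a \<tau> ` W \<subseteq> W \<and> (\<forall>f. a \<tau> (a (inv \<tau>) f) = f))"

lemma stable_action_image:
  assumes "stable_action n V W a" "\<tau> permutes {1..n}"
  shows "a \<tau> ` W = W"
proof
  show "a \<tau> ` W \<subseteq> W" using assms by (simp add: stable_action_def)
  show "W \<subseteq> a \<tau> ` W"
  proof
    fix w assume "w \<in> W"
    then have "a (inv \<tau>) w \<in> W" using assms permutes_inv[OF assms(2)] unfolding stable_action_def by blast
    moreover have "a \<tau> (a (inv \<tau>) w) = w" using assms by (simp add: stable_action_def)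
    ultimately show "w \<in> a \<tau> ` W" by (metis imageI)
  qed
qed

lemma stable_action_coset:
  assumes "stable_action n V W a" "\<tau> permutes {1..n}"
  shows "a \<tau> ` (v +o W) = a \<tau> v +o W"
  using coset_image_eq[OF _ stable_action_image[OF assms]] assms by (simp add: stable_action_def)

lemma sign_sq: "\<tau> permutes {1..n} \<Longrightarrow> of_int (sign (\<tau> :: nat \<Rightarrow> nat)) * of_int (sign (inv \<tau>)) = (1 :: 'k::field)"
  using sign_inverse[of \<tau>] permutes_imp_permutation[of "{1..n}" \<tau>] by (simp add: sign_def)

lemma stable_action_twist:
  assumes "stable_action n V W a"
  shows "stable_action n V W (\<lambda>\<tau> f. fscale (of_int (sign \<tau>)) (a \<tau> f))"
  unfolding stable_action_def
proof (intro conjI allI impI)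
  show V: "fun_space.subspace V" and W: "fun_space.subspace W"
    using assms by (simp_all add: stable_action_def)
  fix \<tau> :: "nat \<Rightarrow> nat" assume \<tau>: "\<tau> permutes {1..n}"
  have a: "flinear (a \<tau>)" "a \<tau> ` V \<subseteq> V" "a \<tau> ` W \<subseteq> W" "\<And>f. a \<tau> (a (inv \<tau>) f) = f"
    using assms \<tau> by (simp_all add: stable_action_def)
  show "flinear (\<lambda>f. fscale (of_int (sign \<tau>)) (a \<tau> f))"
    using flinear_compose[OF a(1) flinear_fscale] .
  show "(\<lambda>f. fscale (of_int (sign \<tau>)) (a \<tau> f)) ` V \<subseteq> V"
    using a(2) fun_space.subspace_scale[OF V] by blast
  show "(\<lambda>f. fscale (of_int (sign \<tau>)) (a \<tau> f)) ` W \<subseteq> W"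
    using a(3) fun_space.subspace_scale[OF W] by blast
  show "fscale (of_int (sign \<tau>)) (a \<tau> (fscale (of_int (sign (inv \<tau>))) (a (inv \<tau>) f))) = f" for f
    using a(4) sign_sq[OF \<tau>, where 'k = 'b] by (simp add: flinear_scale[OF a(1)])
qed

text \<open>The left side is the image of \<open>V\<close> in the quotient by a \<open>W\<close>
  that may be larger than \<open>V\<close>. This is the form of \<open>Lie\<close>, where
  \<open>V\<close> has content \<mu> while the relations of all contents are factored out.\<close>

lemma subquotient_iso:
  fixes F :: "('x \<Rightarrow> 'k::field) \<Rightarrow> 'y \<Rightarrow> 'k"
  assumes V: "fun_space.subspace V" and W: "fun_space.subspace W" and V': "fun_space.subspace V'"
    and b: "stable_action n V' W' b"
    and a: "\<And>\<tau>. \<tau> permutes {1..n} \<Longrightarrow> flinear (a \<tau>)" "\<And>\<tau>. \<tau> permutes {1..n} \<Longrightarrow> a \<tau> ` W \<subseteq> W"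
    and F: "flinear F" "F ` W \<subseteq> W'" "F ` V \<subseteq> V'"
    and inj: "\<And>v. v \<in> V \<Longrightarrow> F v \<in> W' \<Longrightarrow> v \<in> W"
    and surj: "\<And>v'. v' \<in> V' \<Longrightarrow> \<exists>v\<in>V. F v - v' \<in> W'"
    and eqv: "\<And>\<tau> v. \<tau> permutes {1..n} \<Longrightarrow> v \<in> V \<Longrightarrow> F (a \<tau> v) - b \<tau> (F v) \<in> W'"
  shows "rep_iso n ((subquotient U W a)\<lparr>rep_carrier := (\<lambda>v. v +o W) ` V\<rparr>) (subquotient V' W' b)"
proof -
  have W': "fun_space.subspace W'" using b by (simp add: stable_action_def)
  let ?f = "\<lambda>X. F ` X + W'"
  have f: "?f (v +o W) = F v +o W'" for v
    using coset_image[OF F(1) W W' F(2)] .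
  show ?thesis
    unfolding rep_iso_def
  proof (intro exI[of _ ?f] conjI ballI allI impI)
    show "bij_betw ?f (rep_carrier ((subquotient U W a)\<lparr>rep_carrier := (\<lambda>v. v +o W) ` V\<rparr>))
       (rep_carrier (subquotient V' W' b))"
      unfolding subquotient_def rep.simps
    proof (rule bij_betw_imageI)
      show "inj_on ?f ((\<lambda>v. v +o W) ` V)"
      proof (rule inj_onI)
        fix X Y assume "X \<in> (\<lambda>v. v +o W) ` V" "Y \<in> (\<lambda>v. v +o W) ` V" and eq: "?f X = ?f Y"
        then obtain v u where vu: "v \<in> V" "u \<in> V" "X = v +o W" "Y = u +o W" by blast
        then have "F v +o W' = F u +o W'" using eq f by simp
        then have "F v - F u \<in> W'" using coset_eq_iff[OF W'] by blast
        then have "F (v - u) \<in> W'" by (simp add: flinear_diff[OF F(1)])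
        then have "v - u \<in> W" using inj fun_space.subspace_diff[OF V vu(1,2)] by blast
        then show "X = Y" using vu coset_eq_iff[OF W] by blast
      qed
      show "?f ` (\<lambda>v. v +o W) ` V = (\<lambda>v. v +o W') ` V'"
      proof (intro equalityI subsetI)
        fix Y assume "Y \<in> ?f ` (\<lambda>v. v +o W) ` V"
        then show "Y \<in> (\<lambda>v. v +o W') ` V'" using f F(3) by auto
      next
        fix Y assume "Y \<in> (\<lambda>v. v +o W') ` V'"
        then obtain v' where v': "v' \<in> V'" "Y = v' +o W'" by blast
        obtain v where v: "v \<in> V" "F v - v' \<in> W'" using surj[OF v'(1)] by blast
        then have "Y = ?f (v +o W)" unfolding f v'(2) using coset_eq_iff[OF W', of "F v" v'] by blast
        then show "Y \<in> ?f ` (\<lambda>v. v +o W) ` V" using v(1) by blast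
      qed
    qed
  next
    fix X Y assume "X \<in> rep_carrier ((subquotient U W a)\<lparr>rep_carrier := (\<lambda>v. v +o W) ` V\<rparr>)"
      "Y \<in> rep_carrier ((subquotient U W a)\<lparr>rep_carrier := (\<lambda>v. v +o W) ` V\<rparr>)"
    then obtain v u where "X = v +o W" "Y = u +o W" by auto
    then show "?f (rep_add ((subquotient U W a)\<lparr>rep_carrier := (\<lambda>v. v +o W) ` V\<rparr>) X Y) =
        rep_add (subquotient V' W' b) (?f X) (?f Y)"
      by (simp add: subquotient_def coset_add[OF W] coset_add[OF W'] f flinear_add[OF F(1)])
  next
    fix c X assume "X \<in> rep_carrier ((subquotient U W a)\<lparr>rep_carrier := (\<lambda>v. v +o W) ` V\<rparr>)"
    then obtain v where "X = v +o W" by auto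
    then show "?f (rep_scale ((subquotient U W a)\<lparr>rep_carrier := (\<lambda>v. v +o W) ` V\<rparr>) c X) =
        rep_scale (subquotient V' W' b) c (?f X)"
      by (simp add: subquotient_def coset_fscale[OF W] coset_fscale[OF W'] f flinear_scale[OF F(1)])
  next
    fix \<tau> X assume \<tau>: "\<tau> permutes {1..n}"
      and "X \<in> rep_carrier ((subquotient U W a)\<lparr>rep_carrier := (\<lambda>v. v +o W) ` V\<rparr>)"
    then obtain v where v: "v \<in> V" "X = v +o W" by auto
    have "(\<lambda>x. F (a \<tau> x)) ` (v +o W) + W' = F (a \<tau> v) +o W'"
      using a[OF \<tau>] F(2) by (intro coset_image[OF flinear_compose[OF a(1)[OF \<tau>] F(1)] W W']) blast
    also have "\<dots> = b \<tau> (F v) +o W'" using eqv[OF \<tau> v(1)] coset_eq_iff[OF W'] by blast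
    also have "\<dots> = b \<tau> ` (F v +o W')" using stable_action_coset[OF b \<tau>] by simp
    finally show "?f (rep_act ((subquotient U W a)\<lparr>rep_carrier := (\<lambda>v. v +o W) ` V\<rparr>) \<tau> X) =
        rep_act (subquotient V' W' b) \<tau> (?f X)"
      using v(2) f by (simp add: subquotient_def image_image)
  qed
qed

lemma rep_iso_trans:
  assumes "rep_iso n A B" "rep_iso n B C"
  shows "rep_iso n A C"
proof -
  obtain f where f: "bij_betw f (rep_carrier A) (rep_carrier B)"
    "\<And>x y. x \<in> rep_carrier A \<Longrightarrow> y \<in> rep_carrier A \<Longrightarrow> f (rep_add A x y) = rep_add B (f x) (f y)"
    "\<And>c x. x \<in> rep_carrier A \<Longrightarrow> f (rep_scale A c x) = rep_scale B c (f x)"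
    "\<And>\<tau> x. \<tau> permutes {1..n} \<Longrightarrow> x \<in> rep_carrier A \<Longrightarrow> f (rep_act A \<tau> x) = rep_act B \<tau> (f x)"
    using assms(1) unfolding rep_iso_def by blast
  obtain g where g: "bij_betw g (rep_carrier B) (rep_carrier C)"
    "\<And>x y. x \<in> rep_carrier B \<Longrightarrow> y \<in> rep_carrier B \<Longrightarrow> g (rep_add B x y) = rep_add C (g x) (g y)"
    "\<And>c x. x \<in> rep_carrier B \<Longrightarrow> g (rep_scale B c x) = rep_scale C c (g x)"
    "\<And>\<tau> x. \<tau> permutes {1..n} \<Longrightarrow> x \<in> rep_carrier B \<Longrightarrow> g (rep_act B \<tau> x) = rep_act C \<tau> (g x)"
    using assms(2) unfolding rep_iso_def by blast
  have fB: "f x \<in> rep_carrier B" if "x \<in> rep_carrier A" for x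
    using bij_betwE[OF f(1)] that by blast
  show ?thesis
    unfolding rep_iso_def
    using bij_betw_trans[OF f(1) g(1)] f(2-4) g(2-4) fB by (intro exI[of _ "g \<circ> f"]) simp
qed

section \<open>Tensoring with the sign representation\<close>

text \<open>The isomorphism sends \<open>X\<close> to the class of \<open>X \<otimes> 1\<close>. It
  is onto since scalars can be moved to the left factor, and in the same way the sign acting on the
  right factor becomes the twist on the left.\<close>

lemma tensor_sgn_iso:
  fixes V W :: "('x \<Rightarrow> 'k::field) set"
  assumes st: "stable_action n V W a"
  shows "rep_iso n (subquotient V W (\<lambda>\<tau> f. fscale (of_int (sign \<tau>)) (a \<tau> f)))
    (tensor_rep (subquotient V W a) (sgn_rep :: ('k, 'k) rep))"
proof -
  let ?M = "subquotient V W a"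
  let ?S = "sgn_rep :: ('k, 'k) rep"
  let ?tw = "\<lambda>\<tau> f. fscale (of_int (sign \<tau>)) (a \<tau> f)"
  define C where "C = (\<lambda>v. v +o W) ` V"
  define rel where "rel = tensor_relations ?M ?S"
  define R where "R = fun_space.span rel"
  define A where "A = (\<lambda>(\<tau> :: nat \<Rightarrow> nat) (g :: ('x \<Rightarrow> 'k) set \<times> 'k \<Rightarrow> 'k) (X, c). if X \<in> C then g (a (inv \<tau>) ` X, of_int (sign (inv \<tau>)) * c) else 0)"
  let ?b = "\<lambda>X (c :: 'k). basis_fun (X, c) :: ('x \<Rightarrow> 'k) set \<times> 'k \<Rightarrow> 'k"
  have V: "fun_space.subspace V" and W: "fun_space.subspace W" using st by (simp_all add: stable_action_def)
  have R: "fun_space.subspace R" by (simp add: R_def fun_space.subspace_span)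
  have carr: "rep_carrier ?M = C" by (simp add: subquotient_def C_def)
  have carrS: "rep_carrier ?S = UNIV" by (simp add: sgn_rep_def)
  have act: "(\<lambda>\<tau> f (v, w). if v \<in> rep_carrier ?M \<and> w \<in> rep_carrier ?S
      then f (rep_act ?M (inv \<tau>) v, rep_act ?S (inv \<tau>) w) else 0) = A"
    unfolding A_def by (intro ext) (auto simp: subquotient_def sgn_rep_def C_def split: prod.split)
  have tens: "tensor_rep ?M ?S = subquotient (fun_space.span (basis_fun ` (C \<times> UNIV))) R A"
    unfolding tensor_rep_def act unfolding carr carrS R_def rel_def by (rule refl)
  have C_add: "X + Y \<in> C" if "X \<in> C" "Y \<in> C" for X Y
    using that coset_add[OF W] fun_space.subspace_add[OF V] by (auto simp: C_def)
  have C_scale: "fscale c ` X + W \<in> C" if "X \<in> C" for c X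
    using that coset_fscale[OF W] fun_space.subspace_scale[OF V] by (auto simp: C_def)
  have C_act: "a \<tau> ` X \<in> C" if "X \<in> C" "\<tau> permutes {1..n}" for \<tau> X
    using that stable_action_coset[OF st that(2)] st by (auto simp: C_def stable_action_def image_subset_iff)
  have act_inv: "a \<tau> ` a (inv \<tau>) ` X = X" if "\<tau> permutes {1..n}" for \<tau> X
    using st that by (simp add: stable_action_def image_image)
  have act_inv': "a (inv \<tau>) ` a \<tau> ` X = X" if "\<tau> permutes {1..n}" for \<tau> X
    using act_inv[OF permutes_inv[OF that]] permutes_inv_inv[OF that] by simp
  have ops: "rep_add ?M X Y = X + Y" "rep_scale ?M s X = fscale s ` X + W" "rep_add ?S c d = c + d"
    "rep_scale ?S s c = s * c" for X Y s c d
    by (simp_all add: subquotient_def sgn_rep_def)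
  have rel_cases: "rel =
     {?b (X + Y) c - ?b X c - ?b Y c | X Y c. X \<in> C \<and> Y \<in> C \<and> c \<in> UNIV} \<union>
     {?b X (c + d) - ?b X c - ?b X d | X c d. X \<in> C \<and> c \<in> UNIV \<and> d \<in> UNIV} \<union>
     {?b (fscale s ` X + W) c - fscale s (?b X c) | s X c. X \<in> C \<and> c \<in> UNIV} \<union>
     {?b X (s * c) - fscale s (?b X c) | s X c. X \<in> C \<and> c \<in> UNIV}"
    unfolding rel_def tensor_relations_def carr carrS ops by (rule refl)
  have r1: "?b (X + Y) c - ?b X c - ?b Y c \<in> R" if "X \<in> C" "Y \<in> C" for X Y c
    unfolding R_def rel_cases using that by (intro fun_space.span_base) blast
  have r3: "?b (fscale s ` X + W) c - fscale s (?b X c) \<in> R" if "X \<in> C" for s X c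
    unfolding R_def rel_cases using that by (intro fun_space.span_base) blast
  have r4: "?b X (s * c) - fscale s (?b X c) \<in> R" if "X \<in> C" for s X c
    unfolding R_def rel_cases using that by (intro fun_space.span_base) blast
  \<comment> \<open>Both relations on scalars, applied to \<open>c * 1\<close>, identify
    \<open>X \<otimes> c\<close> with \<open>c X \<otimes> 1\<close>.\<close>
  have move: "?b X c - ?b (fscale c ` X + W) 1 \<in> R" if "X \<in> C" for X c
    using fun_space.subspace_diff[OF R r4[OF that, of c 1] r3[OF that, of c 1]] by simp

  have A_lin: "flinear (A \<tau>)" for \<tau>
    by (rule flinearI) (auto simp: A_def fun_eq_iff fscale_def)
  have A_basis: "A \<tau> (?b X c) = ?b (a \<tau> ` X) (of_int (sign \<tau>) * c)" if \<tau>: "\<tau> permutes {1..n}" and X: "X \<in> C" for \<tau> X c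
  proof (rule ext, clarify)
    fix Y d
    have s: "of_int (sign (inv \<tau>)) * d = c \<longleftrightarrow> d = of_int (sign \<tau>) * c"
    proof -
      have 1: "of_int (sign \<tau>) * (of_int (sign (inv \<tau>)) * x) = x" for x :: 'k
        using sign_sq[OF \<tau>, where 'k = 'k] by (simp only: mult.assoc[symmetric] mult_1)
      have 2: "of_int (sign (inv \<tau>)) * (of_int (sign \<tau>) * x) = x" for x :: 'k
        using 1[of x] by (simp only: mult.left_commute)
      show ?thesis using 1[of d] 2[of c] by auto
    qed
    have Y: "(Y \<in> C \<and> a (inv \<tau>) ` Y = X) \<longleftrightarrow> Y = a \<tau> ` X"
      using act_inv[OF \<tau>] act_inv'[OF \<tau>] C_act[OF X \<tau>] by metis
    have "A \<tau> (?b X c) (Y, d) =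
        (if (Y \<in> C \<and> a (inv \<tau>) ` Y = X) \<and> of_int (sign (inv \<tau>)) * d = c then 1 else 0)"
      by (simp add: A_def basis_fun_def)
    also have "\<dots> = ?b (a \<tau> ` X) (of_int (sign \<tau>) * c) (Y, d)"
      unfolding Y s by (simp add: basis_fun_def)
    finally show "A \<tau> (?b X c) (Y, d) = ?b (a \<tau> ` X) (of_int (sign \<tau>) * c) (Y, d)" .
  qed
  have act_add: "a \<tau> ` (X + Y) = a \<tau> ` X + a \<tau> ` Y" if \<tau>: "\<tau> permutes {1..n}" and XY: "X \<in> C" "Y \<in> C" for \<tau> X Y
  proof -
    have lin: "flinear (a \<tau>)" using st \<tau> by (simp add: stable_action_def)
    obtain v u where vu: "X = v +o W" "Y = u +o W" using XY by (auto simp: C_def)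
    show ?thesis
      unfolding vu coset_add[OF W] stable_action_coset[OF st \<tau>] flinear_add[OF lin] ..
  qed
  have act_scale: "a \<tau> ` (fscale s ` X + W) = fscale s ` a \<tau> ` X + W" if \<tau>: "\<tau> permutes {1..n}" and X: "X \<in> C" for \<tau> X s
  proof -
    have lin: "flinear (a \<tau>)" using st \<tau> by (simp add: stable_action_def)
    obtain v where v: "X = v +o W" using X by (auto simp: C_def)
    show ?thesis
      unfolding v coset_fscale[OF W] stable_action_coset[OF st \<tau>] flinear_scale[OF lin] ..
  qed
  have A_rel: "A \<tau> r \<in> rel" if \<tau>: "\<tau> permutes {1..n}" and r: "r \<in> rel" for \<tau> r
  proof -
    note lin = flinear_diff[OF A_lin] flinear_scale[OF A_lin] A_basis[OF \<tau>] C_add C_scale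
      act_add[OF \<tau>] act_scale[OF \<tau>] distrib_left
    consider X Y c where "X \<in> C" "Y \<in> C" "r = ?b (X + Y) c - ?b X c - ?b Y c"
      | X c d where "X \<in> C" "r = ?b X (c + d) - ?b X c - ?b X d"
      | s X c where "X \<in> C" "r = ?b (fscale s ` X + W) c - fscale s (?b X c)"
      | s X c where "X \<in> C" "r = ?b X (s * c) - fscale s (?b X c)"
      using r unfolding rel_cases by blast
    then show ?thesis
    proof cases
      case 1
      then have "A \<tau> r = ?b (a \<tau> ` X + a \<tau> ` Y) (of_int (sign \<tau>) * c) - ?b (a \<tau> ` X) (of_int (sign \<tau>) * c) - ?b (a \<tau> ` Y) (of_int (sign \<tau>) * c)"
        by (simp add: lin)
      then show ?thesis unfolding rel_cases using C_act[OF _ \<tau>] 1 by blast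
    next
      case 2
      then have "A \<tau> r = ?b (a \<tau> ` X) (of_int (sign \<tau>) * c + of_int (sign \<tau>) * d) - ?b (a \<tau> ` X) (of_int (sign \<tau>) * c) - ?b (a \<tau> ` X) (of_int (sign \<tau>) * d)"
        by (simp add: lin)
      then show ?thesis unfolding rel_cases using C_act[OF _ \<tau>] 2 by blast
    next
      case 3
      then have "A \<tau> r = ?b (fscale s ` a \<tau> ` X + W) (of_int (sign \<tau>) * c) - fscale s (?b (a \<tau> ` X) (of_int (sign \<tau>) * c))"
        by (simp add: lin)
      then show ?thesis unfolding rel_cases using C_act[OF _ \<tau>] 3 by blast
    next
      case 4
      then have "A \<tau> r = ?b (a \<tau> ` X) (s * (of_int (sign \<tau>) * c)) - fscale s (?b (a \<tau> ` X) (of_int (sign \<tau>) * c))"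
        by (simp add: lin mult.left_commute)
      then show ?thesis unfolding rel_cases using C_act[OF _ \<tau>] 4 by blast
    qed
  qed
  have A_R: "A \<tau> ` R \<subseteq> R" if "\<tau> permutes {1..n}" for \<tau>
  proof -
    have "A \<tau> ` R = fun_space.span (A \<tau> ` rel)"
      unfolding R_def using vector_space_pair.linear_span_image[OF vector_space_pair_fun A_lin] by blast
    also have "\<dots> \<subseteq> R" unfolding R_def using A_rel[OF that] by (intro fun_space.span_mono) blast
    finally show ?thesis .
  qed
  \<comment> \<open>\<open>A\<close> is set to 0 outside \<open>C\<close>, so invertibility is
    stated on the span of the pairs from the carriers.\<close>
  have rel_inv: "A \<tau> (A (inv \<tau>) r) = r" if \<tau>: "\<tau> permutes {1..n}" and "r \<in> fun_space.span (basis_fun ` (C \<times> UNIV))" for \<tau> r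
    using that(2)
  proof (induction rule: fun_space.span_induct_alt)
    case base
    show ?case unfolding flinear_0[OF A_lin] ..
  next
    case (step s x y)
    then obtain X c where X: "X \<in> C" "x = ?b X c" by blast
    have "A \<tau> (A (inv \<tau>) x) = ?b (a \<tau> ` a (inv \<tau>) ` X) ((of_int (sign \<tau>) * of_int (sign (inv \<tau>))) * c)"
      unfolding X(2) A_basis[OF permutes_inv[OF \<tau>] X(1)] A_basis[OF \<tau> C_act[OF X(1) permutes_inv[OF \<tau>]]]
      by (simp add: mult.assoc)
    also have "\<dots> = x" unfolding act_inv[OF \<tau>] sign_sq[OF \<tau>] X(2) by simp
    finally have x: "A \<tau> (A (inv \<tau>) x) = x" .
    show ?case unfolding flinear_add[OF A_lin] flinear_scale[OF A_lin] x step(2) ..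
  qed
  have R_sub: "R \<subseteq> fun_space.span (basis_fun ` (C \<times> UNIV))"
  proof -
    have "?b X c \<in> fun_space.span (basis_fun ` (C \<times> UNIV))" if "X \<in> C" for X c
      using that by (intro fun_space.span_base imageI) simp
    then have "rel \<subseteq> fun_space.span (basis_fun ` (C \<times> UNIV))"
      unfolding rel_cases by (auto intro!: fun_space.span_diff fun_space.span_scale C_add C_scale)
    then show ?thesis unfolding R_def by (rule fun_space.span_minimal) (rule fun_space.subspace_span)
  qed
  have A_R_eq: "A \<tau> ` R = R" if \<tau>: "\<tau> permutes {1..n}" for \<tau>
  proof
    show "R \<subseteq> A \<tau> ` R"
    proof
      fix r assume r: "r \<in> R"
      then have "A (inv \<tau>) r \<in> R" using A_R[OF permutes_inv[OF \<tau>]] by blast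
      moreover have "r = A \<tau> (A (inv \<tau>) r)" by (rule rel_inv[OF \<tau> subsetD[OF R_sub r], symmetric])
      ultimately show "r \<in> A \<tau> ` R" by blast
    qed
  qed (rule A_R[OF \<tau>])

  text \<open>A bilinear evaluation with values in a complement of \<open>W\<close> shows that \<open>X \<otimes> 1\<close> determines \<open>X\<close>.\<close>
  obtain \<pi> :: "('x \<Rightarrow> 'k) \<Rightarrow> 'x \<Rightarrow> 'k" where \<pi>: "flinear \<pi>" "\<And>v. \<pi> v = 0 \<longleftrightarrow> v \<in> W"
    using exists_projection[OF W] by blast
  \<comment> \<open>\<pi> is constant on cosets of \<open>W\<close>, so the choice of the
    representative does not matter.\<close>
  define ev where "ev X = \<pi> (SOME v. v \<in> X)" for X
  have ev: "ev (v +o W) = \<pi> v" for v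
  proof -
    have "v \<in> v +o W" using fun_space.subspace_0[OF W] by (auto simp: elt_set_plus_def intro: bexI[of _ 0])
    then have "(SOME u. u \<in> v +o W) \<in> v +o W" by (rule someI[of "\<lambda>u. u \<in> v +o W"])
    then obtain w where "w \<in> W" "(SOME u. u \<in> v +o W) = v + w" by (auto simp: elt_set_plus_def)
    then show ?thesis unfolding ev_def flinear_add[OF \<pi>(1)] using \<pi>(2)[of w] by (simp add: flinear_add[OF \<pi>(1)])
  qed
  obtain \<Phi> where \<Phi>: "flinear \<Phi>" "\<And>p. \<Phi> (basis_fun p) = fscale (snd p) (ev (fst p))"
    using exists_flinear[of "\<lambda>p. fscale (snd p) (ev (fst p))"] by blast
  have ev_add: "ev (X + Y) = ev X + ev Y" if XY: "X \<in> C" "Y \<in> C" for X Y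
  proof -
    obtain v u where vu: "X = v +o W" "Y = u +o W" using XY by (auto simp: C_def)
    show ?thesis unfolding vu coset_add[OF W] ev flinear_add[OF \<pi>(1)] ..
  qed
  have ev_scale: "ev (fscale s ` X + W) = fscale s (ev X)" if X: "X \<in> C" for X s
  proof -
    obtain v where v: "X = v +o W" using X by (auto simp: C_def)
    show ?thesis unfolding v coset_fscale[OF W] ev flinear_scale[OF \<pi>(1)] ..
  qed
  have \<Phi>rel: "\<Phi> r = 0" if r: "r \<in> rel" for r
  proof -
    note lin = flinear_diff[OF \<Phi>(1)] flinear_scale[OF \<Phi>(1)] \<Phi>(2) fst_conv snd_conv
    consider X Y c where "X \<in> C" "Y \<in> C" "r = ?b (X + Y) c - ?b X c - ?b Y c"
      | X c d where "X \<in> C" "r = ?b X (c + d) - ?b X c - ?b X d"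
      | s X c where "X \<in> C" "r = ?b (fscale s ` X + W) c - fscale s (?b X c)"
      | s X c where "X \<in> C" "r = ?b X (s * c) - fscale s (?b X c)"
      using r unfolding rel_cases by blast
    then show ?thesis
    proof cases
      case 1
      show ?thesis unfolding 1(3) lin ev_add[OF 1(1,2)] by (simp add: fscale_def fun_eq_iff algebra_simps)
    next
      case 2
      show ?thesis unfolding 2(2) lin by (simp add: fscale_def fun_eq_iff algebra_simps)
    next
      case 3
      show ?thesis unfolding 3(2) lin ev_scale[OF 3(1)] by (simp add: fscale_def fun_eq_iff algebra_simps)
    next
      case 4
      show ?thesis unfolding 4(2) lin by (simp add: fscale_def fun_eq_iff algebra_simps)
    qed
  qed
  have \<Phi>R: "\<Phi> r = 0" if "r \<in> R" for r
    using that unfolding R_def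
  proof (induction rule: fun_space.span_induct_alt)
    case base
    show ?case by (rule flinear_0[OF \<Phi>(1)])
  next
    case (step s x y)
    have x: "\<Phi> x = 0" using \<Phi>rel step(1) .
    show ?case unfolding flinear_add[OF \<Phi>(1)] flinear_scale[OF \<Phi>(1)] x step(2) by simp
  qed
  have b_inj: "X = Y" if X: "X \<in> C" and Y: "Y \<in> C" and d: "?b X 1 - ?b Y 1 \<in> R" for X Y
  proof -
    obtain v u where vu: "X = v +o W" "Y = u +o W" using X Y by (auto simp: C_def)
    have "\<Phi> (?b X 1) - \<Phi> (?b Y 1) = 0" using \<Phi>R[OF d] unfolding flinear_diff[OF \<Phi>(1)] .
    then have "\<pi> v - \<pi> u = 0" unfolding \<Phi>(2) fst_conv snd_conv vu ev by (simp add: fscale_def)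
    then have "\<pi> (v - u) = 0" unfolding flinear_diff[OF \<pi>(1)] .
    then show ?thesis using \<pi>(2) vu coset_eq_iff[OF W] by blast
  qed
  have b_surj: "\<exists>X\<in>C. g - ?b X 1 \<in> R" if "g \<in> fun_space.span (basis_fun ` (C \<times> UNIV))" for g
    using that
  proof (induction rule: fun_space.span_induct_alt)
    case base
    have C0: "0 +o W \<in> C" unfolding C_def using fun_space.subspace_0[OF V] by (rule imageI)
    \<comment> \<open>The zero coset tensored with 1 is itself a relation, as scaling it by 0
      shows.\<close>
    have "?b (fscale 0 ` (0 +o W) + W) 1 - fscale 0 (?b (0 +o W) 1) \<in> R" using r3[OF C0] .
    then have "?b (0 +o W) 1 \<in> R" unfolding coset_fscale[OF W] by simp
    then have "0 - ?b (0 +o W) 1 \<in> R" using fun_space.subspace_neg[OF R] by simp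
    then show ?case using C0 by blast
  next
    case (step s x y)
    then obtain X c Y where XY: "X \<in> C" "x = ?b X c" "Y \<in> C" "y - ?b Y 1 \<in> R" by blast
    let ?X = "fscale c ` X + W"
    let ?Z = "fscale s ` ?X + W"
    have X': "?X \<in> C" and Z: "?Z \<in> C" using C_scale XY(1) by blast+
    have 1: "fscale s (?b X c - ?b ?X 1) \<in> R" using fun_space.subspace_scale[OF R move[OF XY(1)]] .
    have 2: "?b ?Z 1 - fscale s (?b ?X 1) \<in> R" using r3[OF X'] .
    have 3: "?b (?Z + Y) 1 - ?b ?Z 1 - ?b Y 1 \<in> R" using r1[OF Z XY(3)] .
    have "fscale s x + y - ?b (?Z + Y) 1 = fscale s (?b X c - ?b ?X 1) - (?b ?Z 1 - fscale s (?b ?X 1)) +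
        (y - ?b Y 1) - (?b (?Z + Y) 1 - ?b ?Z 1 - ?b Y 1)"
      unfolding XY(2) fun_space.scale_right_diff_distrib by (simp add: algebra_simps)
    also have "\<dots> \<in> R"
      using fun_space.subspace_diff[OF R fun_space.subspace_add[OF R fun_space.subspace_diff[OF R 1 2] XY(4)] 3] .
    finally show ?case using C_add[OF Z XY(3)] by blast
  qed

  let ?f = "\<lambda>X. ?b X 1 +o R"
  show ?thesis
    unfolding rep_iso_def tens
  proof (intro exI[of _ ?f] conjI ballI allI impI)
    show "bij_betw ?f (rep_carrier (subquotient V W ?tw))
       (rep_carrier (subquotient (fun_space.span (basis_fun ` (C \<times> UNIV))) R A))"
      unfolding subquotient_def rep.simps C_def[symmetric]
    proof (rule bij_betw_imageI)
      show "inj_on ?f C" using b_inj coset_eq_iff[OF R] by (intro inj_onI) blast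
      show "?f ` C = (\<lambda>v. v +o R) ` fun_space.span (basis_fun ` (C \<times> UNIV))"
      proof (intro equalityI subsetI)
        fix Y assume "Y \<in> ?f ` C"
        then show "Y \<in> (\<lambda>v. v +o R) ` fun_space.span (basis_fun ` (C \<times> UNIV))"
          by (auto intro!: imageI fun_space.span_base)
      next
        fix Y assume "Y \<in> (\<lambda>v. v +o R) ` fun_space.span (basis_fun ` (C \<times> UNIV))"
        then obtain g where g: "g \<in> fun_space.span (basis_fun ` (C \<times> UNIV))" "Y = g +o R" by blast
        obtain X where "X \<in> C" "g - ?b X 1 \<in> R" using b_surj[OF g(1)] by blast
        then show "Y \<in> ?f ` C" using g(2) coset_eq_iff[OF R] by blast
      qed
    qed
  next
    fix X Y assume "X \<in> rep_carrier (subquotient V W ?tw)" "Y \<in> rep_carrier (subquotient V W ?tw)"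
    then have XY: "X \<in> C" "Y \<in> C" by (simp_all add: subquotient_def C_def)
    have "?b (X + Y) 1 +o R = (?b X 1 + ?b Y 1) +o R"
      using r1[OF XY, of 1] by (simp add: coset_eq_iff[OF R] diff_diff_eq)
    then show "?f (rep_add (subquotient V W ?tw) X Y) =
        rep_add (subquotient (fun_space.span (basis_fun ` (C \<times> UNIV))) R A) (?f X) (?f Y)"
      by (simp add: subquotient_def coset_add[OF R])
  next
    fix c X assume "X \<in> rep_carrier (subquotient V W ?tw)"
    then have X: "X \<in> C" by (simp add: subquotient_def C_def)
    have "?b (fscale c ` X + W) 1 +o R = fscale c (?b X 1) +o R"
      using r3[OF X] by (simp add: coset_eq_iff[OF R])
    then show "?f (rep_scale (subquotient V W ?tw) c X) =
        rep_scale (subquotient (fun_space.span (basis_fun ` (C \<times> UNIV))) R A) c (?f X)"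
      by (simp add: subquotient_def coset_fscale[OF R])
  next
    fix \<tau> X assume \<tau>: "\<tau> permutes {1..n}" and "X \<in> rep_carrier (subquotient V W ?tw)"
    then have X: "X \<in> C" by (simp add: subquotient_def C_def)
    then obtain v where v: "v \<in> V" "X = v +o W" by (auto simp: C_def)
    have tw: "?tw \<tau> ` X = fscale (of_int (sign \<tau>)) ` a \<tau> ` X + W"
      unfolding v(2) stable_action_coset[OF stable_action_twist[OF st] \<tau>] stable_action_coset[OF st \<tau>] coset_fscale[OF W] ..
    have "A \<tau> ` (?b X 1 +o R) = ?b (a \<tau> ` X) (of_int (sign \<tau>)) +o R"
      using coset_image_eq[OF A_lin A_R_eq[OF \<tau>], of "?b X 1"] A_basis[OF \<tau> X, of 1] by simp
    also have "\<dots> = ?b (?tw \<tau> ` X) 1 +o R"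
      unfolding tw coset_eq_iff[OF R] by (rule move[OF C_act[OF X \<tau>]])
    finally show "?f (rep_act (subquotient V W ?tw) \<tau> X) =
        rep_act (subquotient (fun_space.span (basis_fun ` (C \<times> UNIV))) R A) \<tau> (?f X)"
      by (simp add: subquotient_def)
  qed
qed

section \<open>Linear maps on spans, and permutation actions on basis functions\<close>

lemma flinear_sum: "flinear F \<Longrightarrow> F (\<Sum>i\<in>A. f i) = (\<Sum>i\<in>A. F (f i))"
  by (induction A rule: infinite_finite_induct) (simp_all add: flinear_0[of F] flinear_add[of F])

lemma flinear_sg: "flinear F \<Longrightarrow> F (sg m x) = sg m (F x)"
  by (rule additive_sg[OF additive_flinear])

lemma flinear_eq_on_span:
  assumes F: "flinear F" and G: "flinear G" and eq: "\<And>x. x \<in> S \<Longrightarrow> F x = G x"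
  shows "v \<in> fun_space.span S \<Longrightarrow> F v = G v"
proof (induction rule: fun_space.span_induct_alt)
  case base
  show ?case unfolding flinear_0[OF F] flinear_0[OF G] ..
next
  case (step c x y)
  show ?case
    unfolding flinear_add[OF F] flinear_scale[OF F] flinear_add[OF G] flinear_scale[OF G] eq[OF step(1)] step(2) ..
qed

lemma flinear_zero: "flinear (\<lambda>_. 0)"
  by (rule flinearI) (simp_all add: fscale_def fun_eq_iff)

lemma flinear_span_image:
  assumes "flinear F" "\<And>x. x \<in> S \<Longrightarrow> F x \<in> V" "fun_space.subspace V"
  shows "F ` fun_space.span S \<subseteq> V"
proof -
  have "F ` fun_space.span S = fun_space.span (F ` S)"
    using vector_space_pair.linear_span_image[OF vector_space_pair_fun assms(1)] by (rule sym)
  also have "\<dots> \<subseteq> V" by (rule fun_space.span_minimal) (use assms in auto)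
  finally show ?thesis .
qed

lemma subspace_sg: "fun_space.subspace V \<Longrightarrow> x \<in> V \<Longrightarrow> sg m x \<in> V"
  using fun_space.subspace_neg[of V x] by (simp add: sg_def)

lemma flinear_perm_act: "flinear (perm_act \<rho> \<tau>)"
  by (rule flinearI) (simp_all add: perm_act_def fscale_def fun_eq_iff)

lemma perm_act_basis_fun:
  assumes "\<And>x. \<rho> \<tau> (\<rho> (inv \<tau>) x) = x" "\<And>x. \<rho> (inv \<tau>) (\<rho> \<tau> x) = x"
  shows "perm_act \<rho> \<tau> (basis_fun x) = basis_fun (\<rho> \<tau> x)"
proof
  fix y
  have "\<rho> (inv \<tau>) y = x \<longleftrightarrow> y = \<rho> \<tau> x" using assms by metis
  then show "perm_act \<rho> \<tau> (basis_fun x) y = basis_fun (\<rho> \<tau> x) y"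
    by (simp add: perm_act_def basis_fun_def)
qed

section \<open>Actions on trees and chains\<close>

lemma map_bracketing_inverse:
  assumes "\<tau> permutes {1..n}"
  shows "map_bracketing \<tau> (map_bracketing (inv \<tau>) t) = t" "map_bracketing (inv \<tau>) (map_bracketing \<tau> t) = t"
  unfolding bracketing.map_comp permutes_inv_o[OF assms] bracketing.map_id by (rule refl)+

lemma lie_rel_map: "lie_rel ts \<Longrightarrow> lie_rel (map (map_bracketing f) ts)"
proof (induction rule: lie_rel.induct)
  case (left_context ts j u)
  show ?case using lie_rel.left_context[OF left_context.IH, of j "map_bracketing f u"] by (simp add: comp_def)
next
  case (right_context ts j u)
  show ?case using lie_rel.right_context[OF right_context.IH, of j "map_bracketing f u"] by (simp add: comp_def)
qed (auto intro: lie_rel.intros)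

lemma bracketed_perms_map:
  assumes "\<tau> permutes {1..n}" "t \<in> bracketed_perms n"
  shows "map_bracketing \<tau> t \<in> bracketed_perms n"
proof -
  have "inj \<tau>" using assms(1) permutes_inj by blast
  moreover have "\<tau> ` {1..n} = {1..n}" using assms(1) permutes_image by blast
  ultimately show ?thesis
    using assms(2) unfolding bracketed_perms_def by (auto simp: distinct_map intro: inj_on_subset)
qed

lemma lie_relations_act:
  assumes \<tau>: "\<tau> permutes {1..n}"
  shows "perm_act map_bracketing \<tau> ` lie_relations n \<subseteq> (lie_relations n :: (nat bracketing \<Rightarrow> 'k::field) set)"
  unfolding lie_relations_def
proof (rule flinear_span_image[OF flinear_perm_act _ fun_space.subspace_span])
  let ?gen = "{(\<Sum>t\<leftarrow>ts. basis_fun t) | ts. lie_rel ts \<and> set ts \<subseteq> bracketed_perms n} :: (nat bracketing \<Rightarrow> 'k) set"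
  fix x assume "x \<in> ?gen"
  then obtain ts where ts: "x = (\<Sum>t\<leftarrow>ts. basis_fun t)" "lie_rel ts" "set ts \<subseteq> bracketed_perms n" by blast
  have "perm_act map_bracketing \<tau> x = (\<Sum>t\<leftarrow>ts. perm_act map_bracketing \<tau> (basis_fun t))"
    unfolding ts(1) by (rule flinear_sum_list[OF flinear_perm_act])
  also have "\<dots> = (\<Sum>t\<leftarrow>map (map_bracketing \<tau>) ts. basis_fun t)"
    unfolding perm_act_basis_fun[of map_bracketing \<tau>, OF map_bracketing_inverse[OF \<tau>]] by (simp add: comp_def)
  finally have "perm_act map_bracketing \<tau> x = (\<Sum>t\<leftarrow>map (map_bracketing \<tau>) ts. basis_fun t)" .
  moreover have "lie_rel (map (map_bracketing \<tau>) ts)" using lie_rel_map[OF ts(2)] .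
  moreover have "set (map (map_bracketing \<tau>) ts) \<subseteq> bracketed_perms n"
    using ts(3) bracketed_perms_map[OF \<tau>] by auto
  ultimately have "perm_act map_bracketing \<tau> x \<in> ?gen" by blast
  then show "perm_act map_bracketing \<tau> x \<in> fun_space.span ?gen" by (rule fun_space.span_base)
qed

section \<open>The action on partitions, faces and cochains\<close>

lemma wp_act_inverse:
  assumes "\<tau> permutes {1..n}"
  shows "wp_act \<tau> (wp_act (inv \<tau>) P) = P" "wp_act (inv \<tau>) (wp_act \<tau> P) = P"
proof -
  have "wp_act \<sigma> (wp_act \<rho> P) = P" if "\<sigma> \<circ> \<rho> = id" for \<sigma> \<rho> :: "nat \<Rightarrow> nat"
  proof -
    have "\<sigma> (\<rho> x) = x" for x using that by (metis comp_apply id_apply)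
    then show ?thesis by (simp add: wp_act_def image_image case_prod_beta)
  qed
  then show "wp_act \<tau> (wp_act (inv \<tau>) P) = P" "wp_act (inv \<tau>) (wp_act \<tau> P) = P"
    using permutes_inv_o[OF assms] by blast+
qed

lemma map_wp_act_inverse:
  assumes "\<tau> permutes {1..n}"
  shows "map (wp_act \<tau>) (map (wp_act (inv \<tau>)) d) = d" "map (wp_act (inv \<tau>)) (map (wp_act \<tau>) d) = d"
  using wp_act_inverse[OF assms] by (simp_all add: comp_def)

lemma wp_act_bot_top:
  assumes "\<tau> permutes {1..n}"
  shows "wp_act \<tau> (wp_bot n) = wp_bot n" "wp_act \<tau> (wp_top n \<mu>) = wp_top n \<mu>"
proof -
  have \<tau>: "\<tau> ` {1..n} = {1..n}" using assms permutes_image by blast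
  have "wp_act \<tau> (wp_bot n) = (\<lambda>i. ({i}, 0)) ` \<tau> ` {1..n}"
    unfolding wp_act_def wp_bot_def image_image by (intro image_cong) simp_all
  then show "wp_act \<tau> (wp_bot n) = wp_bot n" unfolding \<tau> by (simp add: wp_bot_def)
  show "wp_act \<tau> (wp_top n \<mu>) = wp_top n \<mu>" using \<tau> by (simp add: wp_act_def wp_top_def)
qed

lemma path_forest: "forest n k L \<Longrightarrow> path n k (part L) c P \<Longrightarrow> \<exists>L'. forest n k L' \<and> part L' = P"
proof (induction c arbitrary: L)
  case (Cons Q c)
  then have cov: "wp_cover n k (part L) Q" and p: "path n k Q c P" by auto
  obtain x y R r where xy: "mset L = mset (x # y # R)" "r \<in> {1..k}" "Q = part (Bracket r x y # R)"
    "forest n k (Bracket r x y # R)"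
    by (rule wp_cover_partE[OF Cons.prems(1) cov])
  show ?case using Cons.IH[OF xy(4)] p unfolding xy(3) by blast
qed auto

text \<open>The condition on \<open>P\<close> makes it the partition of a forest, as
  \<open>wp_act_path\<close> requires.\<close>

lemma wp_less_act:
  assumes \<tau>: "\<tau> permutes {1..n}" and P: "P = wp_bot n \<or> wp_less n k (wp_bot n) P" and less: "wp_less n k P Q"
  shows "wp_less n k (wp_act \<tau> P) (wp_act \<tau> Q)"
proof -
  obtain c0 where "path n k (part (leaves n)) c0 P"
    using P
  proof
    assume "P = wp_bot n"
    then have "path n k (part (leaves n)) [] P" unfolding part_leaves by simp
    then show thesis by (rule that)
  next
    assume "wp_less n k (wp_bot n) P"
    then show thesis using wp_less_path that unfolding part_leaves by blast
  qed
  then obtain L where L: "forest n k L" "part L = P" using path_forest[OF forest_leaves] by blast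
  obtain c where c: "c \<noteq> []" "path n k P c Q" using wp_less_path[OF less] by blast
  have "path n k (wp_act \<tau> P) (map (wp_act \<tau>) c) (wp_act \<tau> Q)"
    using wp_act_path[OF \<tau> L(1)] c(2) unfolding L(2) by blast
  then show ?thesis using path_wp_less c(1) by blast
qed

lemma faces_act:
  assumes \<tau>: "\<tau> permutes {1..n}" and "n \<ge> 1" "\<mu> \<in> wcomp (n - 1)" and d: "d \<in> faces (interval_complex n k \<mu>) r"
  shows "map (wp_act \<tau>) d \<in> faces (interval_complex n k \<mu>) r"
proof (cases "n = 1")
  case True
  then show ?thesis using wp_bot_eq_top[of \<mu>] assms(3) d
    by (simp add: faces_def open_interval_complex_def split: if_splits)
next
  case False
  then have n2: "n \<ge> 2" using assms(2) by simp
  have d': "int (length d) = r + 1" "sorted_wrt (wp_less n k) d"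
    "\<And>z. z \<in> set d \<Longrightarrow> wp_less n k (wp_bot n) z" "\<And>z. z \<in> set d \<Longrightarrow> wp_less n k z (wp_top n \<mu>)"
    using d unfolding faces_eq[OF n2] by auto
  have "sorted_wrt (\<lambda>x y. wp_less n k (wp_act \<tau> x) (wp_act \<tau> y)) d"
    using d'(2) by (rule sorted_wrt_mono_rel[rotated]) (use wp_less_act[OF \<tau>] d'(3) in blast)
  moreover have "wp_less n k (wp_bot n) (wp_act \<tau> z)" "wp_less n k (wp_act \<tau> z) (wp_top n \<mu>)" if "z \<in> set d" for z
    using wp_less_act[OF \<tau> _ d'(3)[OF that]] wp_less_act[OF \<tau> _ d'(4)[OF that]] d'(3)[OF that]
    unfolding wp_act_bot_top[OF \<tau>] by blast+
  ultimately show ?thesis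
    unfolding faces_eq[OF n2] using d'(1) by (simp add: sorted_wrt_map)
qed

lemma subspace_cochains: "fun_space.subspace (cochains \<Delta> r)"
  by (rule fun_space.subspaceI) (auto simp: cochains_def fscale_def)

lemma basis_fun_cochain: "d \<in> faces \<Delta> r \<Longrightarrow> basis_fun d \<in> cochains \<Delta> r"
  by (auto simp: cochains_def basis_fun_def)

lemma cochains_span:
  assumes "finite (faces \<Delta> r)"
  shows "(cochains \<Delta> r :: ('p list \<Rightarrow> 'k::field) set) = fun_space.span (basis_fun ` faces \<Delta> r)"
proof
  show "fun_space.span (basis_fun ` faces \<Delta> r) \<subseteq> cochains \<Delta> r"
    by (rule fun_space.span_minimal) (auto simp: basis_fun_cochain subspace_cochains)
  show "cochains \<Delta> r \<subseteq> (fun_space.span (basis_fun ` faces \<Delta> r) :: ('p list \<Rightarrow> 'k) set)"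
  proof
    fix \<phi> :: "'p list \<Rightarrow> 'k" assume \<phi>: "\<phi> \<in> cochains \<Delta> r"
    have "\<phi> = (\<Sum>d\<in>faces \<Delta> r. fscale (\<phi> d) (basis_fun d))"
    proof
      fix x
      have "(\<Sum>d\<in>faces \<Delta> r. fscale (\<phi> d) (basis_fun d)) x = (\<Sum>d\<in>faces \<Delta> r. if d = x then \<phi> x else 0)"
        unfolding sum_fun_apply by (intro sum.cong) (auto simp: fscale_def basis_fun_def)
      also have "\<dots> = \<phi> x" using \<phi> assms by (auto simp: cochains_def)
      finally show "\<phi> x = (\<Sum>d\<in>faces \<Delta> r. fscale (\<phi> d) (basis_fun d)) x" by simp
    qed
    also have "\<dots> \<in> fun_space.span (basis_fun ` faces \<Delta> r)"
      by (intro fun_space.span_sum fun_space.span_scale fun_space.span_base imageI)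
    finally show "\<phi> \<in> fun_space.span (basis_fun ` faces \<Delta> r)" .
  qed
qed

lemma flinear_coboundary: "flinear (coboundary \<Delta> r)"
  by (rule flinearI)
    (auto simp: coboundary_def fscale_def fun_eq_iff sum.distrib distrib_left sum_distrib_left mult.left_commute)

text \<open>Relabelling permutes the faces of each degree and commutes with deleting the element at
  a given position.\<close>

lemma coboundary_act:
  assumes \<tau>: "\<tau> permutes {1..n}" and n: "n \<ge> 1" "\<mu> \<in> wcomp (n - 1)"
  shows "perm_act (\<lambda>\<tau>. map (wp_act \<tau>)) \<tau> (coboundary (interval_complex n k \<mu>) r \<phi>) =
    coboundary (interval_complex n k \<mu>) r (perm_act (\<lambda>\<tau>. map (wp_act \<tau>)) \<tau> \<phi>)"
proof
  fix c
  have "map (wp_act (inv \<tau>)) c \<in> faces (interval_complex n k \<mu>) (r + 1) \<longleftrightarrow> c \<in> faces (interval_complex n k \<mu>) (r + 1)"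
    using faces_act[OF \<tau> n, of "map (wp_act (inv \<tau>)) c" k "r + 1"] faces_act[OF permutes_inv[OF \<tau>] n, of c k "r + 1"]
    unfolding map_wp_act_inverse[OF \<tau>] by blast
  then show "perm_act (\<lambda>\<tau>. map (wp_act \<tau>)) \<tau> (coboundary (interval_complex n k \<mu>) r \<phi>) c =
    coboundary (interval_complex n k \<mu>) r (perm_act (\<lambda>\<tau>. map (wp_act \<tau>)) \<tau> \<phi>) c"
    by (simp add: perm_act_def coboundary_def take_map drop_map)
qed

lemma cohomology_stable_action:
  assumes n: "n \<ge> 1" "\<mu> \<in> wcomp (n - 1)"
  shows "stable_action n (cochains (interval_complex n k \<mu>) r)
    (coboundary (interval_complex n k \<mu>) q ` cochains (interval_complex n k \<mu>) q :: (wpartition list \<Rightarrow> 'k::field) set)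
    (perm_act (\<lambda>\<tau>. map (wp_act \<tau>)))"
  unfolding stable_action_def
proof (intro conjI allI impI)
  let ?\<Delta> = "interval_complex n k \<mu>"
  let ?a = "perm_act (\<lambda>\<tau>. map (wp_act \<tau>)) :: _ \<Rightarrow> (wpartition list \<Rightarrow> 'k) \<Rightarrow> _"
  show "fun_space.subspace (cochains ?\<Delta> r :: (wpartition list \<Rightarrow> 'k) set)" by (rule subspace_cochains)
  show "fun_space.subspace (coboundary ?\<Delta> q ` cochains ?\<Delta> q :: (wpartition list \<Rightarrow> 'k) set)"
    by (rule vector_space_pair.linear_subspace_image[OF vector_space_pair_fun flinear_coboundary subspace_cochains])
  fix \<tau> :: "nat \<Rightarrow> nat" assume \<tau>: "\<tau> permutes {1..n}"
  show "flinear (?a \<tau>)" by (rule flinear_perm_act)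
  have coch: "?a \<tau> \<phi> \<in> cochains ?\<Delta> s" if "\<phi> \<in> cochains ?\<Delta> s" for \<phi> s
    unfolding cochains_def mem_Collect_eq
  proof (intro allI impI)
    fix c assume "c \<notin> faces ?\<Delta> s"
    then have "map (wp_act (inv \<tau>)) c \<notin> faces ?\<Delta> s"
      using faces_act[OF \<tau> n, of "map (wp_act (inv \<tau>)) c" k s] unfolding map_wp_act_inverse[OF \<tau>] by blast
    then show "?a \<tau> \<phi> c = 0" using that by (simp add: cochains_def perm_act_def)
  qed
  then show "?a \<tau> ` cochains ?\<Delta> r \<subseteq> cochains ?\<Delta> r" by blast
  show "?a \<tau> ` coboundary ?\<Delta> q ` cochains ?\<Delta> q \<subseteq> coboundary ?\<Delta> q ` cochains ?\<Delta> q"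
  proof
    fix x assume "x \<in> ?a \<tau> ` coboundary ?\<Delta> q ` cochains ?\<Delta> q"
    then obtain \<phi> where \<phi>: "\<phi> \<in> cochains ?\<Delta> q" "x = ?a \<tau> (coboundary ?\<Delta> q \<phi>)" by blast
    show "x \<in> coboundary ?\<Delta> q ` cochains ?\<Delta> q"
      unfolding \<phi>(2) coboundary_act[OF \<tau> n] using coch[OF \<phi>(1)] by (rule imageI)
  qed
  show "?a \<tau> (?a (inv \<tau>) f) = f" for f
    unfolding perm_act_def permutes_inv_inv[OF \<tau>] map_wp_act_inverse[OF \<tau>] by (rule refl)
qed

section \<open>The isomorphism\<close>

text \<open>Bracketed permutations may use any positive type, but content \<mu> forces the types
  into \<open>{1..k}\<close>; so the generators of \<open>Lie\<close> are the single trees whose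
  partition is the top.\<close>

lemma content_perms_iff:
  assumes "Poly_Mapping.keys \<mu> \<subseteq> {1..k}"
  shows "t \<in> {t \<in> bracketed_perms n. \<forall>j. count_list (bracket_types t) j = Poly_Mapping.lookup \<mu> j} \<longleftrightarrow>
    chain_above n k \<mu> [t] []"
proof -
  have c: "content t = \<mu> \<longleftrightarrow> (\<forall>j. count_list (bracket_types t) j = Poly_Mapping.lookup \<mu> j)"
    unfolding lookup_content[symmetric] by (auto intro: poly_mapping_eqI)
  have "set (bracket_types t) \<subseteq> {1..k}" if "content t = \<mu>"
    using that assms unfolding keys_content[symmetric] by simp
  then show ?thesis
    unfolding chain_above_single mem_Collect_eq c[symmetric] bracketed_perms_def forest_def by auto
qed

theorem theorem1p3:
  fixes n k :: nat and \<mu> :: "nat \<Rightarrow>\<^sub>0 nat"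
  assumes "n \<ge> 1" and "k \<ge> 1" and "\<mu> \<in> wcomp (n - 1)" and "Poly_Mapping.keys \<mu> \<subseteq> {1..k}"
  shows "rep_iso n
    (Lie n \<mu> :: ('k::field, (nat bracketing \<Rightarrow> 'k) set) rep)
    (tensor_rep
      (reduced_cohomology (open_interval_complex (wp_less n k) (wp_bot n) (wp_top n \<mu>))
         wp_act (int n - 3))
      sgn_rep)"
proof -
  let ?\<Delta> = "interval_complex n k \<mu>"
  let ?r = "int n - 3"
  note n = assms(1) and \<mu> = assms(3,4)
  let ?act = "perm_act map_bracketing :: _ \<Rightarrow> (nat bracketing \<Rightarrow> 'k) \<Rightarrow> _"
  let ?chact = "perm_act (\<lambda>\<tau>. map (wp_act \<tau>)) :: _ \<Rightarrow> (wpartition list \<Rightarrow> 'k) \<Rightarrow> _"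
  define T where "T = {t \<in> bracketed_perms n. \<forall>j. count_list (bracket_types t) j = Poly_Mapping.lookup \<mu> j}"
  have T: "t \<in> T \<longleftrightarrow> chain_above n k \<mu> [t] []" for t
    unfolding T_def by (rule content_perms_iff[OF \<mu>(2)])
  define V where "V = (fun_space.span (basis_fun ` T) :: (nat bracketing \<Rightarrow> 'k) set)"
  define W where "W = (lie_relations n :: (nat bracketing \<Rightarrow> 'k) set)"
  define V' where "V' = (cochains ?\<Delta> ?r :: (wpartition list \<Rightarrow> 'k) set)"
  define B where "B = (coboundary ?\<Delta> (?r - 1) ` cochains ?\<Delta> (?r - 1) :: (wpartition list \<Rightarrow> 'k) set)"
  have Vs: "fun_space.subspace V" and Ws: "fun_space.subspace W"
    unfolding V_def W_def lie_relations_def by (rule fun_space.subspace_span)+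
  have st: "stable_action n V' B ?chact"
    unfolding V'_def B_def by (rule cohomology_stable_action[OF n \<mu>(1)])
  then have V's: "fun_space.subspace V'" and Bs: "fun_space.subspace B" by (simp_all add: stable_action_def)
  have V'_span: "V' = fun_space.span (basis_fun ` faces ?\<Delta> ?r)"
    unfolding V'_def by (rule cochains_span[OF finite_faces[OF n \<mu>(1)]])
  have B_span: "B = fun_space.span (coboundary ?\<Delta> (?r - 1) ` basis_fun ` faces ?\<Delta> (?r - 1))"
    unfolding B_def cochains_span[OF finite_faces[OF n \<mu>(1)]]
    by (rule vector_space_pair.linear_span_image[OF vector_space_pair_fun flinear_coboundary, symmetric])

  text \<open>Congruences modulo \<open>W\<close> and \<open>B\<close> become equations after applying projections.\<close>
  obtain \<pi>W :: "(nat bracketing \<Rightarrow> 'k) \<Rightarrow> nat bracketing \<Rightarrow> 'k"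
    where \<pi>W: "flinear \<pi>W" "\<And>v. \<pi>W v = 0 \<longleftrightarrow> v \<in> W"
    using exists_projection[OF Ws] by blast
  obtain \<pi>B :: "(wpartition list \<Rightarrow> 'k) \<Rightarrow> wpartition list \<Rightarrow> 'k"
    where \<pi>B: "flinear \<pi>B" "\<And>v. \<pi>B v = 0 \<longleftrightarrow> v \<in> B"
    using exists_projection[OF Bs] by blast
  define \<phi> where "\<phi> t = \<pi>W (basis_fun t)" for t
  \<comment> \<open>\<open>basis_fun\<close> and \<psi>0 give the actual maps, \<phi> and \<psi>
    their images modulo relations, to which the theory of tree and chain functions applies.\<close>
  define \<psi>0 where "\<psi>0 c = (basis_fun (butlast c) :: wpartition list \<Rightarrow> 'k)" for c
  define \<psi> where "\<psi> c = \<pi>B (\<psi>0 c)" for c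

  have tf: "tree_function n k \<mu> \<phi>"
    unfolding tree_function_def
  proof (intro allI impI)
    fix ts assume ts: "lie_rel ts" "\<forall>t\<in>set ts. chain_above n k \<mu> [t] []"
    then have "set ts \<subseteq> bracketed_perms n" using T by (auto simp: T_def)
    then have "(\<Sum>t\<leftarrow>ts. basis_fun t) \<in> W"
      unfolding W_def lie_relations_def using ts(1) by (intro fun_space.span_base) blast
    then show "(\<Sum>t\<leftarrow>ts. \<phi> t) = 0"
      unfolding \<phi>_def flinear_sum_list[OF \<pi>W(1), symmetric] using \<pi>W(2) by blast
  qed
  have cf: "chain_function n k \<mu> \<psi>"
    unfolding chain_function_def
  proof (intro allI impI)
    fix pre P P' c
    assume pre: "path n k (wp_bot n) pre P" and c: "path n k P' c (wp_top n \<mu>)"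
    show "(\<Sum>Q\<in>mid n k P P'. \<psi> (pre @ Q # P' # c)) = 0"
    proof (cases "mid n k P P' = {}")
      case False
      \<comment> \<open>A filling guarantees that \<open>P\<close> and \<open>P'\<close> are two
        ranks apart and that its deletion leaves a face.\<close>
      then obtain Q where Q: "Q \<in> mid n k P P'" by blast
      note g = gap_face[OF n \<mu>(1) pre c Q]
      have "coboundary ?\<Delta> (?r - 1) (basis_fun (butlast (pre @ P' # c))) \<in> B"
        unfolding B_def using basis_fun_cochain[OF g(1)] by blast
      then have "sg (length pre) (\<Sum>Q\<in>mid n k P P'. \<psi>0 (pre @ Q # P' # c)) \<in> B"
        unfolding coboundary_gap[OF g(2) \<mu> pre c g(3)] \<psi>0_def .
      then have "\<pi>B (sg (length pre) (\<Sum>Q\<in>mid n k P P'. \<psi>0 (pre @ Q # P' # c))) = 0"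
        using \<pi>B(2) by blast
      then show ?thesis
        unfolding flinear_sg[OF \<pi>B(1)] flinear_sum[OF \<pi>B(1)] \<psi>_def sg_simps .
    qed simp
  qed

  \<comment> \<open>\<open>F\<close> vanishes on trees of other contents, because \<open>W\<close>
    contains the relations of all contents and these must be sent into \<open>B\<close> as
    well.\<close>
  obtain F where F: "flinear F" "\<And>t. F (basis_fun t) = (if t \<in> T then chain_sum \<psi>0 [] [t] [] else 0)"
    using exists_flinear[of "\<lambda>t. if t \<in> T then chain_sum \<psi>0 [] [t] [] else 0"] by blast
  \<comment> \<open>\<open>G\<close> closes a top face to a maximal path and builds its tree,
    starting from the sorted leaves.\<close>
  obtain G :: "(wpartition list \<Rightarrow> 'k) \<Rightarrow> nat bracketing \<Rightarrow> 'k" where G: "flinear G" "\<And>d. G (basis_fun d) =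
      (if d \<in> faces ?\<Delta> ?r then tree_sum basis_fun (leaves n) (close_chain n \<mu> d) else 0)"
    using exists_flinear[of "\<lambda>d. if d \<in> faces ?\<Delta> ?r then tree_sum basis_fun (leaves n) (close_chain n \<mu> d) else 0"]
    by blast
  have \<pi>F: "\<pi>B (F (basis_fun t)) = chain_sum \<psi> [] [t] []" if "t \<in> T" for t
  proof -
    have "\<psi> = (\<lambda>c. \<pi>B (\<psi>0 c))" by (rule ext) (rule \<psi>_def)
    then show ?thesis
      using that additive_chain_sum[OF additive_flinear[OF \<pi>B(1)]] by (simp add: F(2))
  qed
  have \<pi>G: "\<pi>W (G (\<psi>0 c)) = tree_sum \<phi> (leaves n) c" if c: "path n k (wp_bot n) c (wp_top n \<mu>)" for c
  proof -
    have "\<phi> = (\<lambda>t. \<pi>W (basis_fun t))" by (rule ext) (rule \<phi>_def)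
    then show ?thesis
      using path_butlast_face[OF n \<mu>(1) c] additive_tree_sum[OF additive_flinear[OF \<pi>W(1)]]
      by (simp add: G(2) \<psi>0_def del: upt_Suc)
  qed
  have face: "path n k (wp_bot n) (close_chain n \<mu> d) (wp_top n \<mu>)" "\<psi>0 (close_chain n \<mu> d) = basis_fun d"
    if "d \<in> faces ?\<Delta> ?r" for d
    using face_close_path[OF n \<mu> that] by (simp_all add: \<psi>0_def)

  have FW: "F v \<in> B" if "v \<in> W" for v
  proof -
    let ?gen = "{(\<Sum>t\<leftarrow>ts. basis_fun t) | ts. lie_rel ts \<and> set ts \<subseteq> bracketed_perms n} :: (nat bracketing \<Rightarrow> 'k) set"
    have "\<pi>B (F x) = 0" if x: "x \<in> ?gen" for x
    proof -
      obtain ts where ts: "x = (\<Sum>t\<leftarrow>ts. basis_fun t)" "lie_rel ts" "set ts \<subseteq> bracketed_perms n"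
        using x by blast
      have \<pi>x: "\<pi>B (F x) = (\<Sum>t\<leftarrow>ts. \<pi>B (F (basis_fun t)))"
        unfolding ts(1) flinear_sum_list[OF F(1)] flinear_sum_list[OF \<pi>B(1)] ..
      show ?thesis
      proof (cases "set ts \<subseteq> T")
        case True
        then have "\<pi>B (F x) = (\<Sum>t\<leftarrow>ts. chain_sum \<psi> [] [t] [])"
          unfolding \<pi>x using \<pi>F by (intro arg_cong[of _ _ sum_list] map_cong) auto
        also have "\<dots> = 0"
          using tree_function_chain_sum[OF cf] ts(2) True T unfolding tree_function_def by blast
        finally show ?thesis .
      next
        case False
        then obtain t0 where t0: "t0 \<in> set ts" "t0 \<notin> T" by blast
        \<comment> \<open>By homogeneity a relation with one term outside content \<mu> has all its
          terms outside.\<close>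
        have "t \<notin> T" if "t \<in> set ts" for t
        proof -
          have "content t = content t0" using lie_rel_same[OF ts(2)] that t0(1) by metis
          moreover have "t \<in> bracketed_perms n" "t0 \<in> bracketed_perms n" using ts(3) that t0(1) by blast+
          ultimately show ?thesis using t0(2) unfolding T_def mem_Collect_eq lookup_content[symmetric] by metis
        qed
        then have "\<pi>B (F (basis_fun t)) = 0" if "t \<in> set ts" for t
          using that by (simp add: F(2) flinear_0[OF \<pi>B(1)])
        then have "(\<Sum>t\<leftarrow>ts. \<pi>B (F (basis_fun t))) = (\<Sum>t\<leftarrow>ts. 0)"
          by (intro arg_cong[of _ _ sum_list] map_cong refl)
        then show ?thesis unfolding \<pi>x by simp
      qed
    qed
    then have "\<pi>B (F v) = 0"
      by (rule flinear_eq_on_span[OF flinear_compose[OF F(1) \<pi>B(1)] flinear_zero])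
        (use that in \<open>simp_all add: W_def lie_relations_def\<close>)
    then show ?thesis using \<pi>B(2) by blast
  qed
  have GB: "\<pi>W (G b) = 0" if "b \<in> B" for b
  proof (rule flinear_eq_on_span[OF flinear_compose[OF G(1) \<pi>W(1)] flinear_zero _ that[unfolded B_span]])
    fix x :: "wpartition list \<Rightarrow> 'k" assume "x \<in> coboundary ?\<Delta> (?r - 1) ` basis_fun ` faces ?\<Delta> (?r - 1)"
    then obtain e where e: "e \<in> faces ?\<Delta> (?r - 1)" "x = coboundary ?\<Delta> (?r - 1) (basis_fun e)" by blast
    obtain pre P P' c where g: "e = butlast (pre @ P' # c)" "path n k (wp_bot n) pre P"
      "path n k P' c (wp_top n \<mu>)" "card P = Suc (Suc (card P'))" "n \<ge> 2"
      using face_gap[OF n \<mu> e(1)] by blast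
    have "\<pi>W (G x) = sg (length pre) (\<Sum>Q\<in>mid n k P P'. \<pi>W (G (\<psi>0 (pre @ Q # P' # c))))"
      unfolding e(2) g(1) coboundary_gap[OF g(5) \<mu> g(2-4)] \<psi>0_def
        flinear_sg[OF G(1)] flinear_sum[OF G(1)] flinear_sg[OF \<pi>W(1)] flinear_sum[OF \<pi>W(1)] ..
    also have "(\<Sum>Q\<in>mid n k P P'. \<pi>W (G (\<psi>0 (pre @ Q # P' # c)))) =
        (\<Sum>Q\<in>mid n k P P'. tree_sum \<phi> (leaves n) (pre @ Q # P' # c))"
    proof (rule sum.cong[OF refl])
      fix Q assume "Q \<in> mid n k P P'"
      then have "path n k (wp_bot n) (pre @ Q # P' # c) (wp_top n \<mu>)"
        using g(2,3) unfolding path_append mid_def by auto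
      then show "\<pi>W (G (\<psi>0 (pre @ Q # P' # c))) = tree_sum \<phi> (leaves n) (pre @ Q # P' # c)" by (rule \<pi>G)
    qed
    also have "\<dots> = 0"
      using chain_function_tree_sum[OF tf] g(2,3) unfolding chain_function_def by blast
    finally show "\<pi>W (G x) = 0" unfolding sg_simps .
  qed
  have GF: "\<pi>W (G (F v)) = \<pi>W v" if "v \<in> V" for v
  proof (rule flinear_eq_on_span[OF flinear_compose[OF flinear_compose[OF F(1) G(1)] \<pi>W(1)] \<pi>W(1) _ that[unfolded V_def]])
    fix x :: "nat bracketing \<Rightarrow> 'k" assume "x \<in> basis_fun ` T"
    then obtain t where t: "t \<in> T" "x = basis_fun t" by blast
    have c: "chain_above n k \<mu> [t] []" using t(1) T by blast
    have "\<pi>W (G (F x)) = chain_sum (\<lambda>c. \<pi>W (G (\<psi>0 c))) [] [t] []"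
      using t additive_chain_sum[OF additive_flinear[OF flinear_compose[OF G(1) \<pi>W(1)]]] by (simp add: F(2))
    \<comment> \<open>\<pi>G holds for maximal chains only, and these are the only arguments at
      which \<open>chain_sum\<close> evaluates its function.\<close>
    also have "\<dots> = chain_sum (tree_sum \<phi> (leaves n)) [] [t] []"
      by (rule chain_sum_cong[OF c \<pi>G])
    also have "\<dots> = \<pi>W x"
      unfolding chain_sum_tree_sum[OF tf c] using t(2) by (simp add: \<phi>_def)
    finally show "\<pi>W (G (F x)) = \<pi>W x" .
  qed
  have FG: "\<pi>B (F (G v)) = \<pi>B v" if "v \<in> V'" for v
  proof (rule flinear_eq_on_span[OF flinear_compose[OF flinear_compose[OF G(1) F(1)] \<pi>B(1)] \<pi>B(1) _ that[unfolded V'_span]])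
    fix x :: "wpartition list \<Rightarrow> 'k" assume "x \<in> basis_fun ` faces ?\<Delta> ?r"
    then obtain d where d: "d \<in> faces ?\<Delta> ?r" "x = basis_fun d" by blast
    have c: "chain_above n k \<mu> (leaves n) (close_chain n \<mu> d)"
      unfolding chain_above_def part_leaves using forest_leaves face(1)[OF d(1)] by blast
    have "\<pi>B (F (G x)) = tree_sum (\<lambda>t. \<pi>B (F (basis_fun t))) (leaves n) (close_chain n \<mu> d)"
      using d additive_tree_sum[OF additive_flinear[OF flinear_compose[OF F(1) \<pi>B(1)]]] by (simp add: G(2))
    also have "\<dots> = tree_sum (\<lambda>t. chain_sum \<psi> [] [t] []) (leaves n) (close_chain n \<mu> d)"
      by (rule tree_sum_cong[OF c]) (use \<pi>F T in blast)
    also have "\<dots> = \<psi> (close_chain n \<mu> d)"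
      by (rule tree_sum_chain_sum[OF cf face(1)[OF d(1)]])
    also have "\<dots> = \<pi>B x" unfolding \<psi>_def face(2)[OF d(1)] d(2) ..
    finally show "\<pi>B (F (G x)) = \<pi>B x" .
  qed
  have FV: "F ` V \<subseteq> V'"
    unfolding V_def
  proof (rule flinear_span_image[OF F(1) _ V's])
    fix x assume "x \<in> (basis_fun ` T :: (nat bracketing \<Rightarrow> 'k) set)"
    then obtain t where t: "t \<in> T" "x = basis_fun t" by blast
    have f: "forest n k (map Letter [] @ [t])" and top: "part [t] = wp_top n \<mu>"
      using t(1) T by (simp_all add: chain_above_def del: part_simps)
    \<comment> \<open>A tree goes to one maximal chain up to sign, so its image is a cochain of top
      degree.\<close>
    obtain m pre where m: "path n k (wp_bot n) pre (part (map Letter [] @ [t]))"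
      "\<And>\<psi> d. chain_sum \<psi> [] [t] d = sg m (\<psi> (pre @ d) :: wpartition list \<Rightarrow> 'k)"
      using chain_sum_prefix[OF f] by blast
    have pre: "path n k (wp_bot n) pre (wp_top n \<mu>)" using m(1) top by (simp del: part_simps)
    have "\<psi>0 (pre @ []) \<in> V'"
      unfolding \<psi>0_def V'_def append_Nil2 by (rule basis_fun_cochain[OF path_butlast_face(1)[OF n \<mu>(1) pre]])
    moreover have "F x = sg m (\<psi>0 (pre @ []))" using t m(2) by (simp add: F(2))
    ultimately show "F x \<in> V'" using subspace_sg[OF V's] by simp
  qed
  have GV: "G ` V' \<subseteq> V"
    unfolding V'_span
  proof (rule flinear_span_image[OF G(1) _ Vs])
    fix x :: "wpartition list \<Rightarrow> 'k" assume "x \<in> basis_fun ` faces ?\<Delta> ?r"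
    then obtain d where d: "d \<in> faces ?\<Delta> ?r" "x = basis_fun d" by blast
    have c: "chain_above n k \<mu> (leaves n) (close_chain n \<mu> d)"
      unfolding chain_above_def part_leaves using forest_leaves face(1)[OF d(1)] by blast
    obtain m t where t: "chain_above n k \<mu> [t] []"
      "\<And>\<phi> :: _ \<Rightarrow> nat bracketing \<Rightarrow> 'k. tree_sum \<phi> (leaves n) (close_chain n \<mu> d) = sg m (\<phi> t)"
      using tree_sum_single[OF c] by blast
    have "basis_fun t \<in> V" unfolding V_def using t(1) T by (intro fun_space.span_base imageI) blast
    moreover have "G x = sg m (basis_fun t)" unfolding d(2) G(2) t(2) using d(1) by simp
    ultimately show "G x \<in> V" using subspace_sg[OF Vs] by simp
  qed
  \<comment> \<open>Equivariance holds exactly and not only modulo \<open>B\<close>, since a tree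
    and its relabelling are split in the same order.\<close>
  have eqv: "F (?act \<tau> v) = fscale (of_int (sign \<tau>)) (?chact \<tau> (F v))" if \<tau>: "\<tau> permutes {1..n}" and v: "v \<in> V" for \<tau> v
  proof (rule flinear_eq_on_span[OF flinear_compose[OF flinear_perm_act F(1)]
        flinear_compose[OF flinear_compose[OF F(1) flinear_perm_act] flinear_fscale] _ v[unfolded V_def]])
    fix x assume "x \<in> (basis_fun ` T :: (nat bracketing \<Rightarrow> 'k) set)"
    then obtain t where t: "t \<in> T" "x = basis_fun t" by blast
    have f: "forest n k (map Letter [] @ [t])"
      using t(1) T by (simp add: chain_above_def)
    have ax: "?act \<tau> x = basis_fun (map_bracketing \<tau> t)"
      unfolding t(2) by (rule perm_act_basis_fun[of map_bracketing \<tau>, OF map_bracketing_inverse[OF \<tau>]])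
    have "map_bracketing \<tau> t \<in> T"
      using t(1) bracketed_perms_map[OF \<tau>] by (simp add: T_def)
    then have "F (?act \<tau> x) = chain_sum \<psi>0 [] [map_bracketing \<tau> t] []"
      unfolding ax F(2) by simp
    also have "\<dots> = sg (perm_parity \<tau>) (chain_sum (\<lambda>d. \<psi>0 (map (wp_act \<tau>) d)) [] [t] [])"
      using chain_sum_equivariant[OF \<tau> f, of \<psi>0 "[]"] by simp
    also have "(\<lambda>d. \<psi>0 (map (wp_act \<tau>) d)) = (\<lambda>d. ?chact \<tau> (\<psi>0 d))"
      unfolding \<psi>0_def perm_act_basis_fun[of "\<lambda>\<tau>. map (wp_act \<tau>)", OF map_wp_act_inverse[OF \<tau>]] map_butlast ..
    also have "chain_sum (\<lambda>d. ?chact \<tau> (\<psi>0 d)) [] [t] [] = ?chact \<tau> (F x)"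
      unfolding t(2) F(2) if_P[OF t(1)]
      by (rule additive_chain_sum[OF additive_flinear[OF flinear_perm_act], symmetric])
    also have "sg (perm_parity \<tau>) (?chact \<tau> (F x)) = fscale (of_int (sign \<tau>)) (?chact \<tau> (F x))"
      by (auto simp: sg_perm_parity fscale_def sign_def fun_eq_iff)
    finally show "F (?act \<tau> x) = fscale (of_int (sign \<tau>)) (?chact \<tau> (F x))" .
  qed

  \<comment> \<open>The sign first appears as a twist of the action on cochains;
    \<open>tensor_sgn_iso\<close> then turns the twist into a tensor factor.\<close>
  have iso: "rep_iso n (Lie n \<mu> :: ('k, (nat bracketing \<Rightarrow> 'k) set) rep)
      (subquotient V' B (\<lambda>\<tau> f. fscale (of_int (sign \<tau>)) (?chact \<tau> f)))"
    unfolding Lie_def Lie_P_def T_def[symmetric] V_def[symmetric] W_def[symmetric]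
  proof (rule subquotient_iso[OF Vs Ws V's stable_action_twist[OF st] flinear_perm_act _ F(1) _ FV])
    show "?act \<tau> ` W \<subseteq> W" if "\<tau> permutes {1..n}" for \<tau>
      unfolding W_def by (rule lie_relations_act[OF that])
    show "F ` W \<subseteq> B" using FW by blast
    show "v \<in> W" if "v \<in> V" "F v \<in> B" for v
    proof -
      have "\<pi>W v = 0" using GB[OF that(2)] unfolding GF[OF that(1)] .
      then show ?thesis using \<pi>W(2) by blast
    qed
    show "\<exists>v\<in>V. F v - v' \<in> B" if v': "v' \<in> V'" for v'
    proof
      show "G v' \<in> V" using GV v' by blast
      have "\<pi>B (F (G v') - v') = 0" unfolding flinear_diff[OF \<pi>B(1)] FG[OF v'] by simp
      then show "F (G v') - v' \<in> B" using \<pi>B(2) by blast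
    qed
    show "F (?act \<tau> v) - fscale (of_int (sign \<tau>)) (?chact \<tau> (F v)) \<in> B" if "\<tau> permutes {1..n}" "v \<in> V" for \<tau> v
      unfolding eqv[OF that] using fun_space.subspace_0[OF Bs] by simp
  qed
  \<comment> \<open>There are no faces above degree \<open>n - 3\<close>, so the cocycle condition
    is void.\<close>
  have cohomology: "reduced_cohomology ?\<Delta> wp_act ?r = subquotient V' B ?chact"
  proof -
    have "coboundary ?\<Delta> ?r \<phi> = (0 :: wpartition list \<Rightarrow> 'k)" for \<phi>
      using faces_above_empty[OF n \<mu>] by (simp add: coboundary_def fun_eq_iff)
    then show ?thesis unfolding reduced_cohomology_def V'_def B_def by simp
  qed
  show ?thesis
    unfolding cohomology by (rule rep_iso_trans[OF iso tensor_sgn_iso[OF st]])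
qed

end
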